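(* Let $\left(\tau,(F_I)_{I\in\mathscr{L}(\tau)},(C_I)_{I\in\mathscr{B}(\tau)}\right)$ be an aggregation tree model in which every leaf distribution $F_I$, $I\in\mathscr{L}(\tau)$, is the distribution function of a discrete random variable. Assume that for every branching node $I\in\mathscr{B}(\tau)$ the copula $C_I$ is absolutely continuous with density $c_I$ and satisfies \[ \lim_{\delta\to 0}\ \sup_{t\in\mathbb{R}}\int_{U_\delta(B_I(t))} c_I(u_1,\ldots,u_{N_I})\,du_1\cdots du_{N_I}=0 . \] For $n\in\mathbb{N}$ and $I\in\mathscr{B}(\tau)$ let $G_I^n$ and $F_I^n$ be the empirical distribution functions produced by the modified reordering algorithm (MRA) with parameter $n$ at node $I$. Then for each branching node $I\in\mathscr{B}(\tau)$, \[ \lim_{n\to\infty}\sup_{\boldsymbol{x}\in\mathbb{R}^{N_I}}\left|G_I^n(\boldsymbol{x})-G_I(\boldsymbol{x})\right|=0 \quad P\text{-a.s.},\qquad \lim_{n\to\infty}\sup_{t\in\mathbb{R}}\left|F_I^n(t)-F_I(t)\right|=0 \quad P\text{-a.s.} \]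
   Context: Rooted tree: a finite set $\tau$ of nodes containing the root $\varnothing$, the other nodes being tuples $(i_1,\ldots,i_d)$ of positive integers; a node $I$ has $N_I\ge 0$ children $(I,1),\ldots,(I,N_I)\in\tau$, and every non-root node $(i_1,\ldots,i_d)$ has parent $(i_1,\ldots,i_{d-1})\in\tau$. Leaves $\mathscr{L}(\tau)=\{I:N_I=0\}$, branching nodes $\mathscr{B}(\tau)=\{I:N_I>0\}$, $\mathscr{LD}(I)$ = leaves that are descendants of $I$ (including $I$ itself if it is a leaf). An aggregation tree model consists of $\tau$, univariate distribution functions $F_I$ for the leaves, and copulas $C_I:[0,1]^{N_I}\to[0,1]$ for the branching nodes. Recursively, for $I\in\mathscr{B}(\tau)$ define $G_I(x_1,\ldots,x_{N_I})=C_I(F_{I,1}(x_1),\ldots,F_{I,N_I}(x_{N_I}))$ and let $F_I(t)=\int\mathbb{1}\{x_1+\cdots+x_{N_I}\le t\}\,dG_I(x_1,\ldots,x_{N_I})$ (the distribution function of the sum of the children). For $I\in\mathscr{B}(\tau)$ and $t\in\mathbb{R}$, $B_I(t)=\{(F_{I,1}(x_1),\ldots,F_{I,N_I}(x_{N_I})):(x_1,\ldots,x_{N_I})\in\mathbb{R}^{N_I},\ x_1+\cdots+x_{N_I}=t\}$ and $U_\delta(B_I(t))=\{\boldsymbol{x}\in[0,1]^{N_I}:\|\boldsymbol{x}-\boldsymbol{y}\|_2<\delta\text{ for some }\boldsymbol{y}\in B_I(t)\}$. MRA with parameter $n$: a call of the MRA at node $I$ returns a random batch $(X_I^k,\boldsymbol{X}_I^k)_{k=1}^n$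 with $X_I^k\in\mathbb{R}$ and $\boldsymbol{X}_I^k\in\mathbb{R}^{\mathscr{LD}(I)}$ (components summing to $X_I^k$); different calls use independent randomness. If $I$ is a leaf, the batch consists of $n$ i.i.d. draws $X_I^k\sim F_I$ and $\boldsymbol{X}_I^k=(X_I^k)$. If $I$ is a branching node: for each $\ell=1,\ldots,n$, independently over $\ell$, obtain for each child $i=1,\ldots,N_I$ a batch $({}^{\ell}X_{I,i}^k,{}^{\ell}\boldsymbol{X}_{I,i}^k)_{k=1}^n$ by an independent call of the MRA at node $(I,i)$, and $n$ i.i.d. samples ${}^{\ell}\boldsymbol{U}_I^k=({}^{\ell}U_I^{k,1},\ldots,{}^{\ell}U_I^{k,N_I})\sim C_I$, $k=1,\ldots,n$, all independent. Let ${}^{\ell}p_{I,i}(k)$ be the rank of ${}^{\ell}U_I^{k,i}$ among ${}^{\ell}U_I^{1,i},\ldots,{}^{\ell}U_I^{n,i}$, and let ${}^{\ell}q_{I,i}$ be the permutation of $\{1,\ldots,n\}$ with ${}^{\ell}q_{I,i}(k)$ the rank of ${}^{\ell}X_{I,i}^k$ among ${}^{\ell}X_{I,i}^1,\ldots,{}^{\ell}X_{I,i}^n$ (ties broken so that it is a permutation). Put $\sigma_i^{\ell}={}^{\ell}q_{I,i}^{-1}\circ{}^{\ell}p_{I,i}\circ{}^{\ell}p_{I,1}^{-1}\circ{}^{\ell}q_{I,1}$ (so $\sigma_1^\ell$ is the identity). The output batch at $I$ is, for $k=1,\ldots,n$: $\boldsymbol{Y}_I^k=({}^{k}X_{I,1}^{\sigma_1^k(k)},\ldots,{}^{k}X_{I,N_I}^{\sigma_{N_I}^k(k)})$,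 $X_I^k=\sum_{i=1}^{N_I}{}^{k}X_{I,i}^{\sigma_i^k(k)}$, and $\boldsymbol{X}_I^k$ the concatenation of ${}^{k}\boldsymbol{X}_{I,i}^{\sigma_i^k(k)}$, $i=1,\ldots,N_I$. Then $G_I^n(\boldsymbol{x})=\frac1n\sum_{k=1}^n\mathbb{1}\{\boldsymbol{Y}_I^k\le\boldsymbol{x}\}$ (componentwise) and $F_I^n(t)=\frac1n\sum_{k=1}^n\mathbb{1}\{X_I^k\le t\}$. *)

theory Defs
  imports "HOL-Probability.Probability"
begin

text \<open>Nodes are lists of naturals; the root is the empty list; the children of a node J
  are J @ [i] for i = 1, ..., N_J.\<close>

definition nchild :: "nat list set \<Rightarrow> nat list \<Rightarrow> nat" where
  "nchild \<tau> J = card {i. J @ [i] \<in> \<tau>}"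

definition agg_tree :: "nat list set \<Rightarrow> bool" where
  "agg_tree \<tau> \<longleftrightarrow> finite \<tau> \<and> [] \<in> \<tau> \<and>
     (\<forall>J i. J @ [i] \<in> \<tau> \<longrightarrow> J \<in> \<tau>) \<and>
     (\<forall>J\<in>\<tau>. \<forall>i. J @ [i] \<in> \<tau> \<longleftrightarrow> i \<in> {1..nchild \<tau> J})"

definition leaves :: "nat list set \<Rightarrow> nat list set" where
  "leaves \<tau> = {J \<in> \<tau>. nchild \<tau> J = 0}"

definition branching :: "nat list set \<Rightarrow> nat list set" where
  "branching \<tau> = {J \<in> \<tau>. 0 < nchild \<tau> J}"

definition discrete_distr :: "real measure \<Rightarrow> bool" where
  "discrete_distr M \<longleftrightarrow> (\<exists>D. countable D \<and> (AE x in M. x \<in> D))"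

text \<open>A copula of dimension n, represented by its probability law on [0,1]^n
  (components indexed by 1..n): uniform one-dimensional marginals.\<close>
definition is_copula :: "nat \<Rightarrow> (nat \<Rightarrow> real) measure \<Rightarrow> bool" where
  "is_copula n M \<longleftrightarrow> prob_space M \<and> sets M = sets (PiM {1..n} (\<lambda>_. lborel)) \<and>
     (AE u in M. \<forall>i\<in>{1..n}. u i \<in> {0..1}) \<and>
     (\<forall>i\<in>{1..n}. \<forall>v\<in>{0..1}. measure M {u \<in> space M. u i \<le> v} = v)"

definition cop_fun :: "nat \<Rightarrow> (nat \<Rightarrow> real) measure \<Rightarrow> (nat \<Rightarrow> real) \<Rightarrow> real" where
  "cop_fun n M u = measure M {v \<in> space M. \<forall>i\<in>{1..n}. v i \<le> u i}"

definition G_fun :: "nat list set \<Rightarrow> (nat list \<Rightarrow> (nat \<Rightarrow> real) measure) \<Rightarrow>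
    (nat list \<Rightarrow> real \<Rightarrow> real) \<Rightarrow> nat list \<Rightarrow> (nat \<Rightarrow> real) \<Rightarrow> real" where
  "G_fun \<tau> C F J x = cop_fun (nchild \<tau> J) (C J) (\<lambda>i. F (J @ [i]) (x i))"

definition agg_F :: "nat list set \<Rightarrow> (nat list \<Rightarrow> real measure) \<Rightarrow>
    (nat list \<Rightarrow> (nat \<Rightarrow> real) measure) \<Rightarrow> (nat list \<Rightarrow> real \<Rightarrow> real) \<Rightarrow> bool" where
  "agg_F \<tau> L C F \<longleftrightarrow>
     (\<forall>J\<in>leaves \<tau>. F J = cdf (L J)) \<and>
     (\<forall>J\<in>branching \<tau>. \<exists>M. prob_space M \<and>
        sets M = sets (PiM {1..nchild \<tau> J} (\<lambda>_. borel)) \<and>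
        (\<forall>x. measure M {y \<in> space M. \<forall>i\<in>{1..nchild \<tau> J}. y i \<le> x i} = G_fun \<tau> C F J x) \<and>
        (\<forall>t. F J t = measure M {y \<in> space M. (\<Sum>i\<in>{1..nchild \<tau> J}. y i) \<le> t}))"

definition B_set :: "nat list set \<Rightarrow> (nat list \<Rightarrow> real \<Rightarrow> real) \<Rightarrow> nat list \<Rightarrow> real \<Rightarrow> (nat \<Rightarrow> real) set" where
  "B_set \<tau> F J t = {(\<lambda>i\<in>{1..nchild \<tau> J}. F (J @ [i]) (x i)) | x.
                      (\<Sum>i\<in>{1..nchild \<tau> J}. x i) = t}"

definition U_nbhd :: "nat \<Rightarrow> real \<Rightarrow> (nat \<Rightarrow> real) set \<Rightarrow> (nat \<Rightarrow> real) set" where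
  "U_nbhd n \<delta> B = {u \<in> PiE {1..n} (\<lambda>_. {0..1}).
                      \<exists>y\<in>B. sqrt (\<Sum>i\<in>{1..n}. (u i - y i)^2) < \<delta>}"

text \<open>Addresses of calls: a call at node J = I @ map snd a, where each pair (l, i) records
  that the call was made for child i in the l-th repetition of the parent call.
  Random inputs: Lf a k = k-th leaf draw of the call at address a;
  Cop a l k = k-th copula sample of the l-th repetition of the call at address a.\<close>
datatype sidx = Lf "(nat \<times> nat) list" nat | Cop "(nat \<times> nat) list" nat nat

definition node :: "nat list \<Rightarrow> (nat \<times> nat) list \<Rightarrow> nat list" where
  "node I a = I @ map snd a"

definition addr_ok :: "nat \<Rightarrow> (nat \<times> nat) list \<Rightarrow> bool" where
  "addr_ok n a \<longleftrightarrow> (\<forall>p\<in>set a. fst p \<in> {1..n})"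

definition mra_units :: "nat list set \<Rightarrow> nat list \<Rightarrow> nat \<Rightarrow> sidx set" where
  "mra_units \<tau> I n =
     {Lf a k | a k. addr_ok n a \<and> node I a \<in> leaves \<tau> \<and> k \<in> {1..n}} \<union>
     {Cop a l k | a l k. addr_ok n a \<and> node I a \<in> branching \<tau> \<and> l \<in> {1..n} \<and> k \<in> {1..n}}"

definition unit_dom :: "nat list set \<Rightarrow> nat list \<Rightarrow> sidx \<Rightarrow> nat set" where
  "unit_dom \<tau> I s = (case s of Lf a k \<Rightarrow> {0} | Cop a l k \<Rightarrow> {1..nchild \<tau> (node I a)})"

definition mra_samples :: "nat list set \<Rightarrow> (nat list \<Rightarrow> real measure) \<Rightarrow>
    (nat list \<Rightarrow> (nat \<Rightarrow> real) measure) \<Rightarrow> 'w measure \<Rightarrow> nat list \<Rightarrow> nat \<Rightarrow>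
    (sidx \<Rightarrow> 'w \<Rightarrow> nat \<Rightarrow> real) \<Rightarrow> bool" where
  "mra_samples \<tau> L C P I n S \<longleftrightarrow>
     prob_space.indep_vars P (\<lambda>s. PiM (unit_dom \<tau> I s) (\<lambda>_. borel))
        (\<lambda>s \<omega>. restrict (S s \<omega>) (unit_dom \<tau> I s)) (mra_units \<tau> I n) \<and>
     (\<forall>a k. Lf a k \<in> mra_units \<tau> I n \<longrightarrow>
        distr P borel (\<lambda>\<omega>. S (Lf a k) \<omega> 0) = L (node I a)) \<and>
     (\<forall>a l k. Cop a l k \<in> mra_units \<tau> I n \<longrightarrow>
        distr P (PiM {1..nchild \<tau> (node I a)} (\<lambda>_. borel))
          (\<lambda>\<omega>. restrict (S (Cop a l k) \<omega>) {1..nchild \<tau> (node I a)}) = C (node I a))"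

text \<open>Rank of x_j among x_1, ..., x_n, ties broken by the index (so it is a permutation
  of {1..n}), and its inverse.\<close>
definition rank :: "nat \<Rightarrow> (nat \<Rightarrow> real) \<Rightarrow> nat \<Rightarrow> nat" where
  "rank n x j = card {j' \<in> {1..n}. x j' < x j \<or> (x j' = x j \<and> j' \<le> j)}"

definition rank_inv :: "nat \<Rightarrow> (nat \<Rightarrow> real) \<Rightarrow> nat \<Rightarrow> nat" where
  "rank_inv n x r = (THE j. j \<in> {1..n} \<and> rank n x j = r)"

text \<open>Given the child batches xs i j = X_{I,i}^j and copula samples us i j = U^{j,i} of one
  repetition, the i-th component of the k-th reordered row:
  X_{I,i}^{sigma_i(k)}, sigma_i = q_i^{-1} o p_i o p_1^{-1} o q_1.\<close>
definition mra_row :: "nat \<Rightarrow> (nat \<Rightarrow> nat \<Rightarrow> real) \<Rightarrow> (nat \<Rightarrow> nat \<Rightarrow> real) \<Rightarrow> nat \<Rightarrow> nat \<Rightarrow> real" where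
  "mra_row n xs us k i =
     xs i (rank_inv n (xs i) (rank n (us i) (rank_inv n (us 1) (rank n (xs 1) k))))"

text \<open>mra_X f tau n s I a k: the value X^k of the batch returned by the call at address a
  (node I @ map snd a), given the random inputs s; f is recursion fuel (card tau suffices).\<close>
primrec mra_X :: "nat \<Rightarrow> nat list set \<Rightarrow> nat \<Rightarrow> (sidx \<Rightarrow> nat \<Rightarrow> real) \<Rightarrow> nat list \<Rightarrow>
    (nat \<times> nat) list \<Rightarrow> nat \<Rightarrow> real" where
  "mra_X 0 \<tau> n s I a k = s (Lf a k) 0"
| "mra_X (Suc f) \<tau> n s I a k =
     (if nchild \<tau> (node I a) = 0 then s (Lf a k) 0
      else (\<Sum>i\<in>{1..nchild \<tau> (node I a)}.
              mra_row n (\<lambda>i' j. mra_X f \<tau> n s I (a @ [(k, i')]) j) (\<lambda>i' j. s (Cop a k j) i') k i))"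

definition mra_Y :: "nat list set \<Rightarrow> nat \<Rightarrow> (sidx \<Rightarrow> nat \<Rightarrow> real) \<Rightarrow> nat list \<Rightarrow> nat \<Rightarrow> nat \<Rightarrow> real" where
  "mra_Y \<tau> n s I k i =
     mra_row n (\<lambda>i' j. mra_X (card \<tau>) \<tau> n s I [(k, i')] j) (\<lambda>i' j. s (Cop [] k j) i') k i"

definition emp_G :: "nat list set \<Rightarrow> nat \<Rightarrow> (sidx \<Rightarrow> nat \<Rightarrow> real) \<Rightarrow> nat list \<Rightarrow> (nat \<Rightarrow> real) \<Rightarrow> real" where
  "emp_G \<tau> n s I x =
     real (card {k \<in> {1..n}. \<forall>i\<in>{1..nchild \<tau> I}. mra_Y \<tau> n s I k i \<le> x i}) / real n"

definition emp_F :: "nat list set \<Rightarrow> nat \<Rightarrow> (sidx \<Rightarrow> nat \<Rightarrow> real) \<Rightarrow> nat list \<Rightarrow> real \<Rightarrow> real" where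
  "emp_F \<tau> n s I t =
     real (card {k \<in> {1..n}. mra_X (Suc (card \<tau>)) \<tau> n s I [] k \<le> t}) / real n"

end

theory Submission
  imports Defs
begin

text \<open>The l-th output row comes from the l-th repetition, so the rows at a node are independent and,
  by Hoeffding's inequality, their empirical law is close to its mean, the average of the row laws.
  Since the repetitions are identically distributed, this mean is the expected empirical law of all n
  rows of a single repetition. In a single repetition the reordered rows can be coupled with the
  i.i.d. vectors obtained from the copula samples by the quantile transforms of the children, which
  have the law G: in each coordinate a row and its partner occupy the same rank, so they agree except
  where the sorted child batch differs from the sorted quantile batch. For discrete laws the number of
  such ranks is small as soon as the empirical frequencies of finitely many half-lines are close to
  their limits. Climbing up the tree, the mean empirical laws converge on every Borel set. At the root,
  Borel--Cantelli gives almost sure convergence of the mass of each atom, and since the limit is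
  discrete this upgrades to convergence that is uniform over all Borel sets.\<close>

text \<open>The entries of a batch are independent but not identically distributed, their laws
  change with \<open>n\<close>, and runs for different \<open>n\<close> may depend on each other in
  any way. So no almost sure statement is carried up the tree. The induction carries the mean
  deviation of the empirical law of a batch, which is a property of the batch law at each
  \<open>n\<close> alone. It passes through the coupling by taking expectations, because every term
  of the coupling bound involves one child batch or the copula samples only. All Borel sets are
  needed: a set of values of the sum pulls back to a set of vectors that is in general neither an
  orthant nor a box, and atoms call for open and closed half-lines alike. Almost sure convergence is
  derived once, at the node \<open>I\<close>, where the Hoeffding tails are summable in
  \<open>n\<close>. Quantile vectors are the right partners of the copula samples because
  \<open>quant \<mu> u \<le> x\<close> and \<open>u \<le> cdf \<mu> x\<close> are equivalent even at
  jumps, so that their law has distribution function G exactly; ties among atoms only permute equal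
  values and leave the sorted batches unchanged.\<close>

declare One_nat_def [simp del]

subsection \<open>Ranks and the reordering of one repetition\<close>

lemma rank_strict_mono:
  assumes "j \<in> {1..n}" "j' \<in> {1..n}" "x j < x j' \<or> (x j = x j' \<and> j < j')"
  shows "rank n x j < rank n x j'"
  unfolding rank_def
proof (rule psubset_card_mono)
  let ?S = "\<lambda>j. {j' \<in> {1..n}. x j' < x j \<or> (x j' = x j \<and> j' \<le> j)}"
  have "?S j \<subseteq> ?S j'" using assms(3) by auto
  moreover have "j' \<in> ?S j'" "j' \<notin> ?S j" using assms by auto
  ultimately show "?S j \<subset> ?S j'" by blast
qed auto

text \<open>Ranks follow the lexicographic order of the pairs \<open>(x j, j)\<close>, which is
  total and strict on distinct indices. This gives injectivity, and an injective self-map of a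
  finite set is onto.\<close>

lemma bij_betw_rank: "bij_betw (rank n x) {1..n} {1..n}"
proof -
  have inj: "inj_on (rank n x) {1..n}"
  proof (rule inj_onI, rule ccontr)
    fix j j' assume *: "j \<in> {1..n}" "j' \<in> {1..n}" "rank n x j = rank n x j'" "j \<noteq> j'"
    then have "(x j < x j' \<or> (x j = x j' \<and> j < j')) \<or> (x j' < x j \<or> (x j' = x j \<and> j' < j))"
      by linarith
    then show False
      using rank_strict_mono[of j n j' x] rank_strict_mono[of j' n j x] * by auto
  qed
  have "rank n x ` {1..n} \<subseteq> {1..n}"
  proof safe
    fix j assume j: "j \<in> {1..n}"
    have "rank n x j \<le> card {1..n}" unfolding rank_def by (rule card_mono) auto
    moreover have "0 < rank n x j"
      unfolding rank_def using j by (subst card_gt_0_iff) auto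
    ultimately show "rank n x j \<in> {1..n}" by auto
  qed
  then show ?thesis
    using inj by (simp add: bij_betw_def endo_inj_surj)
qed

lemma rank_inv_eq:
  assumes "j \<in> {1..n}" "rank n x j = r" shows "rank_inv n x r = j"
  unfolding rank_inv_def
  by (rule the_equality)
     (use assms inj_onD[OF bij_betw_imp_inj_on[OF bij_betw_rank[of n x]]] in auto)

lemma rank_in: "j \<in> {1..n} \<Longrightarrow> rank n x j \<in> {1..n}"
  using bij_betw_rank[of n x] by (rule bij_betw_apply)

lemma rank_inv_in: "r \<in> {1..n} \<Longrightarrow> rank_inv n x r \<in> {1..n}"
  and rank_rank_inv: "r \<in> {1..n} \<Longrightarrow> rank n x (rank_inv n x r) = r"
proof -
  assume "r \<in> {1..n}"
  then have "r \<in> rank n x ` {1..n}"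
    using bij_betw_rank[of n x] by (simp add: bij_betw_def)
  then obtain j where "j \<in> {1..n}" "rank n x j = r"
    by blast
  then show "rank_inv n x r \<in> {1..n}" "rank n x (rank_inv n x r) = r"
    using rank_inv_eq[of j n x r] by auto
qed

lemma rank_inv_rank: "j \<in> {1..n} \<Longrightarrow> rank_inv n x (rank n x j) = j"
  by (rule rank_inv_eq) auto

lemma bij_betw_rank_inv: "bij_betw (rank_inv n x) {1..n} {1..n}"
  by (rule bij_betwI[where g = "rank n x"]) (auto intro: rank_in rank_inv_in rank_rank_inv rank_inv_rank
      simp del: atLeastAtMost_iff)

lemma rank_inv_mono:
  assumes "r \<in> {1..n}" "r' \<in> {1..n}" "r \<le> r'"
  shows "x (rank_inv n x r) \<le> x (rank_inv n x r')"
proof (rule ccontr)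
  assume "\<not> ?thesis"
  then have "rank n x (rank_inv n x r') < rank n x (rank_inv n x r)"
    using rank_inv_in[of r n x] rank_inv_in[of r' n x] assms(1,2)
    by (intro rank_strict_mono) auto
  then show False using assms rank_rank_inv[of r n x] rank_rank_inv[of r' n x] by simp
qed

lemma card_bij_vimage:
  assumes "bij_betw f A B"
  shows "card {a\<in>A. P (f a)} = card {b\<in>B. P b}"
proof (rule bij_betw_same_card[where f=f])
  show "bij_betw f {a\<in>A. P (f a)} {b\<in>B. P b}"
    using assms by (auto simp: bij_betw_def inj_on_def)
qed

lemma card_rank_inv:
  "card {r\<in>{1..n}. P (x (rank_inv n x r))} = card {j\<in>{1..n}. P (x j)}"
  using card_bij_vimage[OF bij_betw_rank_inv, of n "\<lambda>j. P (x j)" x] .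

text \<open>Two initial segments of \<open>{1..n}\<close> are nested. This turns a count of places
  of disagreement into a difference of counts, which empirical frequencies can see.\<close>

lemma card_initial_segments_diff:
  fixes S T :: "nat set"
  assumes "S \<subseteq> {1..n}" "T \<subseteq> {1..n}"
    and S: "\<And>r r'. r' \<in> S \<Longrightarrow> r \<in> {1..n} \<Longrightarrow> r \<le> r' \<Longrightarrow> r \<in> S"
    and T: "\<And>r r'. r' \<in> T \<Longrightarrow> r \<in> {1..n} \<Longrightarrow> r \<le> r' \<Longrightarrow> r \<in> T"
  shows "real (card ((S - T) \<union> (T - S))) = \<bar>real (card S) - real (card T)\<bar>"
proof -
  have fin: "finite S" "finite T" using assms(1,2) finite_subset by blast+
  have aux: "real (card ((A - B) \<union> (B - A))) = \<bar>real (card A) - real (card B)\<bar>"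
    if "A \<subseteq> B" "finite A" "finite B" for A B :: "nat set"
  proof -
    have "(A - B) \<union> (B - A) = B - A" using that by auto
    then show ?thesis
      using that card_mono[OF that(3,1)] by (simp add: card_Diff_subset)
  qed
  have "S \<subseteq> T \<or> T \<subseteq> S"
  proof (rule ccontr)
    assume "\<not> ?thesis"
    then obtain a b where "a \<in> S" "a \<notin> T" "b \<in> T" "b \<notin> S" by auto
    then show False
      using S[of a b] T[of b a] assms(1,2) by (cases "a \<le> b") auto
  qed
  then show ?thesis
    using aux[of S T] aux[of T S] fin by (auto simp: Un_commute)
qed

text \<open>For sorted sequences the sets \<open>{r. x r < a}\<close> and
  \<open>{r. x r \<le> a}\<close> are initial segments. A rank \<open>r\<close> with
  \<open>z r = a\<close> in \<open>A\<close> and \<open>x r \<noteq> a\<close> lies in the symmetric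
  difference of the strict sets or of the weak ones; ranks with \<open>z r\<close> outside
  \<open>A\<close> are simply counted.\<close>

lemma card_sorted_neq:
  fixes x z :: "nat \<Rightarrow> real"
  assumes x: "\<And>r r'. r \<in> {1..n} \<Longrightarrow> r' \<in> {1..n} \<Longrightarrow> r \<le> r' \<Longrightarrow> x r \<le> x r'"
    and z: "\<And>r r'. r \<in> {1..n} \<Longrightarrow> r' \<in> {1..n} \<Longrightarrow> r \<le> r' \<Longrightarrow> z r \<le> z r'"
    and A: "finite A"
  shows "real (card {r\<in>{1..n}. x r \<noteq> z r}) \<le>
    real (card {r\<in>{1..n}. z r \<notin> A}) +
    (\<Sum>a\<in>A. \<bar>real (card {r\<in>{1..n}. x r < a}) - real (card {r\<in>{1..n}. z r < a})\<bar> +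
            \<bar>real (card {r\<in>{1..n}. x r \<le> a}) - real (card {r\<in>{1..n}. z r \<le> a})\<bar>)"
proof -
  let ?L = "\<lambda>x a. {r\<in>{1..n}. x r < (a::real)}" and ?M = "\<lambda>x a. {r\<in>{1..n}. x r \<le> (a::real)}"
  let ?\<Delta> = "\<lambda>S T :: nat set. (S - T) \<union> (T - S)"
  have down: "r \<in> ?L y a \<or> r' \<notin> ?L y a" "r \<in> ?M y a \<or> r' \<notin> ?M y a"
    if "y \<in> {x, z}" "r \<in> {1..n}" "r \<le> r'" for y a r r'
    using that x[of r r'] z[of r r'] by auto
  have L: "real (card (?\<Delta> (?L x a) (?L z a))) = \<bar>real (card (?L x a)) - real (card (?L z a))\<bar>" for a
    by (rule card_initial_segments_diff) (use down(1)[of x _ _ a] down(1)[of z _ _ a] in blast)+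
  have M: "real (card (?\<Delta> (?M x a) (?M z a))) = \<bar>real (card (?M x a)) - real (card (?M z a))\<bar>" for a
    by (rule card_initial_segments_diff) (use down(2)[of x _ _ a] down(2)[of z _ _ a] in blast)+
  have "{r\<in>{1..n}. x r \<noteq> z r} \<subseteq>
      {r\<in>{1..n}. z r \<notin> A} \<union> (\<Union>a\<in>A. ?\<Delta> (?L x a) (?L z a) \<union> ?\<Delta> (?M x a) (?M z a))"
  proof
    fix r assume r: "r \<in> {r\<in>{1..n}. x r \<noteq> z r}"
    show "r \<in> {r\<in>{1..n}. z r \<notin> A} \<union> (\<Union>a\<in>A. ?\<Delta> (?L x a) (?L z a) \<union> ?\<Delta> (?M x a) (?M z a))"
    proof (cases "z r \<in> A")
      case True
      \<comment> \<open>If \<open>x r < z r\<close>, the strict sets at the level \<open>z r\<close>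
        separate; if \<open>x r > z r\<close>, the weak ones do. Hence both kinds of half-line occur
        in the bound.\<close>
      have "r \<in> ?\<Delta> (?L x (z r)) (?L z (z r)) \<union> ?\<Delta> (?M x (z r)) (?M z (z r))"
        using r by auto
      then show ?thesis using True by blast
    qed (use r in auto)
  qed
  then have "card {r\<in>{1..n}. x r \<noteq> z r} \<le>
      card ({r\<in>{1..n}. z r \<notin> A} \<union> (\<Union>a\<in>A. ?\<Delta> (?L x a) (?L z a) \<union> ?\<Delta> (?M x a) (?M z a)))"
    by (rule card_mono[rotated]) (use A in auto)
  also have "\<dots> \<le> card {r\<in>{1..n}. z r \<notin> A} +
      card (\<Union>a\<in>A. ?\<Delta> (?L x a) (?L z a) \<union> ?\<Delta> (?M x a) (?M z a))"
    by (rule card_Un_le)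
  also have "card (\<Union>a\<in>A. ?\<Delta> (?L x a) (?L z a) \<union> ?\<Delta> (?M x a) (?M z a)) \<le>
      (\<Sum>a\<in>A. card (?\<Delta> (?L x a) (?L z a) \<union> ?\<Delta> (?M x a) (?M z a)))"
    by (rule card_UN_le[OF A])
  also have "\<dots> \<le> (\<Sum>a\<in>A. card (?\<Delta> (?L x a) (?L z a)) + card (?\<Delta> (?M x a) (?M z a)))"
    by (intro sum_mono card_Un_le)
  finally have "real (card {r\<in>{1..n}. x r \<noteq> z r}) \<le> real (card {r\<in>{1..n}. z r \<notin> A}) +
     (\<Sum>a\<in>A. real (card (?\<Delta> (?L x a) (?L z a))) + real (card (?\<Delta> (?M x a) (?M z a))))"
    by (simp flip: of_nat_add of_nat_sum add: of_nat_le_iff)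
  then show ?thesis unfolding L M .
qed

text \<open>The copula array is transposed against \<open>mra_row\<close>: here \<open>us j\<close>
  is the whole \<open>j\<close>-th sample, so that \<open>us\<close> is a point of a product of
  copula spaces. The restriction makes a row a point of the product space over
  \<open>{1..N}\<close>.\<close>

definition mra_rows :: "nat \<Rightarrow> nat \<Rightarrow> (nat \<Rightarrow> nat \<Rightarrow> real) \<Rightarrow> (nat \<Rightarrow> nat \<Rightarrow> real) \<Rightarrow> nat \<Rightarrow> nat \<Rightarrow> real" where
  "mra_rows n N xs us k = (\<lambda>i\<in>{1..N}. mra_row n xs (\<lambda>i j. us j i) k i)"

text \<open>The j-th copula sample is coupled with Q(U^j), where Q i is increasing on the values of the
  i-th coordinate: in each coordinate both the reordered batch and the batch Q(U^1), ..., Q(U^n)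
  are arranged in the order of the copula samples, so they differ only where the two sorted batches
  differ.\<close>
lemma card_mra_rows_coupling:
  fixes Q :: "nat \<Rightarrow> real \<Rightarrow> real"
  assumes Q: "\<And>i j j'. i \<in> {1..N} \<Longrightarrow> j \<in> {1..n} \<Longrightarrow> j' \<in> {1..n} \<Longrightarrow> us j i \<le> us j' i \<Longrightarrow>
       Q i (us j i) \<le> Q i (us j' i)"
    and A: "\<And>i. i \<in> {1..N} \<Longrightarrow> finite (A i)"
  shows "\<bar>real (card {k\<in>{1..n}. mra_rows n N xs us k \<in> B}) -
          real (card {j\<in>{1..n}. (\<lambda>i\<in>{1..N}. Q i (us j i)) \<in> B})\<bar> \<le>
    (\<Sum>i\<in>{1..N}. real (card {j\<in>{1..n}. Q i (us j i) \<notin> A i}) +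
      (\<Sum>a\<in>A i. \<bar>real (card {j\<in>{1..n}. xs i j < a}) - real (card {j\<in>{1..n}. Q i (us j i) < a})\<bar> +
        \<bar>real (card {j\<in>{1..n}. xs i j \<le> a}) - real (card {j\<in>{1..n}. Q i (us j i) \<le> a})\<bar>))"
proof -
  let ?u = "\<lambda>i j. us j i"
  define xr where "xr i r = xs i (rank_inv n (xs i) r)" for i r
  define zr where "zr i r = Q i (?u i (rank_inv n (?u i) r))" for i r
  define Y where "Y j = (\<lambda>i\<in>{1..N}. xr i (rank n (?u i) j))" for j
  define Z where "Z j = (\<lambda>i\<in>{1..N}. Q i (us j i))" for j
  \<comment> \<open>\<open>\<pi> k\<close> is the copula sample that the \<open>k\<close>-th row is
    attached to. As \<open>\<pi>\<close> is a bijection, rows may be counted by copula sample, which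
    removes the special role of the first coordinate.\<close>
  define \<pi> where "\<pi> k = rank_inv n (?u 1) (rank n (xs 1) k)" for k
  have \<pi>: "bij_betw \<pi> {1..n} {1..n}"
    using bij_betw_trans[OF bij_betw_rank[of n "xs 1"] bij_betw_rank_inv[of n "?u 1"]]
    unfolding \<pi>_def[abs_def] comp_def .
  have "card {k\<in>{1..n}. mra_rows n N xs us k \<in> B} = card {k\<in>{1..n}. Y (\<pi> k) \<in> B}"
    by (simp add: mra_rows_def mra_row_def Y_def xr_def \<pi>_def)
  also have "\<dots> = card {j\<in>{1..n}. Y j \<in> B}"
    using card_bij_vimage[OF \<pi>, of "\<lambda>j. Y j \<in> B"] .
  finally have 1: "card {k\<in>{1..n}. mra_rows n N xs us k \<in> B} = card {j\<in>{1..n}. Y j \<in> B}" .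
  have "card {j\<in>{1..n}. Y j \<in> B} \<le> card ({j\<in>{1..n}. Z j \<in> B} \<union> {j\<in>{1..n}. Y j \<noteq> Z j})"
    by (rule card_mono) auto
  moreover have "card {j\<in>{1..n}. Z j \<in> B} \<le> card ({j\<in>{1..n}. Y j \<in> B} \<union> {j\<in>{1..n}. Y j \<noteq> Z j})"
    by (rule card_mono) auto
  ultimately have 2: "\<bar>real (card {j\<in>{1..n}. Y j \<in> B}) - real (card {j\<in>{1..n}. Z j \<in> B})\<bar> \<le>
      real (card {j\<in>{1..n}. Y j \<noteq> Z j})"
    using card_Un_le[of "{j\<in>{1..n}. Z j \<in> B}" "{j\<in>{1..n}. Y j \<noteq> Z j}"]
      card_Un_le[of "{j\<in>{1..n}. Y j \<in> B}" "{j\<in>{1..n}. Y j \<noteq> Z j}"] by linarith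
  have zr_rank: "zr i (rank n (?u i) j) = Q i (us j i)" if "j \<in> {1..n}" for i j
    using that by (simp add: zr_def rank_inv_rank del: atLeastAtMost_iff)
  \<comment> \<open>In coordinate \<open>i\<close> both \<open>Y j\<close> and \<open>Z j\<close>
    read a sorted batch at the same position, the rank of \<open>us j i\<close>. Disagreements
    therefore correspond bijectively to ranks at which the sorted batches differ.\<close>
  have "card {j\<in>{1..n}. Y j \<noteq> Z j} \<le> card (\<Union>i\<in>{1..N}. {j\<in>{1..n}. xr i (rank n (?u i) j) \<noteq> zr i (rank n (?u i) j)})"
    by (intro card_mono) (auto simp: Y_def Z_def fun_eq_iff zr_rank split: if_splits)
  also have "\<dots> \<le> (\<Sum>i\<in>{1..N}. card {j\<in>{1..n}. xr i (rank n (?u i) j) \<noteq> zr i (rank n (?u i) j)})"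
    by (rule card_UN_le) auto
  also have "\<dots> = (\<Sum>i\<in>{1..N}. card {r\<in>{1..n}. xr i r \<noteq> zr i r})"
    by (intro sum.cong refl card_bij_vimage[OF bij_betw_rank])
  finally have 3: "real (card {j\<in>{1..n}. Y j \<noteq> Z j}) \<le> (\<Sum>i\<in>{1..N}. real (card {r\<in>{1..n}. xr i r \<noteq> zr i r}))"
    by (simp flip: of_nat_sum add: of_nat_le_iff)
  have 4: "real (card {r\<in>{1..n}. xr i r \<noteq> zr i r}) \<le>
      real (card {j\<in>{1..n}. Q i (us j i) \<notin> A i}) +
      (\<Sum>a\<in>A i. \<bar>real (card {j\<in>{1..n}. xs i j < a}) - real (card {j\<in>{1..n}. Q i (us j i) < a})\<bar> +
        \<bar>real (card {j\<in>{1..n}. xs i j \<le> a}) - real (card {j\<in>{1..n}. Q i (us j i) \<le> a})\<bar>)"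
    if i: "i \<in> {1..N}" for i
  proof -
    have x: "card {r\<in>{1..n}. P (xr i r)} = card {j\<in>{1..n}. P (xs i j)}" for P
      unfolding xr_def by (rule card_rank_inv)
    have z: "card {r\<in>{1..n}. P (zr i r)} = card {j\<in>{1..n}. P (Q i (us j i))}" for P
      unfolding zr_def using card_rank_inv[of n "\<lambda>u. P (Q i u)" "?u i"] .
    have "real (card {r\<in>{1..n}. xr i r \<noteq> zr i r}) \<le>
      real (card {r\<in>{1..n}. zr i r \<notin> A i}) +
      (\<Sum>a\<in>A i. \<bar>real (card {r\<in>{1..n}. xr i r < a}) - real (card {r\<in>{1..n}. zr i r < a})\<bar> +
            \<bar>real (card {r\<in>{1..n}. xr i r \<le> a}) - real (card {r\<in>{1..n}. zr i r \<le> a})\<bar>)"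
    proof (rule card_sorted_neq[OF _ _ A[OF i]])
      fix r r' assume r: "r \<in> {1..n}" "r' \<in> {1..n}" "r \<le> r'"
      show "xr i r \<le> xr i r'" unfolding xr_def by (rule rank_inv_mono[OF r])
      show "zr i r \<le> zr i r'" unfolding zr_def
        using rank_inv_mono[OF r, of "?u i"] rank_inv_in[of _ n "?u i"] r by (intro Q[OF i]) auto
    qed
    then show ?thesis
      using x[of "\<lambda>v. v < _"] x[of "\<lambda>v. v \<le> _"] z[of "\<lambda>v. v < _"] z[of "\<lambda>v. v \<le> _"]
        z[of "\<lambda>v. v \<notin> A i"] by simp
  qed
  show ?thesis
    unfolding 1 Z_def[symmetric] by (rule order_trans[OF 2 order_trans[OF 3 sum_mono[OF 4]]])
qed

subsection \<open>Empirical frequencies\<close>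

lemma measurable_rank:
  assumes x: "\<And>j. j \<in> {1..n} \<Longrightarrow> (\<lambda>w. x w j) \<in> borel_measurable M" and j: "j \<in> {1..n}"
  shows "(\<lambda>w. rank n (x w) j) \<in> measurable M (count_space {1..n})"
proof -
  have "(\<lambda>w. rank n (x w) j) \<in> measurable M (count_space UNIV)"
    unfolding rank_def
  proof (rule measurable_card)
    fix i
    show "{w \<in> space M. i \<in> {j' \<in> {1..n}. x w j' < x w j \<or> x w j' = x w j \<and> j' \<le> j}} \<in> sets M"
    proof (cases "i \<in> {1..n}")
      case True
      note m = x[OF True] x[OF j]
      have "{w \<in> space M. x w i < x w j} \<in> sets M" "{w \<in> space M. x w i = x w j} \<in> sets M"
        by (rule borel_measurable_less[OF m], rule borel_measurable_eq[OF m])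
      moreover have "{w \<in> space M. i \<in> {j' \<in> {1..n}. x w j' < x w j \<or> x w j' = x w j \<and> j' \<le> j}} =
          {w \<in> space M. x w i < x w j} \<union> (if i \<le> j then {w \<in> space M. x w i = x w j} else {})"
        using True by auto
      ultimately show ?thesis by (simp only: sets.Un sets.empty_sets split: if_split) blast
    next
      case False
      then have "{w \<in> space M. i \<in> {j' \<in> {1..n}. x w j' < x w j \<or> x w j' = x w j \<and> j' \<le> j}} = {}"
        by blast
      then show ?thesis by (simp only: sets.empty_sets)
    qed
  qed
  then show ?thesis
    by (rule measurable_count_space_extend[rotated 2]) (use rank_in[OF j] in blast)+
qed

text \<open>The inverse takes the value \<open>j\<close> exactly when \<open>j\<close> has rank
  \<open>r\<close>, so its level sets are level sets of \<open>rank\<close>.\<close>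

lemma measurable_rank_inv:
  assumes x: "\<And>j. j \<in> {1..n} \<Longrightarrow> (\<lambda>w. x w j) \<in> borel_measurable M" and r: "r \<in> {1..n}"
  shows "(\<lambda>w. rank_inv n (x w) r) \<in> measurable M (count_space {1..n})"
  unfolding measurable_count_space_eq2[OF finite_atLeastAtMost]
proof safe
  fix w show "rank_inv n (x w) r \<in> {1..n}" by (rule rank_inv_in[OF r])
next
  fix j assume j: "j \<in> {1..n}"
  have "(\<lambda>w. rank_inv n (x w) r) -` {j} \<inter> space M = (\<lambda>w. rank n (x w) j) -` {r} \<inter> space M"
    using rank_inv_eq[OF j] rank_rank_inv[OF r] by (auto simp del: atLeastAtMost_iff)
  also have "\<dots> \<in> sets M"
    by (rule measurable_sets[OF measurable_rank]) (use x j r in auto)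
  finally show "(\<lambda>w. rank_inv n (x w) r) -` {j} \<inter> space M \<in> sets M" .
qed

text \<open>Each index is a random variable with values in the finite set \<open>{1..n}\<close>;
  evaluating a measurable family at such a random index stays measurable.\<close>

lemma measurable_mra_row:
  assumes xs: "\<And>i j. i \<in> {1..N} \<Longrightarrow> j \<in> {1..n} \<Longrightarrow> (\<lambda>w. xs w i j) \<in> borel_measurable M"
    and us: "\<And>i j. i \<in> {1..N} \<Longrightarrow> j \<in> {1..n} \<Longrightarrow> (\<lambda>w. us w i j) \<in> borel_measurable M"
    and k: "k \<in> {1..n}" and i: "i \<in> {1..N}"
  shows "(\<lambda>w. mra_row n (xs w) (us w) k i) \<in> borel_measurable M"
proof -
  have "1 \<in> {1..N}" using i by auto
  have 1: "(\<lambda>w. rank n (xs w 1) k) \<in> measurable M (count_space {1..n})"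
    by (rule measurable_rank[OF xs[OF \<open>1 \<in> {1..N}\<close>] k])
  have 2: "(\<lambda>w. rank_inv n (us w 1) (rank n (xs w 1) k)) \<in> measurable M (count_space {1..n})"
    by (rule measurable_compose_countable'[OF measurable_rank_inv 1]) (use us \<open>1 \<in> {1..N}\<close> in \<open>auto simp del: atLeastAtMost_iff\<close>)
  have 3: "(\<lambda>w. rank n (us w i) (rank_inv n (us w 1) (rank n (xs w 1) k))) \<in> measurable M (count_space {1..n})"
    by (rule measurable_compose_countable'[OF measurable_rank 2]) (use us i in \<open>auto simp del: atLeastAtMost_iff\<close>)
  have 4: "(\<lambda>w. rank_inv n (xs w i) (rank n (us w i) (rank_inv n (us w 1) (rank n (xs w 1) k))))
      \<in> measurable M (count_space {1..n})"
    by (rule measurable_compose_countable'[OF measurable_rank_inv 3]) (use xs i in \<open>auto simp del: atLeastAtMost_iff\<close>)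
  show ?thesis
    unfolding mra_row_def
    by (rule measurable_compose_countable'[OF _ 4]) (use xs i in \<open>auto simp del: atLeastAtMost_iff\<close>)
qed

section \<open>Empirical frequencies: Hoeffding tails and mean deviations\<close>

definition emp :: "nat \<Rightarrow> 'b set \<Rightarrow> (nat \<Rightarrow> 'b) \<Rightarrow> real" where
  "emp n B y = real (card {k\<in>{1..n}. y k \<in> B}) / real n"

lemma emp_eq_sum: "emp n B y = (\<Sum>k\<in>{1..n}. indicat_real B (y k)) / real n"
  by (simp add: emp_def indicator_def sum.If_cases Int_def)

lemma emp_nonneg: "0 \<le> emp n B y"
  by (simp add: emp_def)

lemma emp_le_1: "emp n B y \<le> 1"
proof -
  have "card {k\<in>{1..n}. y k \<in> B} \<le> card {1..n}" by (rule card_mono) auto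
  then show ?thesis by (auto simp: emp_def divide_le_eq_1)
qed

lemma (in prob_space) indep_vars_rv: "indep_vars N X I \<Longrightarrow> i \<in> I \<Longrightarrow> random_variable (N i) (X i)"
  unfolding indep_vars_def by blast

text \<open>Hoeffding's inequality for the indicators of \<open>B\<close>. Only independence is
  used, and the centre is the average of the individual probabilities, because the rows of a node
  have laws that depend on their index.\<close>

lemma (in prob_space) prob_emp_deviation:
  assumes X: "indep_vars (\<lambda>_. N) X {1..n}" and B: "B \<in> sets N" and n: "0 < n" and \<epsilon>: "0 \<le> \<epsilon>"
  shows "prob {w\<in>space M. \<bar>emp n B (\<lambda>k. X k w) - (\<Sum>k\<in>{1..n}. prob (X k -` B \<inter> space M)) / n\<bar> \<ge> \<epsilon>}
    \<le> 2 * exp (- 2 * real n * \<epsilon>\<^sup>2)"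
proof -
  note rv = indep_vars_rv[OF X]
  have ind: "indep_vars (\<lambda>_. borel) (\<lambda>k w. indicat_real B (X k w)) {1..n}"
    by (rule indep_vars_compose2[OF X]) (rule borel_measurable_indicator[OF B])
  interpret H: Hoeffding_ineq M "{1..n}" "\<lambda>k w. indicat_real B (X k w)" "\<lambda>_. 0" "\<lambda>_. 1"
      "\<Sum>k\<in>{1..n}. expectation (\<lambda>w. indicat_real B (X k w))"
  proof unfold_locales
    show "indep_vars (\<lambda>_. borel) (\<lambda>k w. indicat_real B (X k w)) {1..n}" by (rule ind)
    show "AE w in M. indicat_real B (X k w) \<in> {0..1}" for k
      by (rule AE_I2) (simp add: indicator_def)
  qed simp
  have e: "expectation (\<lambda>w. indicat_real B (X k w)) = prob (X k -` B \<inter> space M)" if "k \<in> {1..n}" for k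
  proof -
    have "expectation (\<lambda>w. indicat_real B (X k w)) = expectation (indicat_real (X k -` B \<inter> space M))"
      by (rule Bochner_Integration.integral_cong) (auto simp: indicator_def)
    also have "\<dots> = prob (X k -` B \<inter> space M)"
      using measurable_sets[OF rv[OF that] B] by simp
    finally show ?thesis .
  qed
  have eq: "(\<Sum>k\<in>{1..n}. expectation (\<lambda>w. indicat_real B (X k w))) = (\<Sum>k\<in>{1..n}. prob (X k -` B \<inter> space M))"
    by (rule sum.cong[OF refl e])
  have iff: "\<epsilon> \<le> \<bar>s / n - m / n\<bar> \<longleftrightarrow> n * \<epsilon> \<le> \<bar>s - m\<bar>" for s m
    using n by (simp add: pos_le_divide_eq mult.commute flip: diff_divide_distrib)
  have "{w\<in>space M. \<bar>emp n B (\<lambda>k. X k w) - (\<Sum>k\<in>{1..n}. prob (X k -` B \<inter> space M)) / n\<bar> \<ge> \<epsilon>} =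
      {w\<in>space M. \<bar>(\<Sum>k\<in>{1..n}. indicat_real B (X k w)) - (\<Sum>k\<in>{1..n}. expectation (\<lambda>w. indicat_real B (X k w)))\<bar> \<ge> n * \<epsilon>}"
    unfolding emp_eq_sum eq iff ..
  \<comment> \<open>Each indicator has range [0, 1], so the squared ranges sum to \<open>n\<close>
    and the exponent becomes \<open>- 2 * n * \<epsilon>\<^sup>2\<close>.\<close>
  also have "prob \<dots> \<le> 2 * exp (- 2 * (n * \<epsilon>)\<^sup>2 / (\<Sum>k\<in>{1..n}. (1 - 0)\<^sup>2))"
    by (rule H.Hoeffding_ineq_abs_ge) (use n \<epsilon> in simp_all)
  also have "- 2 * (n * \<epsilon>)\<^sup>2 / (\<Sum>k\<in>{1..n}. (1 - 0)\<^sup>2) = - 2 * real n * \<epsilon>\<^sup>2"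
    using n by (simp add: power2_eq_square)
  finally show ?thesis .
qed

lemma (in prob_space) measurable_emp:
  assumes "\<And>k. k \<in> {1..n} \<Longrightarrow> random_variable N (X k)" "B \<in> sets N"
  shows "(\<lambda>w. emp n B (\<lambda>k. X k w)) \<in> borel_measurable M"
  unfolding emp_eq_sum using assms by (intro borel_measurable_divide borel_measurable_sum) auto

text \<open>The deviation is below \<epsilon> off the bad event and never exceeds 1, so its mean is
  at most \<epsilon> plus the Hoeffding tail.\<close>

lemma (in prob_space) expectation_emp_deviation:
  assumes X: "indep_vars (\<lambda>_. N) X {1..n}" and B: "B \<in> sets N" and n: "0 < n" and \<epsilon>: "0 \<le> \<epsilon>"
  shows "expectation (\<lambda>w. \<bar>emp n B (\<lambda>k. X k w) - (\<Sum>k\<in>{1..n}. prob (X k -` B \<inter> space M)) / n\<bar>)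
    \<le> \<epsilon> + 2 * exp (- 2 * real n * \<epsilon>\<^sup>2)"
proof -
  define m where "m = (\<Sum>k\<in>{1..n}. prob (X k -` B \<inter> space M)) / n"
  define D where "D w = \<bar>emp n B (\<lambda>k. X k w) - m\<bar>" for w
  define E where "E = {w\<in>space M. D w \<ge> \<epsilon>}"
  have "(\<lambda>w. emp n B (\<lambda>k. X k w)) \<in> borel_measurable M"
    by (rule measurable_emp[OF indep_vars_rv[OF X] B])
  then have D: "D \<in> borel_measurable M"
    unfolding D_def[abs_def] by simp
  then have E: "E \<in> events"
    unfolding E_def by (intro borel_measurable_le) simp_all
  have "(\<Sum>k\<in>{1..n}. prob (X k -` B \<inter> space M)) \<le> (\<Sum>k\<in>{1..n}. 1)"
    by (rule sum_mono) simp
  moreover have "0 \<le> (\<Sum>k\<in>{1..n}. prob (X k -` B \<inter> space M))"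
    by (rule sum_nonneg) simp
  ultimately have m: "0 \<le> m" "m \<le> 1"
    using n unfolding m_def by simp_all
  have D1: "D w \<le> 1" "0 \<le> D w" for w
    using m emp_nonneg[of n B "\<lambda>k. X k w"] emp_le_1[of n B "\<lambda>k. X k w"] 
    unfolding D_def by linarith+
  have iE: "integrable M (indicat_real E)"
    using E by (simp add: emeasure_eq_measure)
  have "expectation D \<le> expectation (\<lambda>w. \<epsilon> + indicat_real E w)"
  proof (rule integral_mono)
    show "integrable M D"
      by (rule integrable_const_bound[where B=1]) (use D1 D in auto)
    show "integrable M (\<lambda>w. \<epsilon> + indicat_real E w)"
      using iE by simp
    fix w assume "w \<in> space M"
    then show "D w \<le> \<epsilon> + indicat_real E w"
      using D1[of w] \<epsilon> by (cases "w \<in> E") (auto simp: E_def)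
  qed
  also have "\<dots> = \<epsilon> + prob E"
    by (subst Bochner_Integration.integral_add[OF _ iE]) (use E in \<open>simp_all add: prob_space\<close>)
  also have "\<dots> \<le> \<epsilon> + 2 * exp (- 2 * real n * \<epsilon>\<^sup>2)"
    using prob_emp_deviation[OF X B n \<epsilon>] unfolding E_def D_def m_def by (rule add_left_mono)
  finally show ?thesis unfolding D_def[abs_def] m_def .
qed

text \<open>A geometric series with ratio below 1. Its terms tending to zero drives the induction
  over the tree; its summability is what Borel--Cantelli needs.\<close>

lemma summable_exp_deviation:
  fixes \<epsilon> :: real
  assumes "0 < \<epsilon>"
  shows "summable (\<lambda>n. 2 * exp (- 2 * real n * \<epsilon>\<^sup>2))"
proof -
  have eq: "exp (- 2 * real n * \<epsilon>\<^sup>2) = exp (- 2 * \<epsilon>\<^sup>2) ^ n" for n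
    by (simp add: exp_of_nat_mult[symmetric] mult.assoc mult.left_commute)
  have "summable (\<lambda>n. exp (- 2 * \<epsilon>\<^sup>2) ^ n)"
    using assms by (intro summable_geometric) simp
  then show ?thesis unfolding eq by (rule summable_mult)
qed

text \<open>The bound is available for every \<epsilon>; half of the tolerance is spent on
  \<epsilon> and the other half on the exponential term for large \<open>n\<close>.\<close>

lemma tendsto_zeroI_eps_exp:
  fixes g :: "nat \<Rightarrow> real"
  assumes "\<And>n. 0 < n \<Longrightarrow> 0 \<le> g n"
    and g: "\<And>n \<epsilon>. 0 < n \<Longrightarrow> 0 < \<epsilon> \<Longrightarrow> g n \<le> \<epsilon> + 2 * exp (- 2 * real n * \<epsilon>\<^sup>2)"
  shows "g \<longlonglongrightarrow> 0"
proof (rule LIMSEQ_I)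
  fix r :: real assume r: "0 < r"
  have "summable (\<lambda>n. 2 * exp (- 2 * real n * (r/2)\<^sup>2))"
    using r by (intro summable_exp_deviation) simp
  then have "(\<lambda>n. 2 * exp (- 2 * real n * (r/2)\<^sup>2)) \<longlonglongrightarrow> 0"
    by (rule summable_LIMSEQ_zero)
  then have "\<forall>\<^sub>F n in sequentially. 2 * exp (- 2 * real n * (r/2)\<^sup>2) < r/2"
    by (rule order_tendstoD(2)) (use r in simp)
  then have "\<forall>\<^sub>F n in sequentially. norm (g n - 0) < r"
    using eventually_gt_at_top[of 0]
  proof eventually_elim
    case (elim n)
    have "g n \<le> r/2 + 2 * exp (- 2 * real n * (r/2)\<^sup>2)"
      using elim(2) r by (intro g) auto
    then have "g n < r" using elim(1) by linarith
    then show ?case using assms(1)[OF elim(2)] by simp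
  qed
  then show "\<exists>no. \<forall>n\<ge>no. norm (g n - 0) < r" by (simp add: eventually_sequentially)
qed

subsection \<open>Copulas and quantile transforms\<close>

text \<open>Half-lines generate the Borel sets of the line and exhaust it along the integers, so
  products of generators generate the finite product. Such products are lower orthants.\<close>

lemma sets_PiM_atMost:
  fixes J :: "'i set"
  assumes "finite J"
  shows "sets (PiM J (\<lambda>_. borel :: real measure)) =
    sigma_sets (PiE J (\<lambda>_. UNIV)) (range (\<lambda>x. {y \<in> PiE J (\<lambda>_. UNIV). \<forall>i\<in>J. y i \<le> x i}))"
proof -
  let ?P = "{{f\<in>(\<Pi>\<^sub>E i\<in>J. UNIV). \<forall>i\<in>j. f i \<in> A i} | A j. j \<in> {J} \<and> A \<in> Pi j (\<lambda>_. range (\<lambda>x::real. {..x}))}"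
  have "sets (PiM J (\<lambda>_. borel :: real measure)) = sets (\<Pi>\<^sub>M i\<in>J. sigma UNIV (range (\<lambda>x::real. {..x})))"
    unfolding borel_eq_atMost ..
  also have "\<dots> = sets (sigma (\<Pi>\<^sub>E i\<in>J. UNIV) ?P)"
  proof (rule sets_PiM_sigma)
    show "\<exists>S\<subseteq>range (\<lambda>x::real. {..x}). countable S \<and> UNIV = \<Union>S"
    proof (intro exI conjI)
      show "range (\<lambda>n::nat. {..real n}) \<subseteq> range (\<lambda>x::real. {..x})" by auto
      show "countable (range (\<lambda>n::nat. {..real n}))" by simp
      show "UNIV = \<Union>(range (\<lambda>n::nat. {..real n}))"
        using real_arch_simple by (intro set_eqI) (simp add: real_arch_simple)
    qed
  qed (use assms in auto)
  also have "\<dots> = sigma_sets (PiE J (\<lambda>_. UNIV)) ?P"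
    by (rule sets_measure_of) auto
  also have "?P = range (\<lambda>x. {y \<in> PiE J (\<lambda>_. UNIV). \<forall>i\<in>J. y i \<le> x i})"
  proof (intro equalityI subsetI)
    fix S assume "S \<in> ?P"
    then obtain A where A: "A \<in> Pi J (\<lambda>_. range (\<lambda>x::real. {..x}))"
      and S: "S = {f\<in>(\<Pi>\<^sub>E i\<in>J. UNIV). \<forall>i\<in>J. f i \<in> A i}" by blast
    from A have "\<forall>i\<in>J. \<exists>x. A i = {..x}" by (auto simp: Pi_iff)
    then obtain x where "\<forall>i\<in>J. A i = {..x i}" by metis
    then have "S = {y \<in> PiE J (\<lambda>_. UNIV). \<forall>i\<in>J. y i \<le> x i}"
      unfolding S by (intro Collect_cong conj_cong refl ball_cong) simp
    then show "S \<in> range (\<lambda>x. {y \<in> PiE J (\<lambda>_. UNIV). \<forall>i\<in>J. y i \<le> x i})"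
      by (intro image_eqI[where x=x] UNIV_I)
  next
    fix S :: "('i \<Rightarrow> real) set" assume "S \<in> range (\<lambda>x. {y \<in> PiE J (\<lambda>_. UNIV). \<forall>i\<in>J. y i \<le> x i})"
    then obtain x where "S = {y \<in> PiE J (\<lambda>_. UNIV). \<forall>i\<in>J. y i \<in> {..x i}}" by (auto simp only: atMost_iff)
    moreover have "(\<lambda>i. {..x i}) \<in> Pi J (\<lambda>_. range (\<lambda>x::real. {..x}))" by (rule Pi_I) (rule rangeI)
    ultimately show "S \<in> ?P" by (intro CollectI exI conjI) (assumption | rule singletonI)+
  qed
  finally show ?thesis .
qed

text \<open>Uniqueness of a law with given joint distribution function: lower orthants are closed
  under intersection, by coordinatewise minimum, and exhaust the space.\<close>

lemma measure_eqI_PiM_cdf: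
  fixes J :: "'i set"
  assumes J: "finite J" and P: "prob_space P" and Q: "prob_space Q"
    and sP: "sets P = sets (PiM J (\<lambda>_. borel :: real measure))"
    and sQ: "sets Q = sets (PiM J (\<lambda>_. borel :: real measure))"
    and eq: "\<And>x. measure P {y\<in>space P. \<forall>i\<in>J. y i \<le> x i} = measure Q {y\<in>space Q. \<forall>i\<in>J. y i \<le> x i}"
  shows "P = Q"
proof -
  interpret P: prob_space P by fact
  interpret Q: prob_space Q by fact
  let ?\<Omega> = "PiE J (\<lambda>_. UNIV :: real set)"
  let ?S = "\<lambda>x. {y \<in> ?\<Omega>. \<forall>i\<in>J. y i \<le> x i}"
  have sp: "space P = ?\<Omega>" "space Q = ?\<Omega>"
    using sets_eq_imp_space_eq[OF sP] sets_eq_imp_space_eq[OF sQ] by (simp_all add: space_PiM)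
  show ?thesis
  proof (rule measure_eqI_generator_eq[where \<Omega>="?\<Omega>" and E="range ?S" and A="\<lambda>n. ?S (\<lambda>_. real n)"])
    show "Int_stable (range ?S)"
    proof (rule Int_stableI)
      fix a b assume "a \<in> range ?S" "b \<in> range ?S"
      then obtain x y where ab: "a = ?S x" "b = ?S y" by blast
      have "a \<inter> b = ?S (\<lambda>i. min (x i) (y i))" unfolding ab by auto
      then show "a \<inter> b \<in> range ?S"
        by (intro image_eqI[where x="\<lambda>i. min (x i) (y i)"] UNIV_I)
    qed
    show "range ?S \<subseteq> Pow ?\<Omega>" by auto
    show "emeasure P X = emeasure Q X" if "X \<in> range ?S" for X
      using that eq unfolding sp by (auto simp: P.emeasure_eq_measure Q.emeasure_eq_measure)
    show "sets P = sigma_sets ?\<Omega> (range ?S)" "sets Q = sigma_sets ?\<Omega> (range ?S)"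
      unfolding sP sQ by (rule sets_PiM_atMost[OF J])+
    show "range (\<lambda>n. ?S (\<lambda>_. real n)) \<subseteq> range ?S"
      by (intro image_subsetI) (rule image_eqI[OF refl UNIV_I])
    show "(\<Union>n. ?S (\<lambda>_. real n)) = ?\<Omega>"
    proof (intro equalityI subsetI)
      fix y assume y: "y \<in> ?\<Omega>"
      \<comment> \<open>Inserting 0 keeps the maximum meaningful when \<open>J\<close> is
        empty.\<close>
      obtain n where "Max (insert 0 (y ` J)) \<le> real n" using real_arch_simple by blast
      then have "\<forall>i\<in>J. y i \<le> real n" using J by (auto simp: Max_le_iff)
      then show "y \<in> (\<Union>n. ?S (\<lambda>_. real n))" using y by blast
    qed blast
    show "emeasure P (?S (\<lambda>_. real n)) \<noteq> \<infinity>" for n by simp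
  qed
qed

text \<open>The generalised inverse of the distribution function. Outside (0, 1) the infimum may
  range over an empty or unbounded set; the value 0 there is a mere convention, harmless because
  copula samples avoid the endpoints almost surely.\<close>

definition quant :: "real measure \<Rightarrow> real \<Rightarrow> real" where
  "quant \<mu> u = (if 0 < u \<and> u < 1 then Inf {x. u \<le> cdf \<mu> x} else 0)"

text \<open>Right continuity of the distribution function makes the infimum attained, so the
  equivalence is exact at jumps too. All identities between laws below rest on it.\<close>

lemma quant_le_iff:
  assumes "real_distribution \<mu>" "0 < u" "u < 1"
  shows "quant \<mu> u \<le> x \<longleftrightarrow> u \<le> cdf \<mu> x"
proof -
  interpret cdf_distribution \<mu> using assms(1) by (simp add: cdf_distribution_def)
  show ?thesis using pseudoinverse[OF assms(2,3), of x] assms by (simp add: quant_def)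
qed

lemma quant_mono:
  assumes "real_distribution \<mu>" "0 < u" "u \<le> v" "v < 1"
  shows "quant \<mu> u \<le> quant \<mu> v"
proof -
  have "v \<le> cdf \<mu> (quant \<mu> v)" using quant_le_iff[OF assms(1), of v "quant \<mu> v"] assms by simp
  then show ?thesis using quant_le_iff[OF assms(1), of u "quant \<mu> v"] assms by simp
qed

lemma measurable_quant:
  assumes "real_distribution \<mu>" shows "quant \<mu> \<in> borel_measurable borel"
proof -
  interpret cdf_distribution \<mu> using assms(1) by (simp add: cdf_distribution_def)
  have *: "{u::real. 0 < u \<and> u < 1} = {0<..<1}" by auto
  show ?thesis
    unfolding quant_def[abs_def]
    by (subst measurable_If_restrict_space_iff) (use measurable_CI in \<open>simp_all add: *\<close>)
qed

definition qvec :: "nat \<Rightarrow> (nat \<Rightarrow> real measure) \<Rightarrow> (nat \<Rightarrow> real) \<Rightarrow> nat \<Rightarrow> real" where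
  "qvec N \<mu> u = (\<lambda>i\<in>{1..N}. quant (\<mu> i) (u i))"

lemma copula_sets: "is_copula N C \<Longrightarrow> sets C = sets (PiM {1..N} (\<lambda>_. borel))"
  using sets_PiM_cong[of "{1..N}" "{1..N}" "\<lambda>_. lborel" "\<lambda>_. borel"]
  by (simp add: is_copula_def)

lemma copula_prob_space: "is_copula N C \<Longrightarrow> prob_space C"
  by (simp add: is_copula_def)

lemma measurable_copula_component:
  assumes "is_copula N C" "i \<in> {1..N}" shows "(\<lambda>u. u i) \<in> borel_measurable C"
  unfolding measurable_cong_sets[OF copula_sets[OF assms(1)] refl]
  by (rule measurable_component_singleton[OF assms(2)])

lemma measurable_qvec:
  assumes "is_copula N C" "\<And>i. i \<in> {1..N} \<Longrightarrow> real_distribution (\<mu> i)"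
  shows "qvec N \<mu> \<in> measurable C (PiM {1..N} (\<lambda>_. borel))"
  unfolding qvec_def[abs_def]
  by (intro measurable_restrict measurable_compose[OF measurable_copula_component[OF assms(1)] measurable_quant[OF assms(2)]])

text \<open>Uniform marginals give no mass to the endpoints: the mass at or below 0 is read off
  directly, and the mass at or above 1 is at most \<open>1 - v\<close> for every
  \<open>v < 1\<close>.\<close>

lemma copula_AE_interior:
  assumes C: "is_copula N C" shows "AE u in C. \<forall>i\<in>{1..N}. 0 < u i \<and> u i < 1"
proof (rule AE_ball_countable'[rotated])
  interpret prob_space C using C by (rule copula_prob_space)
  fix i assume i: "i \<in> {1..N}"
  note [measurable] = measurable_copula_component[OF C i]
  have m: "prob {u\<in>space C. u i \<le> v} = v" if "0 \<le> v" "v \<le> 1" for v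
    using C i that unfolding is_copula_def by (meson atLeastAtMost_iff)
  have "AE u in C. 0 < u i"
  proof (rule AE_I'[where N="{u\<in>space C. u i \<le> 0}"])
    have "{u\<in>space C. u i \<le> 0} \<in> events" by measurable
    then show "{u\<in>space C. u i \<le> 0} \<in> null_sets C"
      using m[of 0] by (auto simp: null_sets_def emeasure_eq_measure)
  qed auto
  moreover have "AE u in C. u i < 1"
  proof (rule AE_I'[where N="{u\<in>space C. 1 \<le> u i}"])
    have e: "{u\<in>space C. 1 \<le> u i} \<in> events" by measurable
    have "prob {u\<in>space C. 1 \<le> u i} \<le> 0 + e" if "0 < e" for e
    proof -
      \<comment> \<open>The maximum keeps \<open>v\<close> in [0, 1], where the marginal is
        prescribed, also when \<open>e > 1\<close>.\<close>
      define v where "v = max 0 (1 - e)"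
      have v: "0 \<le> v" "v < 1" "1 - v \<le> e" using that by (auto simp: v_def)
      have "{u\<in>space C. u i \<le> v} \<in> events" by measurable
      then have "prob (space C - {u\<in>space C. u i \<le> v}) = 1 - v"
        using m[of v] v by (simp add: prob_compl)
      moreover have "prob {u\<in>space C. 1 \<le> u i} \<le> prob (space C - {u\<in>space C. u i \<le> v})"
        using v by (intro finite_measure_mono) auto
      ultimately show ?thesis using v by simp
    qed
    then have "prob {u\<in>space C. 1 \<le> u i} \<le> 0" by (rule field_le_epsilon)
    then show "{u\<in>space C. 1 \<le> u i} \<in> null_sets C"
      using e by (auto simp: null_sets_def emeasure_eq_measure measure_le_0_iff)
  qed auto
  ultimately show "AE u in C. 0 < u i \<and> u i < 1" by auto
qed simp

text \<open>Inverse transform sampling: the event \<open>quant \<mu> (u i) \<le> x\<close> is almost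
  surely \<open>u i \<le> cdf \<mu> x\<close>, whose probability is \<open>cdf \<mu> x\<close> as
  the marginal is uniform.\<close>

lemma distr_copula_quant:
  assumes C: "is_copula N C" and i: "i \<in> {1..N}" and \<mu>: "real_distribution \<mu>"
  shows "distr C borel (\<lambda>u. quant \<mu> (u i)) = \<mu>"
proof -
  interpret prob_space C using C by (rule copula_prob_space)
  interpret \<mu>: real_distribution \<mu> by fact
  have qm[measurable]: "(\<lambda>u. quant \<mu> (u i)) \<in> borel_measurable C"
    by (rule measurable_compose[OF measurable_copula_component[OF C i] measurable_quant[OF \<mu>]])
  have cm[measurable]: "(\<lambda>u. u i) \<in> borel_measurable C" by (rule measurable_copula_component[OF C i])
  show ?thesis
  proof (rule cdf_unique[OF _ \<mu>])
    show "real_distribution (distr C borel (\<lambda>u. quant \<mu> (u i)))"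
      by (rule real_distribution_distr[OF qm])
    show "cdf (distr C borel (\<lambda>u. quant \<mu> (u i))) = cdf \<mu>"
    proof
      fix x
      have "cdf (distr C borel (\<lambda>u. quant \<mu> (u i))) x = prob {u\<in>space C. quant \<mu> (u i) \<le> x}"
        unfolding cdf_def by (subst measure_distr[OF qm]) (auto intro!: arg_cong[where f=prob])
      also have "\<dots> = prob {u\<in>space C. u i \<le> cdf \<mu> x}"
      proof (rule finite_measure_eq_AE)
        show "AE u in C. u \<in> {u\<in>space C. quant \<mu> (u i) \<le> x} \<longleftrightarrow> u \<in> {u\<in>space C. u i \<le> cdf \<mu> x}"
          using copula_AE_interior[OF C]
        proof eventually_elim
          case (elim u)
          then show ?case using quant_le_iff[OF \<mu>, of "u i" x] i by blast
        qed
      qed measurable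
      also have "\<dots> = cdf \<mu> x"
        using C i \<mu>.cdf_nonneg[of x] \<mu>.cdf_bounded_prob[of x] unfolding is_copula_def by auto
      finally show "cdf (distr C borel (\<lambda>u. quant \<mu> (u i))) x = cdf \<mu> x" .
    qed
  qed
qed

text \<open>Applying \<open>quant_le_iff\<close> in all coordinates at once shows that the quantile
  vector of a copula sample has the prescribed distribution function. This identifies the law whose
  mere existence the model asserts, and provides the coupling partner of the rows.\<close>

lemma aggregation_law_eq_distr:
  assumes C: "is_copula N C" and \<mu>: "\<And>i. i \<in> {1..N} \<Longrightarrow> real_distribution (\<mu> i)"
    and M: "prob_space M" "sets M = sets (PiM {1..N} (\<lambda>_. borel))"
    and G: "\<And>x. measure M {y\<in>space M. \<forall>i\<in>{1..N}. y i \<le> x i} = cop_fun N C (\<lambda>i. cdf (\<mu> i) (x i))"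
  shows "M = distr C (PiM {1..N} (\<lambda>_. borel)) (qvec N \<mu>)"
proof (rule measure_eqI_PiM_cdf[OF _ M(1) _ M(2)])
  interpret prob_space C using C by (rule copula_prob_space)
  have q: "qvec N \<mu> \<in> measurable C (PiM {1..N} (\<lambda>_. borel))"
    by (rule measurable_qvec[OF C \<mu>])
  show "prob_space (distr C (PiM {1..N} (\<lambda>_. borel)) (qvec N \<mu>))"
    by (rule prob_space_distr[OF q])
  fix x :: "nat \<Rightarrow> real"
  have mS: "{y\<in>space (PiM {1..N} (\<lambda>_. borel)). \<forall>i\<in>{1..N}. y i \<le> x i} \<in> sets (PiM {1..N} (\<lambda>_. borel))"
    by measurable
  have "measure (distr C (PiM {1..N} (\<lambda>_. borel)) (qvec N \<mu>))
      {y\<in>space (distr C (PiM {1..N} (\<lambda>_. borel)) (qvec N \<mu>)). \<forall>i\<in>{1..N}. y i \<le> x i} =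
    prob (qvec N \<mu> -` {y\<in>space (PiM {1..N} (\<lambda>_. borel)). \<forall>i\<in>{1..N}. y i \<le> x i} \<inter> space C)"
    unfolding space_distr by (rule measure_distr[OF q mS])
  also have "\<dots> = prob {v\<in>space C. \<forall>i\<in>{1..N}. v i \<le> cdf (\<mu> i) (x i)}"
  proof (rule finite_measure_eq_AE)
    show "AE u in C. u \<in> qvec N \<mu> -` {y\<in>space (PiM {1..N} (\<lambda>_. borel)). \<forall>i\<in>{1..N}. y i \<le> x i} \<inter> space C
        \<longleftrightarrow> u \<in> {v\<in>space C. \<forall>i\<in>{1..N}. v i \<le> cdf (\<mu> i) (x i)}"
      using copula_AE_interior[OF C] AE_space
    proof eventually_elim
      case (elim u)
      have "qvec N \<mu> u \<in> space (PiM {1..N} (\<lambda>_. borel))" using q elim(2) by (rule measurable_space)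
      moreover have "(qvec N \<mu> u i \<le> x i) = (u i \<le> cdf (\<mu> i) (x i))" if "i \<in> {1..N}" for i
        using quant_le_iff[OF \<mu>[OF that], of "u i" "x i"] elim(1) that by (simp add: qvec_def)
      ultimately show ?case using elim(2) by blast
    qed
    show "qvec N \<mu> -` {y\<in>space (PiM {1..N} (\<lambda>_. borel)). \<forall>i\<in>{1..N}. y i \<le> x i} \<inter> space C \<in> events"
      by (rule measurable_sets[OF q mS])
    show "{v\<in>space C. \<forall>i\<in>{1..N}. v i \<le> cdf (\<mu> i) (x i)} \<in> events"
      by (rule sets.sets_Collect_finite_All)
         (auto intro!: borel_measurable_le measurable_copula_component[OF C])
  qed
  finally show "measure M {y\<in>space M. \<forall>i\<in>{1..N}. y i \<le> x i} =
     measure (distr C (PiM {1..N} (\<lambda>_. borel)) (qvec N \<mu>))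
      {y\<in>space (distr C (PiM {1..N} (\<lambda>_. borel)) (qvec N \<mu>)). \<forall>i\<in>{1..N}. y i \<le> x i}"
    unfolding G cop_fun_def by simp
qed simp_all

subsection \<open>One repetition of the reordering\<close>

lemma (in prob_space) distr_pair_snd:
  assumes "prob_space N" shows "distr (N \<Otimes>\<^sub>M M) M snd = M"
proof (rule measure_eqI)
  interpret N: prob_space N by fact
  fix A assume "A \<in> sets (distr (N \<Otimes>\<^sub>M M) M snd)"
  then have A: "A \<in> sets M" by simp
  have "snd -` A \<inter> space (N \<Otimes>\<^sub>M M) = space N \<times> A"
    using sets.sets_into_space[OF A] by (auto simp: space_pair_measure)
  then show "emeasure (distr (N \<Otimes>\<^sub>M M) M snd) A = emeasure M A"
    using A by (simp add: emeasure_distr emeasure_pair_measure_Times N.emeasure_space_1)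
qed simp

lemma indep_vars_PiM_components:
  assumes M: "\<And>i. i \<in> I \<Longrightarrow> prob_space (M i)" and I: "I \<noteq> {}"
  shows "prob_space.indep_vars (PiM I M) M (\<lambda>i x. x i) I"
proof -
  interpret prob_space "PiM I M" by (rule prob_space_PiM[OF M])
  have "distr (PiM I M) (PiM I M) (\<lambda>x. \<lambda>i\<in>I. x i) = distr (PiM I M) (PiM I M) (\<lambda>x. x)"
    by (rule distr_cong) (auto simp: space_PiM PiE_restrict)
  also have "\<dots> = PiM I M" by (rule distr_id2) simp
  also have "\<dots> = PiM I (\<lambda>i. distr (PiM I M) (M i) (\<lambda>x. x i))"
    by (rule PiM_cong[OF refl distr_PiM_component[OF M, symmetric]])
  finally show ?thesis
    by (subst indep_vars_iff_distr_eq_PiM'[OF I]) auto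
qed

text \<open>Continuity from below along an enumeration of \<open>D\<close>. Discreteness is
  exploited through this lemma: in the coupling, to reduce to finitely many half-lines, and at the
  end, to reduce to finitely many atoms.\<close>

lemma (in prob_space) finite_approx_countable_support:
  assumes D: "countable D" "AE x in M. x \<in> D" "\<And>d. d \<in> D \<Longrightarrow> {d} \<in> sets M" and \<delta>: "0 < \<delta>"
  shows "\<exists>A. finite A \<and> A \<subseteq> D \<and> prob (space M - A) < \<delta>"
proof -
  \<comment> \<open>The enumeration \<open>from_nat_into D\<close> stays inside \<open>D\<close>
    only for nonempty \<open>D\<close>.\<close>
  have "D \<noteq> {}"
  proof
    assume "D = {}"
    then have "AE x in M. False" using D(2) by simp
    then show False by simp
  qed
  let ?A = "\<lambda>m::nat. from_nat_into D ` {..m}"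
  have sub: "?A m \<subseteq> D" for m
    using from_nat_into[OF \<open>D \<noteq> {}\<close>] by blast
  have sets: "?A m \<in> events" for m
    by (rule sets.countable[OF D(3)]) (use sub[of m] in blast, simp)
  have inc: "incseq ?A" by (intro incseq_SucI image_mono) simp
  have D_ev: "D \<in> events"
    using sets.countable[OF D(3) D(1)] .
  have "(\<Union>m. ?A m) = D"
  proof (intro equalityI subsetI)
    fix d assume "d \<in> D"
    then obtain m where "from_nat_into D m = d" using from_nat_into_surj[OF D(1)] by blast
    then show "d \<in> (\<Union>m. ?A m)" by blast
  qed (use sub in blast)
  then have "(\<lambda>m. prob (?A m)) \<longlonglongrightarrow> prob D"
    using finite_Lim_measure_incseq[of ?A] sets inc by (simp add: image_subset_iff)
  moreover have "prob D = 1" using D(2) D_ev by (simp add: prob_eq_1)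
  ultimately have "\<forall>\<^sub>F m in sequentially. 1 - \<delta> < prob (?A m)"
    using \<delta> by (intro order_tendstoD(1)[where y=1]) simp_all
  then obtain m where "1 - \<delta> < prob (?A m)"
    using eventually_happens'[OF sequentially_bot] by blast
  then have "prob (space M - ?A m) < \<delta>" by (simp add: prob_compl sets)
  then show ?thesis using sub[of m] by (intro exI[of _ "?A m"]) simp
qed

lemma (in prob_space) expectation_emp:
  assumes X: "\<And>k. k \<in> {1..n} \<Longrightarrow> random_variable N (X k)" and B: "B \<in> sets N"
  shows "expectation (\<lambda>w. emp n B (\<lambda>k. X k w)) = (\<Sum>k\<in>{1..n}. prob (X k -` B \<inter> space M)) / n"
proof -
  have e: "expectation (\<lambda>w. indicat_real B (X k w)) = prob (X k -` B \<inter> space M)"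
    "integrable M (\<lambda>w. indicat_real B (X k w))" if "k \<in> {1..n}" for k
  proof -
    have s: "X k -` B \<inter> space M \<in> events" using measurable_sets[OF X[OF that] B] .
    have c: "indicat_real B (X k w) = indicat_real (X k -` B \<inter> space M) w" if "w \<in> space M" for w
      using that by (simp add: indicator_def)
    have "expectation (\<lambda>w. indicat_real B (X k w)) = expectation (indicat_real (X k -` B \<inter> space M))"
      by (rule Bochner_Integration.integral_cong[OF refl c])
    also have "\<dots> = prob (X k -` B \<inter> space M)"
      using s by simp
    finally show "expectation (\<lambda>w. indicat_real B (X k w)) = prob (X k -` B \<inter> space M)" .
    have "integrable M (indicat_real (X k -` B \<inter> space M))"
      using s by (simp add: emeasure_eq_measure)
    then show "integrable M (\<lambda>w. indicat_real B (X k w))"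
      by (subst Bochner_Integration.integrable_cong[OF refl c])
  qed
  show ?thesis
    unfolding emp_eq_sum by (simp add: e del: atLeastAtMost_iff)
qed

lemma (in prob_space) integrable_emp_deviation:
  assumes X: "\<And>k. k \<in> {1..n} \<Longrightarrow> random_variable N (X k)" and B: "B \<in> sets N"
  shows "integrable M (\<lambda>w. \<bar>emp n B (\<lambda>k. X k w) - c\<bar>)"
proof (rule integrable_const_bound[where B="1 + \<bar>c\<bar>"])
  have "norm \<bar>emp n B (\<lambda>k. X k w) - c\<bar> \<le> 1 + \<bar>c\<bar>" for w
    using emp_nonneg[of n B "\<lambda>k. X k w"] emp_le_1[of n B "\<lambda>k. X k w"] by auto
  then show "AE w in M. norm \<bar>emp n B (\<lambda>k. X k w) - c\<bar> \<le> 1 + \<bar>c\<bar>" by (rule AE_I2)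
  show "(\<lambda>w. \<bar>emp n B (\<lambda>k. X k w) - c\<bar>) \<in> borel_measurable M"
    using measurable_emp[OF X B] by (intro borel_measurable_abs borel_measurable_diff) simp_all
qed

text \<open>The inputs of one repetition: one batch per child and \<open>n\<close> copula samples,
  all independent. Being free of addresses and of the underlying space \<open>P\<close>, it allows
  laws to be computed recursively along the tree.\<close>

definition rep_law :: "nat \<Rightarrow> nat \<Rightarrow> (nat \<Rightarrow> (nat \<Rightarrow> real) measure) \<Rightarrow> (nat \<Rightarrow> real) measure \<Rightarrow>
    ((nat \<Rightarrow> nat \<Rightarrow> real) \<times> (nat \<Rightarrow> nat \<Rightarrow> real)) measure" where
  "rep_law n N Bs C = PiM {1..N} Bs \<Otimes>\<^sub>M PiM {1..n} (\<lambda>_. C)"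

text \<open>Ties are broken by index, so the laws of the rows of one repetition depend on k; only their
  average over k converges.\<close>
definition row_law :: "nat \<Rightarrow> nat \<Rightarrow> (nat \<Rightarrow> (nat \<Rightarrow> real) measure) \<Rightarrow> (nat \<Rightarrow> real) measure \<Rightarrow>
    nat \<Rightarrow> (nat \<Rightarrow> real) measure" where
  "row_law n N Bs C k =
     distr (rep_law n N Bs C) (PiM {1..N} (\<lambda>_. borel)) (\<lambda>w. mra_rows n N (fst w) (snd w) k)"

lemma sets_rep_law:
  assumes "\<And>i. i \<in> {1..N} \<Longrightarrow> sets (Bs i) = sets (PiM {1..n} (\<lambda>_. borel :: real measure))"
    and "is_copula N C"
  shows "sets (rep_law n N Bs C) = sets (PiM {1..N} (\<lambda>_. PiM {1..n} (\<lambda>_. borel)) \<Otimes>\<^sub>M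
    PiM {1..n} (\<lambda>_. PiM {1..N} (\<lambda>_. borel)))"
  unfolding rep_law_def using assms(1) copula_sets[OF assms(2)]
  by (intro sets_pair_measure_cong sets_PiM_cong) simp_all

lemma measurable_mra_rows:
  assumes "\<And>i. i \<in> {1..N} \<Longrightarrow> sets (Bs i) = sets (PiM {1..n} (\<lambda>_. borel :: real measure))"
    and "is_copula N C" and k: "k \<in> {1..n}"
  shows "(\<lambda>w. mra_rows n N (fst w) (snd w) k) \<in> measurable (rep_law n N Bs C) (PiM {1..N} (\<lambda>_. borel))"
proof -
  let ?M = "PiM {1..N} (\<lambda>_. PiM {1..n} (\<lambda>_. borel :: real measure)) \<Otimes>\<^sub>M PiM {1..n} (\<lambda>_. PiM {1..N} (\<lambda>_. borel :: real measure))"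
  have eq: "measurable (rep_law n N Bs C) K = measurable ?M K" for K :: "(nat \<Rightarrow> real) measure"
    by (rule measurable_cong_sets[OF sets_rep_law[OF assms(1,2)] refl])
  have xs: "(\<lambda>w. fst w i j) \<in> borel_measurable ?M" if "i \<in> {1..N}" "j \<in> {1..n}" for i j
    by (rule measurable_compose[OF measurable_compose[OF measurable_fst measurable_component_singleton[OF that(1)]]
          measurable_component_singleton[OF that(2)]])
  have us: "(\<lambda>w. snd w j i) \<in> borel_measurable ?M" if "i \<in> {1..N}" "j \<in> {1..n}" for i j
    by (rule measurable_compose[OF measurable_compose[OF measurable_snd measurable_component_singleton[OF that(2)]]
          measurable_component_singleton[OF that(1)]])
  show ?thesis
    unfolding eq mra_rows_def
    by (rule measurable_restrict) (rule measurable_mra_row[OF xs us k])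
qed

lemma prob_space_rep_law:
  assumes "\<And>i. i \<in> {1..N} \<Longrightarrow> prob_space (Bs i)" "is_copula N C"
  shows "prob_space (rep_law n N Bs C)"
  unfolding rep_law_def
  by (rule prob_space_pair[OF prob_space_PiM[OF assms(1)] prob_space_PiM[OF copula_prob_space[OF assms(2)]]])

lemma prob_space_row_law:
  assumes "\<And>i. i \<in> {1..N} \<Longrightarrow> prob_space (Bs i)"
    "\<And>i. i \<in> {1..N} \<Longrightarrow> sets (Bs i) = sets (PiM {1..n} (\<lambda>_. borel :: real measure))"
    "is_copula N C" "k \<in> {1..n}"
  shows "prob_space (row_law n N Bs C k)"
  unfolding row_law_def
  by (rule prob_space.prob_space_distr[OF prob_space_rep_law[OF assms(1,3)] measurable_mra_rows[OF assms(2,3,4)]])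

text \<open>The combinatorial coupling divided by \<open>n\<close>, with the limit
  \<open>measure (\<mu> i) S\<close> inserted by the triangle inequality. Child batches and copula
  samples are thereby separated, and each can be estimated by itself.\<close>

lemma emp_rows_coupling:
  assumes \<mu>: "\<And>i. i \<in> {1..N} \<Longrightarrow> real_distribution (\<mu> i)" and A: "\<And>i. i \<in> {1..N} \<Longrightarrow> finite (A i)"
    and us: "\<And>j i. j \<in> {1..n} \<Longrightarrow> i \<in> {1..N} \<Longrightarrow> 0 < us j i \<and> us j i < 1"
  shows "\<bar>emp n B (mra_rows n N xs us) - emp n B (\<lambda>j. qvec N \<mu> (us j))\<bar> \<le>
    (\<Sum>i\<in>{1..N}. emp n (- A i) (\<lambda>j. quant (\<mu> i) (us j i)) +
      (\<Sum>a\<in>A i. (\<Sum>S\<in>{{..<a}, {..a}}.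
        \<bar>emp n S (xs i) - measure (\<mu> i) S\<bar> + \<bar>emp n S (\<lambda>j. quant (\<mu> i) (us j i)) - measure (\<mu> i) S\<bar>)))"
    (is "?l \<le> ?r")
\<comment> \<open>For \<open>n = 0\<close> both empirical frequencies are 0, since division by zero
  yields 0.\<close>
proof (cases "n = 0")
  case True
  then have "?l = 0" by (simp add: emp_def)
  also have "0 \<le> ?r" by (intro sum_nonneg add_nonneg_nonneg emp_nonneg abs_ge_zero)
  finally show ?thesis .
next
  case False
  define c where "c S i = real (card {j\<in>{1..n}. xs i j \<in> S})" for S i
  define d where "d S i = real (card {j\<in>{1..n}. quant (\<mu> i) (us j i) \<in> S})" for S i
  have E: "emp n S (xs i) = c S i / n" "emp n S (\<lambda>j. quant (\<mu> i) (us j i)) = d S i / n" for S i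
    by (simp_all add: emp_def c_def d_def)
  have "\<bar>real (card {k\<in>{1..n}. mra_rows n N xs us k \<in> B}) -
          real (card {j\<in>{1..n}. (\<lambda>i\<in>{1..N}. quant (\<mu> i) (us j i)) \<in> B})\<bar> \<le>
    (\<Sum>i\<in>{1..N}. real (card {j\<in>{1..n}. quant (\<mu> i) (us j i) \<notin> A i}) +
      (\<Sum>a\<in>A i. \<bar>real (card {j\<in>{1..n}. xs i j < a}) - real (card {j\<in>{1..n}. quant (\<mu> i) (us j i) < a})\<bar> +
        \<bar>real (card {j\<in>{1..n}. xs i j \<le> a}) - real (card {j\<in>{1..n}. quant (\<mu> i) (us j i) \<le> a})\<bar>))"
  proof (rule card_mra_rows_coupling[OF _ A])
    fix i j j' assume *: "i \<in> {1..N}" "j \<in> {1..n}" "j' \<in> {1..n}" "us j i \<le> us j' i"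
    then show "quant (\<mu> i) (us j i) \<le> quant (\<mu> i) (us j' i)"
      using us[OF *(2,1)] us[OF *(3,1)] by (intro quant_mono \<mu>) simp_all
  qed
  also have "\<dots> = (\<Sum>i\<in>{1..N}. d (- A i) i + (\<Sum>a\<in>A i. \<bar>c {..<a} i - d {..<a} i\<bar> + \<bar>c {..a} i - d {..a} i\<bar>))"
    by (simp add: c_def d_def)
  finally have "\<bar>real (card {k\<in>{1..n}. mra_rows n N xs us k \<in> B}) -
          real (card {j\<in>{1..n}. (\<lambda>i\<in>{1..N}. quant (\<mu> i) (us j i)) \<in> B})\<bar> / n \<le> \<dots> / n"
    by (rule divide_right_mono) simp
  then have "?l \<le> (\<Sum>i\<in>{1..N}. d (- A i) i + (\<Sum>a\<in>A i. \<bar>c {..<a} i - d {..<a} i\<bar> + \<bar>c {..a} i - d {..a} i\<bar>)) / n"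
    unfolding emp_def qvec_def diff_divide_distrib[symmetric] abs_divide by simp
  also have "\<dots> = (\<Sum>i\<in>{1..N}. emp n (- A i) (\<lambda>j. quant (\<mu> i) (us j i)) +
      (\<Sum>a\<in>A i. \<bar>emp n {..<a} (xs i) - emp n {..<a} (\<lambda>j. quant (\<mu> i) (us j i))\<bar> +
         \<bar>emp n {..a} (xs i) - emp n {..a} (\<lambda>j. quant (\<mu> i) (us j i))\<bar>))"
    unfolding E diff_divide_distrib[symmetric] abs_divide
    by (simp add: sum_divide_distrib add_divide_distrib)
  also have "\<dots> \<le> ?r"
  proof (intro sum_mono add_mono order_refl)
    fix i and a :: real
    \<comment> \<open>The inner sum runs over a set of half-lines, so it has two terms only because
      the two are different.\<close>
    have "a \<in> {..a}" "a \<notin> {..<a}" by simp_all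
    then have "{..<a} \<noteq> {..a}" by blast
    then have sum2: "(\<Sum>S\<in>{{..<a}, {..a}}. f S) = f {..<a} + f {..a}" for f :: "real set \<Rightarrow> real" by simp
    have tri: "\<bar>p - q\<bar> \<le> \<bar>p - m\<bar> + \<bar>q - m\<bar>" for p q m :: real by linarith
    show "\<bar>emp n {..<a} (xs i) - emp n {..<a} (\<lambda>j. quant (\<mu> i) (us j i))\<bar> +
         \<bar>emp n {..a} (xs i) - emp n {..a} (\<lambda>j. quant (\<mu> i) (us j i))\<bar> \<le> (\<Sum>S\<in>{{..<a}, {..a}}.
        \<bar>emp n S (xs i) - measure (\<mu> i) S\<bar> + \<bar>emp n S (\<lambda>j. quant (\<mu> i) (us j i)) - measure (\<mu> i) S\<bar>)"
      unfolding sum2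
      by (rule add_mono[OF tri tri])
  qed
  finally show ?thesis .
qed

lemma measurable_emp_component:
  assumes "sets M = sets (PiM {1..n} (\<lambda>_. N))" "S \<in> sets N"
  shows "(\<lambda>x. \<bar>emp n S x - c\<bar>) \<in> borel_measurable M"
proof -
  have "(\<lambda>x. indicat_real S (x k)) \<in> borel_measurable M" if "k \<in> {1..n}" for k
    unfolding measurable_cong_sets[OF assms(1) refl]
    by (rule measurable_compose[OF measurable_component_singleton[OF that] borel_measurable_indicator[OF assms(2)]])
  then show ?thesis
    unfolding emp_eq_sum
    by (intro borel_measurable_abs borel_measurable_diff borel_measurable_divide borel_measurable_sum borel_measurable_const)
qed

lemma (in prob_space) integrable_emp:
  assumes X: "\<And>k. k \<in> {1..n} \<Longrightarrow> random_variable N (X k)" and B: "B \<in> sets N"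
  shows "integrable M (\<lambda>w. emp n B (\<lambda>k. X k w))"
proof -
  have "integrable M (\<lambda>w. \<bar>emp n B (\<lambda>k. X k w) - 0\<bar>)"
    by (rule integrable_emp_deviation[OF X B])
  then show ?thesis by (simp only: diff_0_right abs_of_nonneg[OF emp_nonneg])
qed

text \<open>Expectation of the coupling bound over one repetition. The mean empirical frequency of
  the rows is the average of the row laws, while that of the quantile vectors is exactly their
  common law.\<close>

lemma row_law_avg_deviation:
  assumes Bs: "\<And>i. i \<in> {1..N} \<Longrightarrow> prob_space (Bs i)"
      "\<And>i. i \<in> {1..N} \<Longrightarrow> sets (Bs i) = sets (PiM {1..n} (\<lambda>_. borel :: real measure))"
    and C: "is_copula N C" and \<mu>: "\<And>i. i \<in> {1..N} \<Longrightarrow> real_distribution (\<mu> i)"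
    and A: "\<And>i. i \<in> {1..N} \<Longrightarrow> finite (A i)"
    and B: "B \<in> sets (PiM {1..N} (\<lambda>_. borel))" and n: "0 < n"
  shows "\<bar>(\<Sum>k\<in>{1..n}. measure (row_law n N Bs C k) B) / n -
      measure (distr C (PiM {1..N} (\<lambda>_. borel)) (qvec N \<mu>)) B\<bar> \<le>
    (\<Sum>i\<in>{1..N}. measure (\<mu> i) (- A i) + (\<Sum>a\<in>A i. (\<Sum>S\<in>{{..<a}, {..a}}.
        (\<integral>x. \<bar>emp n S x - measure (\<mu> i) S\<bar> \<partial>Bs i) +
        (\<integral>u. \<bar>emp n S (\<lambda>j. quant (\<mu> i) (u j i)) - measure (\<mu> i) S\<bar> \<partial>PiM {1..n} (\<lambda>_. C)))))"
proof -
  let ?K = "PiM {1..N} (\<lambda>_. borel :: real measure)" and ?U = "PiM {1..n} (\<lambda>_. C)"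
  define R where "R = rep_law n N Bs C"
  have C': "prob_space C" by (rule copula_prob_space[OF C])
  have U': "prob_space ?U" by (rule prob_space_PiM[OF C'])
  interpret U: prob_space ?U by (rule U')
  interpret R: prob_space R unfolding R_def by (rule prob_space_rep_law[OF Bs(1) C])
  interpret X: prob_space "PiM {1..N} Bs" by (rule prob_space_PiM[OF Bs(1)])
  have snd: "snd \<in> measurable R ?U" and fst: "fst \<in> measurable R (PiM {1..N} Bs)"
    unfolding R_def rep_law_def by (rule measurable_snd, rule measurable_fst)
  have dsnd: "distr R ?U snd = ?U"
    unfolding R_def rep_law_def by (rule U.distr_pair_snd[OF X.prob_space_axioms])
  have dfst: "distr R (PiM {1..N} Bs) fst = PiM {1..N} Bs"
    unfolding R_def rep_law_def by (rule U.distr_pair_fst)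
  have sndj: "(\<lambda>w. snd w j) \<in> measurable R C" if "j \<in> {1..n}" for j
    by (rule measurable_compose[OF snd measurable_component_singleton[OF that]])
  have dsndj: "distr R C (\<lambda>w. snd w j) = C" if "j \<in> {1..n}" for j
  proof -
    have "distr (distr R ?U snd) C (\<lambda>u. u j) = distr R C ((\<lambda>u. u j) \<circ> snd)"
      by (rule distr_distr[OF measurable_component_singleton[OF that] snd])
    then show ?thesis
      unfolding dsnd comp_def using distr_PiM_component[of "{1..n}" "\<lambda>_. C" j, OF C' that] by simp
  qed
  have fsti: "(\<lambda>w. fst w i) \<in> measurable R (Bs i)" if "i \<in> {1..N}" for i
    by (rule measurable_compose[OF fst measurable_component_singleton[OF that]])
  have dfsti: "distr R (Bs i) (\<lambda>w. fst w i) = Bs i" if "i \<in> {1..N}" for i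
  proof -
    have "distr (distr R (PiM {1..N} Bs) fst) (Bs i) (\<lambda>u. u i) = distr R (Bs i) ((\<lambda>u. u i) \<circ> fst)"
      by (rule distr_distr[OF measurable_component_singleton[OF that] fst])
    then show ?thesis
      unfolding dfst comp_def using distr_PiM_component[of "{1..N}" Bs i, OF Bs(1) that] by simp
  qed
  have q: "qvec N \<mu> \<in> measurable C ?K" by (rule measurable_qvec[OF C \<mu>])
  have qi: "(\<lambda>u. quant (\<mu> i) (u i)) \<in> borel_measurable C" if "i \<in> {1..N}" for i
    by (rule measurable_compose[OF measurable_copula_component[OF C that] measurable_quant[OF \<mu>[OF that]]])
  define frow where "frow w = emp n B (mra_rows n N (fst w) (snd w))" for w
  define fZ where "fZ w = emp n B (\<lambda>j. qvec N \<mu> (snd w j))"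
    for w :: "(nat \<Rightarrow> nat \<Rightarrow> real) \<times> (nat \<Rightarrow> nat \<Rightarrow> real)"
  have rows: "(\<lambda>w. mra_rows n N (fst w) (snd w) k) \<in> measurable R ?K" if "k \<in> {1..n}" for k
    unfolding R_def by (rule measurable_mra_rows[OF Bs(2) C that])
  have Z: "(\<lambda>w. qvec N \<mu> (snd w j)) \<in> measurable R ?K" if "j \<in> {1..n}" for j
    by (rule measurable_compose[OF sndj[OF that] q])
  have "R.expectation frow = (\<Sum>k\<in>{1..n}. R.prob ((\<lambda>w. mra_rows n N (fst w) (snd w) k) -` B \<inter> space R)) / n"
    unfolding frow_def by (rule R.expectation_emp[OF rows B])
  also have "(\<Sum>k\<in>{1..n}. R.prob ((\<lambda>w. mra_rows n N (fst w) (snd w) k) -` B \<inter> space R)) =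
      (\<Sum>k\<in>{1..n}. measure (row_law n N Bs C k) B)"
    unfolding row_law_def R_def[symmetric]
    by (rule sum.cong[OF refl measure_distr[OF rows B, symmetric]])
  finally have E1: "R.expectation frow = (\<Sum>k\<in>{1..n}. measure (row_law n N Bs C k) B) / n" .
  have "R.expectation fZ = (\<Sum>j\<in>{1..n}. R.prob ((\<lambda>w. qvec N \<mu> (snd w j)) -` B \<inter> space R)) / n"
    unfolding fZ_def by (rule R.expectation_emp[OF Z B])
  also have "(\<Sum>j\<in>{1..n}. R.prob ((\<lambda>w. qvec N \<mu> (snd w j)) -` B \<inter> space R)) = (\<Sum>j\<in>{1..n}. measure (distr C ?K (qvec N \<mu>)) B)"
  proof (rule sum.cong[OF refl])
    fix j assume j: "j \<in> {1..n}"
    have "distr C ?K (qvec N \<mu>) = distr R ?K (\<lambda>w. qvec N \<mu> (snd w j))"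
      using distr_distr[OF q sndj[OF j]] unfolding dsndj[OF j] comp_def .
    then show "R.prob ((\<lambda>w. qvec N \<mu> (snd w j)) -` B \<inter> space R) = measure (distr C ?K (qvec N \<mu>)) B"
      by (simp only: measure_distr[OF Z[OF j] B])
  qed
  also have "\<dots> / n = measure (distr C ?K (qvec N \<mu>)) B" using n by simp
  finally have E2: "R.expectation fZ = measure (distr C ?K (qvec N \<mu>)) B" .
  have "integrable R frow" unfolding frow_def by (rule R.integrable_emp[OF rows B])
  moreover have "integrable R fZ" unfolding fZ_def by (rule R.integrable_emp[OF Z B])
  ultimately have int: "integrable R frow" "integrable R fZ" .
  \<comment> \<open>The coupling bound as a random variable. Each summand depends on one child batch
    or on the copula samples alone, so its integral reduces to one over \<open>Bs i\<close> or over
    the samples.\<close>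
  define h where "h w = (\<Sum>i\<in>{1..N}. emp n (- A i) (\<lambda>j. quant (\<mu> i) (snd w j i)) +
      (\<Sum>a\<in>A i. (\<Sum>S\<in>{{..<a}, {..a}}.
        \<bar>emp n S (fst w i) - measure (\<mu> i) S\<bar> + \<bar>emp n S (\<lambda>j. quant (\<mu> i) (snd w j i)) - measure (\<mu> i) S\<bar>)))" for w
  have hb: "has_bochner_integral R h (\<Sum>i\<in>{1..N}. measure (\<mu> i) (- A i) + (\<Sum>a\<in>A i. (\<Sum>S\<in>{{..<a}, {..a}}.
        (\<integral>x. \<bar>emp n S x - measure (\<mu> i) S\<bar> \<partial>Bs i) +
        (\<integral>u. \<bar>emp n S (\<lambda>j. quant (\<mu> i) (u j i)) - measure (\<mu> i) S\<bar> \<partial>?U))))"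
    unfolding h_def
  proof (intro has_bochner_integral_sum has_bochner_integral_add)
    fix i assume i: "i \<in> {1..N}"
    have qm: "(\<lambda>w. quant (\<mu> i) (snd w j i)) \<in> borel_measurable R" if "j \<in> {1..n}" for j
      by (rule measurable_compose[OF sndj[OF that] qi[OF i]])
    have Ai: "- A i \<in> sets borel"
      using A[OF i] by (intro borel_comp borel_closed finite_imp_closed)
    have "R.expectation (\<lambda>w. emp n (- A i) (\<lambda>j. quant (\<mu> i) (snd w j i))) =
       (\<Sum>j\<in>{1..n}. R.prob ((\<lambda>w. quant (\<mu> i) (snd w j i)) -` (- A i) \<inter> space R)) / n"
      by (rule R.expectation_emp[OF qm Ai])
    also have "(\<Sum>j\<in>{1..n}. R.prob ((\<lambda>w. quant (\<mu> i) (snd w j i)) -` (- A i) \<inter> space R)) = (\<Sum>j\<in>{1..n}. measure (\<mu> i) (- A i))"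
    proof (rule sum.cong[OF refl])
      fix j assume j: "j \<in> {1..n}"
      have "\<mu> i = distr R borel (\<lambda>w. quant (\<mu> i) (snd w j i))"
        using distr_distr[OF qi[OF i] sndj[OF j]]
        unfolding dsndj[OF j] comp_def distr_copula_quant[OF C i \<mu>[OF i]] .
      then have "measure (\<mu> i) (- A i) = measure (distr R borel (\<lambda>w. quant (\<mu> i) (snd w j i))) (- A i)" by simp
      then show "R.prob ((\<lambda>w. quant (\<mu> i) (snd w j i)) -` (- A i) \<inter> space R) = measure (\<mu> i) (- A i)"
        by (simp only: measure_distr[OF qm[OF j] Ai])
    qed
    also have "\<dots> / n = measure (\<mu> i) (- A i)" using n by simp
    finally have e: "R.expectation (\<lambda>w. emp n (- A i) (\<lambda>j. quant (\<mu> i) (snd w j i))) = measure (\<mu> i) (- A i)" .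
    have "integrable R (\<lambda>w. emp n (- A i) (\<lambda>j. quant (\<mu> i) (snd w j i)))"
      by (rule R.integrable_emp[OF qm Ai])
    then show "has_bochner_integral R (\<lambda>w. emp n (- A i) (\<lambda>j. quant (\<mu> i) (snd w j i))) (measure (\<mu> i) (- A i))"
      unfolding has_bochner_integral_iff using e by blast
    fix a and S :: "real set" assume S: "S \<in> {{..<a}, {..a}}"
    then have Sb: "S \<in> sets borel" by auto
    let ?c = "measure (\<mu> i) S"
    have m1: "(\<lambda>x. \<bar>emp n S x - ?c\<bar>) \<in> borel_measurable (Bs i)"
      by (rule measurable_emp_component[OF Bs(2)[OF i] Sb])
    have xm: "(\<lambda>w. fst w i k) \<in> borel_measurable R" if "k \<in> {1..n}" for k
    proof (rule measurable_compose[OF fsti[OF i]])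
      show "(\<lambda>x. x k) \<in> borel_measurable (Bs i)"
        unfolding measurable_cong_sets[OF Bs(2)[OF i] refl] by (rule measurable_component_singleton[OF that])
    qed
    have "R.expectation (\<lambda>w. \<bar>emp n S (fst w i) - ?c\<bar>) = (\<integral>x. \<bar>emp n S x - ?c\<bar> \<partial>Bs i)"
      using integral_distr[OF fsti[OF i] m1] unfolding dfsti[OF i] by simp
    moreover have "integrable R (\<lambda>w. \<bar>emp n S (fst w i) - ?c\<bar>)"
      by (rule R.integrable_emp_deviation[OF xm Sb])
    ultimately show "has_bochner_integral R (\<lambda>w. \<bar>emp n S (fst w i) - ?c\<bar>) (\<integral>x. \<bar>emp n S x - ?c\<bar> \<partial>Bs i)"
      unfolding has_bochner_integral_iff by blast
    have qU: "(\<lambda>u. quant (\<mu> i) (u j i)) \<in> borel_measurable ?U" if "j \<in> {1..n}" for j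
      by (rule measurable_compose[OF measurable_component_singleton[OF that] qi[OF i]])
    have m2: "(\<lambda>u. \<bar>emp n S (\<lambda>j. quant (\<mu> i) (u j i)) - ?c\<bar>) \<in> borel_measurable ?U"
      using U.integrable_emp_deviation[OF qU Sb] by (rule borel_measurable_integrable)
    have "R.expectation (\<lambda>w. \<bar>emp n S (\<lambda>j. quant (\<mu> i) (snd w j i)) - ?c\<bar>) =
       (\<integral>u. \<bar>emp n S (\<lambda>j. quant (\<mu> i) (u j i)) - ?c\<bar> \<partial>?U)"
      using integral_distr[OF snd m2] unfolding dsnd by simp
    moreover have "integrable R (\<lambda>w. \<bar>emp n S (\<lambda>j. quant (\<mu> i) (snd w j i)) - ?c\<bar>)"
      by (rule R.integrable_emp_deviation[OF qm Sb])
    ultimately show "has_bochner_integral R (\<lambda>w. \<bar>emp n S (\<lambda>j. quant (\<mu> i) (snd w j i)) - ?c\<bar>)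
       (\<integral>u. \<bar>emp n S (\<lambda>j. quant (\<mu> i) (u j i)) - ?c\<bar> \<partial>?U)"
      unfolding has_bochner_integral_iff by blast
  qed
  \<comment> \<open>The pointwise coupling requires all copula samples in the open cube, where
    \<open>quant\<close> is monotone; this holds almost surely.\<close>
  have "AE u in ?U. \<forall>j\<in>{1..n}. \<forall>i\<in>{1..N}. 0 < u j i \<and> u j i < 1"
    by (rule AE_ball_countable'[OF AE_PiM_component[of "{1..n}" "\<lambda>_. C", OF C' _ copula_AE_interior[OF C]]]) simp_all
  then have "AE w in R. \<forall>j\<in>{1..n}. \<forall>i\<in>{1..N}. 0 < snd w j i \<and> snd w j i < 1"
    by (intro AE_distrD[OF snd]) (simp only: dsnd)
  then have ae: "AE w in R. \<bar>frow w - fZ w\<bar> \<le> h w"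
  proof eventually_elim
    case (elim w)
    show ?case
      unfolding frow_def fZ_def h_def by (rule emp_rows_coupling[OF \<mu> A]) (use elim in blast)+
  qed
  have "\<bar>R.expectation frow - R.expectation fZ\<bar> = \<bar>R.expectation (\<lambda>w. frow w - fZ w)\<bar>"
    using int by simp
  also have "\<dots> \<le> R.expectation (\<lambda>w. \<bar>frow w - fZ w\<bar>)"
    by (rule integral_abs_bound)
  also have "\<dots> \<le> R.expectation h"
    using hb int ae by (intro integral_mono_AE) (simp_all add: has_bochner_integral_iff)
  finally show ?thesis
    unfolding E1 E2 has_bochner_integral_integral_eq[OF hb] .
qed

text \<open>The mean deviation on a canonical product space, with factors that may differ. The maps
  \<open>f k\<close> cover both raw batches (identity) and copula samples (quantile
  transform).\<close>

lemma PiM_emp_deviation: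
  assumes \<rho>: "\<And>k. k \<in> {1..n} \<Longrightarrow> prob_space (\<rho> k)" and f: "\<And>k. k \<in> {1..n} \<Longrightarrow> f k \<in> measurable (\<rho> k) N"
    and B: "B \<in> sets N" and n: "0 < n" and \<epsilon>: "0 \<le> \<epsilon>"
  shows "(\<integral>y. \<bar>emp n B (\<lambda>k. f k (y k)) - (\<Sum>k\<in>{1..n}. measure (distr (\<rho> k) N (f k)) B) / n\<bar> \<partial>PiM {1..n} \<rho>)
    \<le> \<epsilon> + 2 * exp (- 2 * real n * \<epsilon>\<^sup>2)"
proof -
  interpret P: prob_space "PiM {1..n} \<rho>" by (rule prob_space_PiM[OF \<rho>])
  have ne: "{1..n} \<noteq> {}" using n by simp
  have ind: "P.indep_vars (\<lambda>_. N) (\<lambda>k y. f k (y k)) {1..n}"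
    by (rule P.indep_vars_compose2[OF indep_vars_PiM_components[OF \<rho> ne] f])
  have "P.prob ((\<lambda>y. f k (y k)) -` B \<inter> space (PiM {1..n} \<rho>)) = measure (distr (\<rho> k) N (f k)) B" if k: "k \<in> {1..n}" for k
  proof -
    have c: "distr (PiM {1..n} \<rho>) (\<rho> k) (\<lambda>x. x k) = \<rho> k"
      by (rule distr_PiM_component[OF \<rho> k])
    have "distr (\<rho> k) N (f k) = distr (PiM {1..n} \<rho>) N (\<lambda>y. f k (y k))"
      using distr_distr[OF f[OF k] measurable_component_singleton[OF k, of \<rho>]]
      unfolding c comp_def .
    then show ?thesis
      using measure_distr[OF measurable_compose[OF measurable_component_singleton[OF k, of \<rho>] f[OF k]] B] by simp
  qed
  then have "(\<Sum>k\<in>{1..n}. measure (distr (\<rho> k) N (f k)) B) =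
      (\<Sum>k\<in>{1..n}. P.prob ((\<lambda>y. f k (y k)) -` B \<inter> space (PiM {1..n} \<rho>)))"
    by (intro sum.cong[OF refl]) simp
  then show ?thesis
    using P.expectation_emp_deviation[OF ind B n \<epsilon>] by simp
qed

lemma copula_emp_tendsto:
  assumes C: "is_copula N C" and i: "i \<in> {1..N}" and \<mu>: "real_distribution \<mu>" and S: "S \<in> sets borel"
  shows "(\<lambda>n. \<integral>u. \<bar>emp n S (\<lambda>j. quant \<mu> (u j i)) - measure \<mu> S\<bar> \<partial>PiM {1..n} (\<lambda>_. C)) \<longlonglongrightarrow> 0"
proof (rule tendsto_zeroI_eps_exp)
  fix n :: nat and \<epsilon> :: real assume n: "0 < n" and \<epsilon>: "0 < \<epsilon>"
  have q: "(\<lambda>u. quant \<mu> (u i)) \<in> borel_measurable C"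
    by (rule measurable_compose[OF measurable_copula_component[OF C i] measurable_quant[OF \<mu>]])
  have "(\<Sum>k\<in>{1..n}. measure (distr C borel (\<lambda>u. quant \<mu> (u i))) S) / n = measure \<mu> S"
    using n unfolding distr_copula_quant[OF C i \<mu>] by simp
  then show "(\<integral>u. \<bar>emp n S (\<lambda>j. quant \<mu> (u j i)) - measure \<mu> S\<bar> \<partial>PiM {1..n} (\<lambda>_. C)) \<le> \<epsilon> + 2 * exp (- 2 * real n * \<epsilon>\<^sup>2)"
    using PiM_emp_deviation[of n "\<lambda>_. C", OF copula_prob_space[OF C] q S n less_imp_le[OF \<epsilon>]] by simp
qed (rule integral_nonneg_AE, simp)

text \<open>The step from the children to their parent: if the child batches have vanishing mean
  deviation, the averaged row laws converge on every Borel set of vectors.\<close>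

lemma row_law_avg_tendsto:
  assumes C: "is_copula N C"
    and \<mu>: "\<And>i. i \<in> {1..N} \<Longrightarrow> real_distribution (\<mu> i)" "\<And>i. i \<in> {1..N} \<Longrightarrow> discrete_distr (\<mu> i)"
    and Bs: "\<And>n i. i \<in> {1..N} \<Longrightarrow> prob_space (Bs n i)"
      "\<And>n i. i \<in> {1..N} \<Longrightarrow> sets (Bs n i) = sets (PiM {1..n} (\<lambda>_. borel :: real measure))"
    and dev: "\<And>i S. i \<in> {1..N} \<Longrightarrow> S \<in> sets borel \<Longrightarrow>
      (\<lambda>n. \<integral>x. \<bar>emp n S x - measure (\<mu> i) S\<bar> \<partial>Bs n i) \<longlonglongrightarrow> 0"
    and B: "B \<in> sets (PiM {1..N} (\<lambda>_. borel))"
  shows "(\<lambda>n. (\<Sum>k\<in>{1..n}. measure (row_law n N (Bs n) C k) B) / n) \<longlonglongrightarrow>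
      measure (distr C (PiM {1..N} (\<lambda>_. borel)) (qvec N \<mu>)) B" (is "?f \<longlonglongrightarrow> ?m")
proof (rule LIMSEQ_I)
  fix r :: real assume r: "0 < r"
  \<comment> \<open>Each of the \<open>N\<close> coordinates may lose mass \<delta> outside its
    finite set; the \<open>+ 1\<close> gives \<open>N * \<delta> < r\<close> and avoids dividing by
    zero when \<open>N = 0\<close>.\<close>
  define \<delta> where "\<delta> = r / (real N + 1)"
  have \<delta>: "0 < \<delta>" "real N * \<delta> < r" using r by (auto simp: \<delta>_def field_simps)
  have "\<exists>A. finite A \<and> measure (\<mu> i) (- A) < \<delta>" if i: "i \<in> {1..N}" for i
  proof -
    interpret real_distribution "\<mu> i" by (rule \<mu>(1)[OF i])
    obtain D where "countable D" "AE x in \<mu> i. x \<in> D"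
      using \<mu>(2)[OF i] by (auto simp: discrete_distr_def)
    then obtain A where "finite A" "prob (space (\<mu> i) - A) < \<delta>"
      using finite_approx_countable_support[of D \<delta>] \<delta> by auto
    then show ?thesis by (intro exI[of _ A]) (simp add: Compl_eq_Diff_UNIV)
  qed
  then obtain A where A: "\<And>i. i \<in> {1..N} \<Longrightarrow> finite (A i)" "\<And>i. i \<in> {1..N} \<Longrightarrow> measure (\<mu> i) (- A i) < \<delta>"
    by metis
  define g where "g n = (\<Sum>i\<in>{1..N}. measure (\<mu> i) (- A i) + (\<Sum>a\<in>A i. (\<Sum>S\<in>{{..<a}, {..a}}.
        (\<integral>x. \<bar>emp n S x - measure (\<mu> i) S\<bar> \<partial>Bs n i) +
        (\<integral>u. \<bar>emp n S (\<lambda>j. quant (\<mu> i) (u j i)) - measure (\<mu> i) S\<bar> \<partial>PiM {1..n} (\<lambda>_. C)))))" for n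
  \<comment> \<open>The sets \<open>A i\<close> are fixed before \<open>n\<close> grows, so only
    finitely many half-lines occur. Their deviations vanish and the mass outside the
    \<open>A i\<close> remains.\<close>
  have "g \<longlonglongrightarrow> (\<Sum>i\<in>{1..N}. measure (\<mu> i) (- A i) + (\<Sum>a\<in>A i. (\<Sum>S\<in>{{..<a}, {..a}}. 0 + 0)))"
    unfolding g_def
  proof (intro tendsto_sum tendsto_add tendsto_const)
    fix i a and S :: "real set" assume i: "i \<in> {1..N}" and "S \<in> {{..<a}, {..a}}"
    then have S: "S \<in> sets borel" by auto
    show "(\<lambda>n. \<integral>x. \<bar>emp n S x - measure (\<mu> i) S\<bar> \<partial>Bs n i) \<longlonglongrightarrow> 0" by (rule dev[OF i S])
    show "(\<lambda>n. \<integral>u. \<bar>emp n S (\<lambda>j. quant (\<mu> i) (u j i)) - measure (\<mu> i) S\<bar> \<partial>PiM {1..n} (\<lambda>_. C)) \<longlonglongrightarrow> 0"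
      by (rule copula_emp_tendsto[OF C i \<mu>(1)[OF i] S])
  qed
  moreover have "(\<Sum>i\<in>{1..N}. measure (\<mu> i) (- A i) + (\<Sum>a\<in>A i. (\<Sum>S\<in>{{..<a}, {..a}}. 0 + 0))) < r"
  proof -
    have "(\<Sum>i\<in>{1..N}. measure (\<mu> i) (- A i) + (\<Sum>a\<in>A i. (\<Sum>S\<in>{{..<a}, {..a}}. 0 + 0))) = (\<Sum>i\<in>{1..N}. measure (\<mu> i) (- A i))"
      by simp
    also have "\<dots> \<le> (\<Sum>i\<in>{1..N}. \<delta>)" using A(2) by (intro sum_mono less_imp_le)
    also have "\<dots> < r" using \<delta> by simp
    finally show ?thesis .
  qed
  ultimately have "\<forall>\<^sub>F n in sequentially. g n < r" by (rule order_tendstoD(2))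
  then have "\<forall>\<^sub>F n in sequentially. norm (?f n - ?m) < r"
    using eventually_gt_at_top[of 0]
  proof eventually_elim
    case (elim n)
    have "\<bar>?f n - ?m\<bar> \<le> g n"
      unfolding g_def by (rule row_law_avg_deviation[OF Bs C \<mu>(1) A(1) B elim(2)])
    then show ?case using elim(1) by simp
  qed
  then show "\<exists>no. \<forall>n\<ge>no. norm (?f n - ?m) < r" by (simp add: eventually_sequentially)
qed

section \<open>Laws of whole batches and heights of subtrees\<close>

text \<open>The recursion of \<open>mra_X\<close> carried out on laws. The factors of the product
  are independent because output \<open>k\<close> stems from repetition \<open>k\<close>; they vary
  with \<open>k\<close> through the tie-breaking.\<close>

primrec batch_law :: "nat \<Rightarrow> nat list set \<Rightarrow> (nat list \<Rightarrow> real measure) \<Rightarrow>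
    (nat list \<Rightarrow> (nat \<Rightarrow> real) measure) \<Rightarrow> nat \<Rightarrow> nat list \<Rightarrow> (nat \<Rightarrow> real) measure" where
  "batch_law 0 \<tau> L C n J = PiM {1..n} (\<lambda>_. L J)"
| "batch_law (Suc f) \<tau> L C n J =
     (if nchild \<tau> J = 0 then PiM {1..n} (\<lambda>_. L J)
      else PiM {1..n} (\<lambda>k. distr (row_law n (nchild \<tau> J) (\<lambda>i. batch_law f \<tau> L C n (J @ [i])) (C J) k)
             borel (\<lambda>y. \<Sum>i\<in>{1..nchild \<tau> J}. y i)))"

text \<open>A bound on the depth of the subtree below \<open>J\<close>: with fuel \<open>f\<close>
  the recursion reaches the leaves before the fuel is exhausted.\<close>

definition height_le :: "nat list set \<Rightarrow> nat list \<Rightarrow> nat \<Rightarrow> bool" where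
  "height_le \<tau> J f \<longleftrightarrow> (\<forall>K. J @ K \<in> \<tau> \<longrightarrow> length K \<le> f)"

lemma height_le_0: "height_le \<tau> J 0 \<Longrightarrow> nchild \<tau> J = 0"
proof -
  assume "height_le \<tau> J 0"
  then have "{i. J @ [i] \<in> \<tau>} = {}" unfolding height_le_def by fastforce
  then show ?thesis unfolding nchild_def by (simp only: card.empty)
qed

lemma height_le_child: "height_le \<tau> J (Suc f) \<Longrightarrow> height_le \<tau> (J @ [i]) f"
  unfolding height_le_def by fastforce

lemma agg_tree_prefix:
  assumes "agg_tree \<tau>" "J @ K \<in> \<tau>" shows "J \<in> \<tau>"
  using assms(2)
proof (induction K rule: rev_induct)
  case (snoc x K)
  then have "(J @ K) @ [x] \<in> \<tau>" by simp
  then have "J @ K \<in> \<tau>" using assms(1) unfolding agg_tree_def by blast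
  then show ?case by (rule snoc.IH)
qed simp

text \<open>The prefixes of a descending path \<open>K\<close> yield \<open>length K + 1\<close>
  distinct nodes, whence the \<open>- 1\<close>.\<close>

lemma height_le_card:
  assumes "agg_tree \<tau>" shows "height_le \<tau> J (card \<tau> - 1)"
  unfolding height_le_def
proof (intro allI impI)
  fix K assume K: "J @ K \<in> \<tau>"
  have "(\<lambda>m. J @ take m K) ` {..length K} \<subseteq> \<tau>"
  proof
    fix x assume "x \<in> (\<lambda>m. J @ take m K) ` {..length K}"
    then obtain m where x: "x = J @ take m K" by blast
    have "(J @ take m K) @ drop m K \<in> \<tau>" using K by simp
    then show "x \<in> \<tau>" unfolding x by (rule agg_tree_prefix[OF assms])
  qed
  moreover have "inj_on (\<lambda>m. J @ take m K) {..length K}"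
  proof (rule inj_onI)
    fix m m' assume "m \<in> {..length K}" "m' \<in> {..length K}" "J @ take m K = J @ take m' K"
    then have "min (length K) m = min (length K) m'" "m \<le> length K" "m' \<le> length K"
      by (metis length_take same_append_eq, simp_all)
    then show "m = m'" by (auto simp: min_def split: if_splits)
  qed
  ultimately have "card {..length K} \<le> card \<tau>"
    using assms unfolding agg_tree_def by (intro card_inj_on_le) blast+
  then show "length K \<le> card \<tau> - 1" by simp
qed

lemma agg_tree_child: "agg_tree \<tau> \<Longrightarrow> J \<in> \<tau> \<Longrightarrow> i \<in> {1..nchild \<tau> J} \<Longrightarrow> J @ [i] \<in> \<tau>"
  unfolding agg_tree_def by blast

text \<open>Each coordinate of the quantile vector has a law carried by a countable set, and a
  finite product of countable sets is countable.\<close>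

lemma copula_law_countable_support:
  assumes C: "is_copula N C"
    and \<mu>: "\<And>i. i \<in> {1..N} \<Longrightarrow> real_distribution (\<mu> i)" "\<And>i. i \<in> {1..N} \<Longrightarrow> discrete_distr (\<mu> i)"
  shows "\<exists>D. countable D \<and> D \<subseteq> PiE {1..N} (\<lambda>_. UNIV) \<and>
    (AE y in distr C (PiM {1..N} (\<lambda>_. borel)) (qvec N \<mu>). y \<in> D)"
proof -
  let ?K = "PiM {1..N} (\<lambda>_. borel :: real measure)"
  have "\<exists>D. countable D \<and> (AE x in \<mu> i. x \<in> D)" if "i \<in> {1..N}" for i
    using \<mu>(2)[OF that] unfolding discrete_distr_def .
  then obtain D where D: "\<And>i. i \<in> {1..N} \<Longrightarrow> countable (D i)" "\<And>i. i \<in> {1..N} \<Longrightarrow> AE x in \<mu> i. x \<in> D i"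
    by metis
  have ae: "AE u in C. \<forall>i\<in>{1..N}. quant (\<mu> i) (u i) \<in> D i"
  proof (rule AE_ball_countable'[rotated])
    fix i assume i: "i \<in> {1..N}"
    have q: "(\<lambda>u. quant (\<mu> i) (u i)) \<in> borel_measurable C"
      by (rule measurable_compose[OF measurable_copula_component[OF C i] measurable_quant[OF \<mu>(1)[OF i]]])
    show "AE u in C. quant (\<mu> i) (u i) \<in> D i"
      by (rule AE_distrD[OF q]) (simp only: distr_copula_quant[OF C i \<mu>(1)[OF i]] D(2)[OF i])
  qed simp
  have cD: "countable (PiE {1..N} D)" by (rule countable_PiE) (use D(1) in simp_all)
  have Dset: "PiE {1..N} D \<in> sets ?K"
    by (rule sets_PiM_I_finite) (use D(1) in \<open>auto intro: sets.countable\<close>)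
  have "AE y in distr C ?K (qvec N \<mu>). y \<in> PiE {1..N} D"
  proof (subst AE_distr_iff[OF measurable_qvec[OF C \<mu>(1)]])
    show "{y \<in> space ?K. y \<in> PiE {1..N} D} \<in> sets ?K"
      using Dset by simp
    show "AE u in C. qvec N \<mu> u \<in> PiE {1..N} D"
      using ae by eventually_elim (simp add: qvec_def)
  qed
  then show ?thesis using cD by (intro exI[of _ "PiE {1..N} D"]) auto
qed

subsection \<open>Laws along the tree\<close>

definition node_law :: "nat list set \<Rightarrow> (nat list \<Rightarrow> (nat \<Rightarrow> real) measure) \<Rightarrow>
    (nat list \<Rightarrow> real measure) \<Rightarrow> nat list \<Rightarrow> (nat \<Rightarrow> real) measure" where
  "node_law \<tau> C \<mu> J =
     distr (C J) (PiM {1..nchild \<tau> J} (\<lambda>_. borel)) (qvec (nchild \<tau> J) (\<lambda>i. \<mu> (J @ [i])))"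

text \<open>The model is stated through distribution functions; this is its counterpart for
  measures, given as consistency conditions instead of a recursion over the tree.\<close>

definition tree_laws :: "nat list set \<Rightarrow> (nat list \<Rightarrow> real measure) \<Rightarrow>
    (nat list \<Rightarrow> (nat \<Rightarrow> real) measure) \<Rightarrow> (nat list \<Rightarrow> real measure) \<Rightarrow> bool" where
  "tree_laws \<tau> L C \<mu> \<longleftrightarrow>
     (\<forall>J\<in>\<tau>. real_distribution (\<mu> J)) \<and> (\<forall>J\<in>leaves \<tau>. \<mu> J = L J) \<and>
     (\<forall>J\<in>branching \<tau>. \<mu> J = distr (node_law \<tau> C \<mu> J) borel (\<lambda>y. \<Sum>i\<in>{1..nchild \<tau> J}. y i))"

lemma measurable_row_sum: "(\<lambda>y. \<Sum>i\<in>{1..N}. y i) \<in> borel_measurable (PiM {1..N} (\<lambda>_. borel :: real measure))"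
  by (rule borel_measurable_sum) (rule measurable_component_singleton)

text \<open>The image of a countable support under the sum is countable; this carries discreteness
  from the children to their parent.\<close>

lemma discrete_distr_row_sum:
  assumes C: "is_copula N C"
    and \<mu>: "\<And>i. i \<in> {1..N} \<Longrightarrow> real_distribution (\<mu> i)" "\<And>i. i \<in> {1..N} \<Longrightarrow> discrete_distr (\<mu> i)"
  shows "discrete_distr (distr (distr C (PiM {1..N} (\<lambda>_. borel)) (qvec N \<mu>)) borel (\<lambda>y. \<Sum>i\<in>{1..N}. y i))"
proof -
  define M where "M = distr C (PiM {1..N} (\<lambda>_. borel)) (qvec N \<mu>)"
  let ?s = "\<lambda>y :: nat \<Rightarrow> real. \<Sum>i\<in>{1..N}. y i"
  have sM: "?s \<in> borel_measurable M" unfolding M_def measurable_distr_eq1 by (rule measurable_row_sum)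
  have "\<exists>D. countable D \<and> D \<subseteq> PiE {1..N} (\<lambda>_. UNIV) \<and> (AE y in M. y \<in> D)"
    unfolding M_def by (rule copula_law_countable_support[OF C \<mu>])
  then obtain D where D: "countable D" "AE y in M. y \<in> D"
    by metis
  have "?s ` D \<in> sets borel" by (rule sets.countable[OF _ countable_image[OF D(1)]]) simp
  then have "{x \<in> space borel. x \<in> ?s ` D} \<in> sets borel" by simp
  moreover have "AE y in M. ?s y \<in> ?s ` D"
    using D(2) by (rule eventually_mono) (rule imageI)
  ultimately have "AE x in distr M borel ?s. x \<in> ?s ` D"
    by (simp only: AE_distr_iff[OF sM])
  then show ?thesis
    unfolding discrete_distr_def M_def[symmetric] using countable_image[OF D(1), of ?s] by blast
qed

lemma tree_cases: "J \<in> \<tau> \<Longrightarrow> J \<in> leaves \<tau> \<or> J \<in> branching \<tau>"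
  by (auto simp: leaves_def branching_def)

text \<open>The laws are obtained by choosing a witness of the model at every branching node. They
  are then recognised as images of the copulas, because the distribution functions inside G are
  those of the chosen laws.\<close>

lemma tree_laws_exist:
  assumes tree: "agg_tree \<tau>"
    and leaf: "\<forall>J\<in>leaves \<tau>. real_distribution (L J)"
    and cop: "\<forall>J\<in>branching \<tau>. is_copula (nchild \<tau> J) (C J)"
    and model: "agg_F \<tau> L C F"
  obtains \<mu> where "tree_laws \<tau> L C \<mu>"
    "\<And>J x. J \<in> branching \<tau> \<Longrightarrow> G_fun \<tau> C F J x =
       measure (node_law \<tau> C \<mu> J) {y\<in>space (node_law \<tau> C \<mu> J). \<forall>i\<in>{1..nchild \<tau> J}. y i \<le> x i}"
    "\<And>J t. J \<in> branching \<tau> \<Longrightarrow> F J t =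
       measure (node_law \<tau> C \<mu> J) {y\<in>space (node_law \<tau> C \<mu> J). (\<Sum>i\<in>{1..nchild \<tau> J}. y i) \<le> t}"
proof -
  have "\<forall>J\<in>branching \<tau>. \<exists>M. prob_space M \<and>
        sets M = sets (PiM {1..nchild \<tau> J} (\<lambda>_. borel)) \<and>
        (\<forall>x. measure M {y \<in> space M. \<forall>i\<in>{1..nchild \<tau> J}. y i \<le> x i} = G_fun \<tau> C F J x) \<and>
        (\<forall>t. F J t = measure M {y \<in> space M. (\<Sum>i\<in>{1..nchild \<tau> J}. y i) \<le> t})"
    using model unfolding agg_F_def by (rule conjunct2)
  then obtain M where "\<forall>J\<in>branching \<tau>. prob_space (M J) \<and>
        sets (M J) = sets (PiM {1..nchild \<tau> J} (\<lambda>_. borel)) \<and>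
        (\<forall>x. measure (M J) {y \<in> space (M J). \<forall>i\<in>{1..nchild \<tau> J}. y i \<le> x i} = G_fun \<tau> C F J x) \<and>
        (\<forall>t. F J t = measure (M J) {y \<in> space (M J). (\<Sum>i\<in>{1..nchild \<tau> J}. y i) \<le> t})"
    unfolding bchoice_iff by blast
  then have M: "prob_space (M J)" "sets (M J) = sets (PiM {1..nchild \<tau> J} (\<lambda>_. borel))"
    "measure (M J) {y \<in> space (M J). \<forall>i\<in>{1..nchild \<tau> J}. y i \<le> x i} = G_fun \<tau> C F J x"
    "F J t = measure (M J) {y \<in> space (M J). (\<Sum>i\<in>{1..nchild \<tau> J}. y i) \<le> t}"
    if "J \<in> branching \<tau>" for J x t using that by blast+
  define \<mu> where "\<mu> J = (if J \<in> leaves \<tau> then L J else distr (M J) borel (\<lambda>y. \<Sum>i\<in>{1..nchild \<tau> J}. y i))" for J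
  have \<mu>_leaf: "\<mu> J = L J" if "J \<in> leaves \<tau>" for J using that by (simp add: \<mu>_def)
  have \<mu>_br: "\<mu> J = distr (M J) borel (\<lambda>y. \<Sum>i\<in>{1..nchild \<tau> J}. y i)" if "J \<in> branching \<tau>" for J
    using that by (simp add: \<mu>_def leaves_def branching_def)
  have sm: "(\<lambda>y. \<Sum>i\<in>{1..nchild \<tau> J}. y i) \<in> borel_measurable (M J)" if "J \<in> branching \<tau>" for J
    unfolding measurable_cong_sets[OF M(2)[OF that] refl] by (rule measurable_row_sum)
  \<comment> \<open>Read off node by node: the model prescribes \<open>F J\<close> as the
    distribution function of the sum under the chosen \<open>M J\<close>, so no induction is
    required.\<close>
  have rd: "real_distribution (\<mu> J)" and F: "F J = cdf (\<mu> J)" if "J \<in> \<tau>" for J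
  proof -
    have "real_distribution (\<mu> J) \<and> F J = cdf (\<mu> J)"
    proof (cases "J \<in> leaves \<tau>")
      case True
      then show ?thesis using leaf model by (simp add: \<mu>_leaf agg_F_def)
    next
      case False
      then have J: "J \<in> branching \<tau>" using tree_cases[OF that] by blast
      interpret prob_space "M J" by (rule M(1)[OF J])
      have "cdf (\<mu> J) t = F J t" for t
        unfolding cdf_def \<mu>_br[OF J] M(4)[OF J, of t]
        by (subst measure_distr[OF sm[OF J]]) (auto intro!: arg_cong[where f="measure (M J)"])
      then show ?thesis
        using real_distribution_distr[OF sm[OF J]] unfolding \<mu>_br[OF J] by (intro conjI ext) simp_all
    qed
    then show "real_distribution (\<mu> J)" "F J = cdf (\<mu> J)" by blast+
  qed
  have M_eq: "M J = node_law \<tau> C \<mu> J" if J: "J \<in> branching \<tau>" for J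
    unfolding node_law_def
  proof (rule aggregation_law_eq_distr[OF _ _ M(1)[OF J] M(2)[OF J]])
    have "J \<in> \<tau>" using J by (simp add: branching_def)
    note child = agg_tree_child[OF tree this]
    show "is_copula (nchild \<tau> J) (C J)" using cop J by blast
    show "real_distribution (\<mu> (J @ [i]))" if "i \<in> {1..nchild \<tau> J}" for i
      by (rule rd[OF child[OF that]])
    show "measure (M J) {y \<in> space (M J). \<forall>i\<in>{1..nchild \<tau> J}. y i \<le> x i} =
        cop_fun (nchild \<tau> J) (C J) (\<lambda>i. cdf (\<mu> (J @ [i])) (x i))" for x
      unfolding M(3)[OF J] G_fun_def cop_fun_def
      by (intro arg_cong[where f="measure (C J)"] Collect_cong conj_cong refl ball_cong) (simp only: F[OF child])
  qed
  show ?thesis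
  proof (rule that)
    show "tree_laws \<tau> L C \<mu>"
      unfolding tree_laws_def using rd \<mu>_leaf \<mu>_br M_eq by simp
  qed (use M M_eq in simp_all)
qed

lemma batch_law_leaf:
  assumes "nchild \<tau> J = 0" shows "batch_law f \<tau> L C n J = PiM {1..n} (\<lambda>_. L J)"
  using assms by (cases f) simp_all

text \<open>Discreteness is part of the induction since the step to the parent needs finite sets
  that carry almost all mass of the children. The mean deviation is the form of convergence that
  \<open>row_law_avg_tendsto\<close> consumes.\<close>

lemma batch_law_correct:
  assumes tree: "agg_tree \<tau>"
    and leaf: "\<forall>J\<in>leaves \<tau>. real_distribution (L J) \<and> discrete_distr (L J)"
    and cop: "\<forall>J\<in>branching \<tau>. is_copula (nchild \<tau> J) (C J)"
    and \<mu>: "tree_laws \<tau> L C \<mu>"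
    and "J \<in> \<tau>" "height_le \<tau> J f"
  shows "discrete_distr (\<mu> J) \<and>
    (\<forall>n. prob_space (batch_law f \<tau> L C n J) \<and> sets (batch_law f \<tau> L C n J) = sets (PiM {1..n} (\<lambda>_. borel))) \<and>
    (\<forall>S\<in>sets borel. (\<lambda>n. \<integral>x. \<bar>emp n S x - measure (\<mu> J) S\<bar> \<partial>batch_law f \<tau> L C n J) \<longlonglongrightarrow> 0)"
  using assms(5,6)
proof (induction f arbitrary: J)
  \<comment> \<open>Stated for every fuel, as a leaf can be met at fuel 0 or with fuel left.\<close>
  have leaf_case: "discrete_distr (\<mu> J) \<and>
    (\<forall>n. prob_space (batch_law f \<tau> L C n J) \<and> sets (batch_law f \<tau> L C n J) = sets (PiM {1..n} (\<lambda>_. borel))) \<and>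
    (\<forall>S\<in>sets borel. (\<lambda>n. \<integral>x. \<bar>emp n S x - measure (\<mu> J) S\<bar> \<partial>batch_law f \<tau> L C n J) \<longlonglongrightarrow> 0)"
    if "J \<in> \<tau>" "nchild \<tau> J = 0" for J f
  proof -
    have J: "J \<in> leaves \<tau>" using that by (simp add: leaves_def)
    have LJ: "real_distribution (L J)" "discrete_distr (L J)" using leaf J by blast+
    interpret real_distribution "L J" by (rule LJ(1))
    have \<mu>J: "\<mu> J = L J" using \<mu> J by (simp add: tree_laws_def)
    have "(\<lambda>n. \<integral>x. \<bar>emp n S x - measure (L J) S\<bar> \<partial>PiM {1..n} (\<lambda>_. L J)) \<longlonglongrightarrow> 0" if S: "S \<in> sets borel" for S
    proof (rule tendsto_zeroI_eps_exp)
      fix n :: nat and \<epsilon> :: real assume n: "0 < n" and \<epsilon>: "0 < \<epsilon>"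
      have id: "(\<lambda>x. x) \<in> borel_measurable (L J)" by simp
      have "measure (distr (L J) borel (\<lambda>x. x)) S = measure (L J) S"
        using S by (subst measure_distr[OF id]) simp_all
      then have "(\<Sum>k\<in>{1..n}. measure (distr (L J) borel (\<lambda>x. x)) S) / n = measure (L J) S"
        using n by simp
      then show "(\<integral>x. \<bar>emp n S x - measure (L J) S\<bar> \<partial>PiM {1..n} (\<lambda>_. L J)) \<le> \<epsilon> + 2 * exp (- 2 * real n * \<epsilon>\<^sup>2)"
        using PiM_emp_deviation[of n "\<lambda>_. L J", OF prob_space_axioms id S n less_imp_le[OF \<epsilon>]] by simp
    qed (rule integral_nonneg_AE, simp)
    moreover have "prob_space (PiM {1..n} (\<lambda>_. L J))" for n
      by (rule prob_space_PiM[OF prob_space_axioms])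
    moreover have "sets (PiM {1..n} (\<lambda>_. L J)) = sets (PiM {1..n} (\<lambda>_. borel))" for n
      by (rule sets_PiM_cong) simp_all
    ultimately show ?thesis
      unfolding \<mu>J batch_law_leaf[OF that(2)] using LJ(2) by blast
  qed
  {
    case 0
    then show ?case by (intro leaf_case height_le_0)
  next
    case (Suc f)
    show ?case
    proof (cases "nchild \<tau> J = 0")
      case True
      then show ?thesis by (intro leaf_case Suc.prems)
    next
      case False
      define N where "N = nchild \<tau> J"
      have J: "J \<in> branching \<tau>" using False Suc.prems(1) by (simp add: branching_def)
      have C: "is_copula N (C J)" using cop J by (simp add: N_def)
      have child: "J @ [i] \<in> \<tau>" if "i \<in> {1..N}" for i
        using agg_tree_child[OF tree Suc.prems(1)] that by (simp only: N_def)
      note IH = Suc.IH[OF child height_le_child[OF Suc.prems(2)]]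
      have rd: "real_distribution (\<mu> (J @ [i]))" if "i \<in> {1..N}" for i
        using \<mu> child[OF that] by (simp add: tree_laws_def)
      have dd: "discrete_distr (\<mu> (J @ [i]))" if "i \<in> {1..N}" for i
        using IH[OF that] by blast
      define Bs where "Bs n i = batch_law f \<tau> L C n (J @ [i])" for n i
      have Bs: "prob_space (Bs n i)" "sets (Bs n i) = sets (PiM {1..n} (\<lambda>_. borel))"
        if "i \<in> {1..N}" for n i using IH[OF that] unfolding Bs_def by blast+
      have dev: "(\<lambda>n. \<integral>x. \<bar>emp n S x - measure (\<mu> (J @ [i])) S\<bar> \<partial>Bs n i) \<longlonglongrightarrow> 0"
        if "i \<in> {1..N}" "S \<in> sets borel" for i S using IH[OF that(1)] that(2) unfolding Bs_def by blast
      let ?K = "PiM {1..N} (\<lambda>_. borel :: real measure)"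
      let ?s = "\<lambda>y :: nat \<Rightarrow> real. \<Sum>i\<in>{1..N}. y i"
      define M where "M = distr (C J) ?K (qvec N (\<lambda>i. \<mu> (J @ [i])))"
      have \<mu>J: "\<mu> J = distr M borel ?s"
        using \<mu> J unfolding tree_laws_def node_law_def M_def N_def by blast
      have sM: "?s \<in> borel_measurable M" unfolding M_def measurable_distr_eq1 by (rule measurable_row_sum)
      define \<rho> where "\<rho> n k = distr (row_law n N (Bs n) (C J) k) borel ?s" for n k
      have bl: "batch_law (Suc f) \<tau> L C n J = PiM {1..n} (\<rho> n)" for n
        using False unfolding \<rho>_def N_def Bs_def by simp
      have srow: "?s \<in> borel_measurable (row_law n N (Bs n) (C J) k)" for n k
        unfolding row_law_def measurable_distr_eq1 by (rule measurable_row_sum)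
      have \<rho>: "prob_space (\<rho> n k)" if "k \<in> {1..n}" for n k
        unfolding \<rho>_def by (rule prob_space.prob_space_distr[OF prob_space_row_law[OF Bs C that] srow])
      have 1: "discrete_distr (\<mu> J)"
        unfolding \<mu>J M_def by (rule discrete_distr_row_sum[OF C rd dd])
      have 2: "prob_space (PiM {1..n} (\<rho> n))" for n
        by (rule prob_space_PiM[OF \<rho>])
      have 3: "sets (PiM {1..n} (\<rho> n)) = sets (PiM {1..n} (\<lambda>_. borel))" for n
        by (rule sets_PiM_cong) (simp_all add: \<rho>_def)
      have 4: "(\<lambda>n. \<integral>x. \<bar>emp n S x - measure (\<mu> J) S\<bar> \<partial>PiM {1..n} (\<rho> n)) \<longlonglongrightarrow> 0" if S: "S \<in> sets borel" for S
      proof -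
        \<comment> \<open>The deviation is split into the fluctuation of the empirical frequency
          around its mean \<open>m n\<close>, bounded by Hoeffding, and the bias
          \<open>m n - measure (\<mu> J) S\<close>, which vanishes by convergence of the averaged
          row laws.\<close>
        define m where "m n = (\<Sum>k\<in>{1..n}. measure (\<rho> n k) S) / n" for n
        let ?S = "?s -` S \<inter> space ?K"
        have SK: "?S \<in> sets ?K" by (rule measurable_sets[OF measurable_row_sum S])
        have "measure (\<rho> n k) S = measure (row_law n N (Bs n) (C J) k) ?S" for n k
          unfolding \<rho>_def by (subst measure_distr[OF srow S]) (simp add: row_law_def)
        moreover have "measure (\<mu> J) S = measure M ?S"
          unfolding \<mu>J by (subst measure_distr[OF sM S]) (simp add: M_def)
        moreover have "(\<lambda>n. (\<Sum>k\<in>{1..n}. measure (row_law n N (Bs n) (C J) k) ?S) / n) \<longlonglongrightarrow> measure M ?S"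
          unfolding M_def by (rule row_law_avg_tendsto[OF C rd dd Bs dev SK])
        ultimately have m: "m \<longlonglongrightarrow> measure (\<mu> J) S"
          unfolding m_def by simp
        have g: "(\<lambda>n. \<integral>x. \<bar>emp n S x - m n\<bar> \<partial>PiM {1..n} (\<rho> n)) \<longlonglongrightarrow> 0"
        proof (rule tendsto_zeroI_eps_exp)
          fix n :: nat and \<epsilon> :: real assume n: "0 < n" and \<epsilon>: "0 < \<epsilon>"
          have id: "(\<lambda>x. x) \<in> borel_measurable (\<rho> n k)" for k unfolding \<rho>_def by simp
          have "measure (distr (\<rho> n k) borel (\<lambda>x. x)) S = measure (\<rho> n k) S" for k
            using S by (subst measure_distr[OF id]) (simp_all add: \<rho>_def)
          moreover have "(\<integral>x. \<bar>emp n S (\<lambda>k. x k) - (\<Sum>k\<in>{1..n}. measure (distr (\<rho> n k) borel (\<lambda>x. x)) S) / n\<bar> \<partial>PiM {1..n} (\<rho> n))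
              \<le> \<epsilon> + 2 * exp (- 2 * real n * \<epsilon>\<^sup>2)"
            by (rule PiM_emp_deviation[OF \<rho> id S n less_imp_le[OF \<epsilon>]])
          ultimately show "(\<integral>x. \<bar>emp n S x - m n\<bar> \<partial>PiM {1..n} (\<rho> n)) \<le> \<epsilon> + 2 * exp (- 2 * real n * \<epsilon>\<^sup>2)"
            by (simp add: m_def)
        qed (rule integral_nonneg_AE, simp)
        have lim: "(\<lambda>n. (\<integral>x. \<bar>emp n S x - m n\<bar> \<partial>PiM {1..n} (\<rho> n)) + \<bar>m n - measure (\<mu> J) S\<bar>) \<longlonglongrightarrow> 0"
          using tendsto_add[OF g tendsto_rabs_zero[OF LIM_zero[OF m]]] by simp
        have bound: "(\<integral>x. \<bar>emp n S x - measure (\<mu> J) S\<bar> \<partial>PiM {1..n} (\<rho> n)) \<le>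
            (\<integral>x. \<bar>emp n S x - m n\<bar> \<partial>PiM {1..n} (\<rho> n)) + \<bar>m n - measure (\<mu> J) S\<bar>" for n
        proof -
          interpret P: prob_space "PiM {1..n} (\<rho> n)" by (rule 2)
          have c: "(\<lambda>x. x k) \<in> borel_measurable (PiM {1..n} (\<rho> n))" if "k \<in> {1..n}" for k
            unfolding measurable_cong_sets[OF 3 refl] by (rule measurable_component_singleton[OF that])
          have i: "integrable (PiM {1..n} (\<rho> n)) (\<lambda>x. \<bar>emp n S x - d\<bar>)" for d
            by (rule P.integrable_emp_deviation[OF c S])
          have "(\<integral>x. \<bar>emp n S x - measure (\<mu> J) S\<bar> \<partial>PiM {1..n} (\<rho> n)) \<le>
             (\<integral>x. \<bar>emp n S x - m n\<bar> + \<bar>m n - measure (\<mu> J) S\<bar> \<partial>PiM {1..n} (\<rho> n))"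
            using i by (intro integral_mono) simp_all
          also have "\<dots> = (\<integral>x. \<bar>emp n S x - m n\<bar> \<partial>PiM {1..n} (\<rho> n)) + \<bar>m n - measure (\<mu> J) S\<bar>"
            using i by (simp add: P.prob_space)
          finally show ?thesis .
        qed
        show ?thesis
        proof (rule tendsto_sandwich[OF _ _ tendsto_const lim])
          show "\<forall>\<^sub>F n in sequentially. 0 \<le> (\<integral>x. \<bar>emp n S x - measure (\<mu> J) S\<bar> \<partial>PiM {1..n} (\<rho> n))"
            by (rule always_eventually) simp
          show "\<forall>\<^sub>F n in sequentially. (\<integral>x. \<bar>emp n S x - measure (\<mu> J) S\<bar> \<partial>PiM {1..n} (\<rho> n)) \<le>
            (\<integral>x. \<bar>emp n S x - m n\<bar> \<partial>PiM {1..n} (\<rho> n)) + \<bar>m n - measure (\<mu> J) S\<bar>"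
            by (rule always_eventually) (rule allI, rule bound)
        qed
      qed
      show ?thesis unfolding bl using 1 2 3 4 by blast
    qed
  }
qed

subsection \<open>The run of the algorithm\<close>

lemma rank_cong:
  assumes "\<And>j. j \<in> {1..n} \<Longrightarrow> x j = y j" "j \<in> {1..n}"
  shows "rank n x j = rank n y j"
proof -
  have "{j' \<in> {1..n}. x j' < x j \<or> x j' = x j \<and> j' \<le> j} = {j' \<in> {1..n}. y j' < y j \<or> y j' = y j \<and> j' \<le> j}"
    by (rule Collect_cong) (metis assms)
  then show ?thesis unfolding rank_def by (rule arg_cong)
qed

lemma rank_inv_cong:
  assumes "\<And>j. j \<in> {1..n} \<Longrightarrow> x j = y j" "r \<in> {1..n}"
  shows "rank_inv n x r = rank_inv n y r"
proof (rule rank_inv_eq)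
  show *: "rank_inv n y r \<in> {1..n}" by (rule rank_inv_in[OF assms(2)])
  show "rank n x (rank_inv n y r) = r"
    using rank_cong[of n x y, OF assms(1) *] rank_rank_inv[OF assms(2)] by simp
qed

text \<open>All intermediate ranks stay in \<open>{1..n}\<close>, so a row reads only entries with
  indices in range. This permits replacing the inputs by restricted ones, for which independence is
  assumed.\<close>

lemma mra_row_cong:
  assumes xs: "\<And>i j. i \<in> {1..N} \<Longrightarrow> j \<in> {1..n} \<Longrightarrow> xs i j = xs' i j"
    and us: "\<And>i j. i \<in> {1..N} \<Longrightarrow> j \<in> {1..n} \<Longrightarrow> us i j = us' i j"
    and k: "k \<in> {1..n}" and i: "i \<in> {1..N}"
  shows "mra_row n xs us k i = mra_row n xs' us' k i"
proof -
  have 1: "1 \<in> {1..N}" using i by auto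
  have a: "rank n (xs 1) k = rank n (xs' 1) k" by (rule rank_cong[OF xs[OF 1] k])
  have a': "rank n (xs' 1) k \<in> {1..n}" by (rule rank_in[OF k])
  have b: "rank_inv n (us 1) (rank n (xs' 1) k) = rank_inv n (us' 1) (rank n (xs' 1) k)"
    by (rule rank_inv_cong[OF us[OF 1] a'])
  have b': "rank_inv n (us' 1) (rank n (xs' 1) k) \<in> {1..n}" by (rule rank_inv_in[OF a'])
  have c: "rank n (us i) (rank_inv n (us' 1) (rank n (xs' 1) k)) = rank n (us' i) (rank_inv n (us' 1) (rank n (xs' 1) k))"
    by (rule rank_cong[OF us[OF i] b'])
  have c': "rank n (us' i) (rank_inv n (us' 1) (rank n (xs' 1) k)) \<in> {1..n}" by (rule rank_in[OF b'])
  have d: "rank_inv n (xs i) (rank n (us' i) (rank_inv n (us' 1) (rank n (xs' 1) k))) =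
      rank_inv n (xs' i) (rank n (us' i) (rank_inv n (us' 1) (rank n (xs' 1) k)))"
    by (rule rank_inv_cong[OF xs[OF i] c'])
  have d': "rank_inv n (xs' i) (rank n (us' i) (rank_inv n (us' 1) (rank n (xs' 1) k))) \<in> {1..n}"
    by (rule rank_inv_in[OF c'])
  show ?thesis unfolding mra_row_def a b c d by (rule xs[OF i d'])
qed

lemma mra_rows_cong:
  assumes "\<And>i j. i \<in> {1..N} \<Longrightarrow> j \<in> {1..n} \<Longrightarrow> xs i j = xs' i j"
    and "\<And>i j. i \<in> {1..N} \<Longrightarrow> j \<in> {1..n} \<Longrightarrow> us j i = us' j i"
    and "k \<in> {1..n}"
  shows "mra_rows n N xs us k = mra_rows n N xs' us' k"
  unfolding mra_rows_def by (rule restrict_ext) (rule mra_row_cong[OF assms])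

text \<open>Functions of disjoint blocks of an independent family are independent. The hypothesis on
  \<open>X\<close> lets the variables be written with the unrestricted inputs.\<close>

lemma (in prob_space) indep_vars_blocks:
  assumes V: "indep_vars Md V U" and K: "\<And>j. j \<in> L \<Longrightarrow> K j \<subseteq> U" and dis: "disjoint_family_on K L"
    and g: "\<And>j. j \<in> L \<Longrightarrow> g j \<in> measurable (PiM (K j) Md) (N j)"
    and X: "\<And>j \<omega>. j \<in> L \<Longrightarrow> X j \<omega> = g j (\<lambda>s\<in>K j. V s \<omega>)"
  shows "indep_vars N X L"
proof -
  have "indep_vars N (\<lambda>j \<omega>. g j (\<lambda>s\<in>K j. V s \<omega>)) L"
    by (rule indep_vars_compose2[OF indep_vars_restrict[OF V K dis] g])
  moreover have "indep_vars N X L = indep_vars N (\<lambda>j \<omega>. g j (\<lambda>s\<in>K j. V s \<omega>)) L"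
    by (rule indep_vars_cong) (simp_all add: X fun_eq_iff)
  ultimately show ?thesis by simp
qed

lemma (in prob_space) indep_vars_distr_PiM:
  assumes "indep_vars N X L" "L \<noteq> {}"
  shows "distr M (PiM L N) (\<lambda>\<omega>. \<lambda>j\<in>L. X j \<omega>) = PiM L (\<lambda>j. distr M (N j) (X j))"
proof -
  have "indep_vars N X L \<longleftrightarrow> distr M (PiM L N) (\<lambda>\<omega>. \<lambda>j\<in>L. X j \<omega>) = PiM L (\<lambda>j. distr M (N j) (X j))"
    by (rule indep_vars_iff_distr_eq_PiM'[OF assms(2) indep_vars_rv[OF assms(1)]])
  then show ?thesis using assms(1) by blast
qed

primrec unit_addr :: "sidx \<Rightarrow> (nat \<times> nat) list" where
  "unit_addr (Lf a k) = a"
| "unit_addr (Cop a l k) = a"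

text \<open>A single run with fixed \<open>n\<close>; nothing relates runs with different
  parameters.\<close>

locale mra_run = prob_space P for P :: "'w measure" +
  fixes \<tau> :: "nat list set" and L :: "nat list \<Rightarrow> real measure"
    and C :: "nat list \<Rightarrow> (nat \<Rightarrow> real) measure"
    and I :: "nat list" and n :: nat and S :: "sidx \<Rightarrow> 'w \<Rightarrow> nat \<Rightarrow> real"
  assumes tree: "agg_tree \<tau>"
    and cop: "\<And>J. J \<in> branching \<tau> \<Longrightarrow> is_copula (nchild \<tau> J) (C J)"
    and samples: "mra_samples \<tau> L C P I n S"
    and n: "0 < n"
begin

abbreviation "U \<equiv> mra_units \<tau> I n"
abbreviation "Md \<equiv> (\<lambda>s. PiM (unit_dom \<tau> I s) (\<lambda>_. borel :: real measure))"
text \<open>The samples are arbitrary outside the coordinates in \<open>unit_dom\<close>;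
  independence and laws concern these restrictions.\<close>

definition "V s \<omega> = restrict (S s \<omega>) (unit_dom \<tau> I s)"
text \<open>The random inputs available to the call at \<open>a\<close> and its subcalls, recognised
  by addresses that extend \<open>a\<close>.\<close>

definition "desc a = {s \<in> U. \<exists>b. unit_addr s = a @ b}"

lemma indep: "indep_vars Md V U"
  using samples unfolding mra_samples_def V_def[abs_def] by (rule conjunct1)

lemma leaf_law: "Lf a k \<in> U \<Longrightarrow> distr P borel (\<lambda>\<omega>. S (Lf a k) \<omega> 0) = L (node I a)"
  using samples unfolding mra_samples_def by blast

lemma cop_law: "Cop a l k \<in> U \<Longrightarrow>
   distr P (PiM {1..nchild \<tau> (node I a)} (\<lambda>_. borel)) (V (Cop a l k)) = C (node I a)"
  using samples unfolding mra_samples_def V_def[abs_def] unit_dom_def sidx.case by blast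

lemma node_snoc: "node I (a @ [(k, i)]) = node I a @ [i]"
  by (simp add: node_def)

lemma addr_ok_snoc: "addr_ok n a \<Longrightarrow> k \<in> {1..n} \<Longrightarrow> addr_ok n (a @ [(k, i)])"
  by (simp add: addr_ok_def)

lemma Lf_in: "addr_ok n a \<Longrightarrow> node I a \<in> leaves \<tau> \<Longrightarrow> k \<in> {1..n} \<Longrightarrow> Lf a k \<in> desc a"
  unfolding desc_def mra_units_def by simp

lemma Cop_in: "addr_ok n a \<Longrightarrow> node I a \<in> branching \<tau> \<Longrightarrow> l \<in> {1..n} \<Longrightarrow> k \<in> {1..n} \<Longrightarrow> Cop a l k \<in> desc a"
  unfolding desc_def mra_units_def by simp

lemma desc_child: "desc (a @ [(k, i)]) \<subseteq> desc a"
  unfolding desc_def by auto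

lemma desc_subset: "desc a \<subseteq> U"
  unfolding desc_def by blast

lemma V_eq: "d \<in> unit_dom \<tau> I s \<Longrightarrow> V s \<omega> d = S s \<omega> d"
  by (simp add: V_def)

lemma unit_dom_Lf: "0 \<in> unit_dom \<tau> I (Lf a k)"
  by (simp add: unit_dom_def)

lemma unit_dom_Cop: "unit_dom \<tau> I (Cop a l k) = {1..nchild \<tau> (node I a)}"
  by (simp add: unit_dom_def)

lemma mra_X_leaf: "nchild \<tau> (node I a) = 0 \<Longrightarrow> mra_X f \<tau> n s I a k = s (Lf a k) 0"
  by (cases f) simp_all

text \<open>Only row \<open>k\<close> of repetition \<open>k\<close> is kept, so \<open>k\<close>
  plays both parts. The fuel \<open>f\<close> is that of the children; the call itself runs with
  \<open>Suc f\<close>.\<close>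

definition rows :: "nat \<Rightarrow> (sidx \<Rightarrow> nat \<Rightarrow> real) \<Rightarrow> (nat \<times> nat) list \<Rightarrow> nat \<Rightarrow> nat \<Rightarrow> real" where
  "rows f s a k = mra_rows n (nchild \<tau> (node I a)) (\<lambda>i j. mra_X f \<tau> n s I (a @ [(k, i)]) j) (\<lambda>j. s (Cop a k j)) k"

lemma mra_X_branching:
  "nchild \<tau> (node I a) \<noteq> 0 \<Longrightarrow> mra_X (Suc f) \<tau> n s I a k = (\<Sum>i\<in>{1..nchild \<tau> (node I a)}. rows f s a k i)"
  by (simp add: rows_def mra_rows_def)

text \<open>Locality of the recursion: a call reads no input outside \<open>desc a\<close>. Calls at
  incomparable addresses thus depend on disjoint blocks of inputs.\<close>

lemma mra_X_cong:
  assumes "addr_ok n a" "node I a \<in> \<tau>" "height_le \<tau> (node I a) f" "k \<in> {1..n}"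
    and "\<And>u d. u \<in> desc a \<Longrightarrow> d \<in> unit_dom \<tau> I u \<Longrightarrow> s u d = s' u d"
  shows "mra_X f \<tau> n s I a k = mra_X f \<tau> n s' I a k"
  using assms
proof (induction f arbitrary: a k)
  case 0
  have 0: "nchild \<tau> (node I a) = 0" by (rule height_le_0[OF "0.prems"(3)])
  then have "node I a \<in> leaves \<tau>" using "0.prems"(2) by (simp add: leaves_def)
  then have "s (Lf a k) 0 = s' (Lf a k) 0"
    by (intro "0.prems"(5) Lf_in "0.prems" unit_dom_Lf)
  then show ?case by simp
next
  case (Suc f)
  show ?case
  proof (cases "nchild \<tau> (node I a) = 0")
    case True
    then have "node I a \<in> leaves \<tau>" using Suc.prems(2) by (simp add: leaves_def)
    then have "s (Lf a k) 0 = s' (Lf a k) 0"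
      by (intro Suc.prems(5) Lf_in Suc.prems unit_dom_Lf)
    then show ?thesis by (simp only: mra_X_leaf[OF True])
  next
    case False
    then have J: "node I a \<in> branching \<tau>" using Suc.prems(2) by (simp add: branching_def)
    have "rows f s a k = rows f s' a k"
      unfolding rows_def
    proof (rule mra_rows_cong[OF _ _ Suc.prems(4)])
      fix i j assume i: "i \<in> {1..nchild \<tau> (node I a)}" and j: "j \<in> {1..n}"
      show "mra_X f \<tau> n s I (a @ [(k, i)]) j = mra_X f \<tau> n s' I (a @ [(k, i)]) j"
      proof (rule Suc.IH[OF addr_ok_snoc[OF Suc.prems(1,4)] _ _ j])
        show "node I (a @ [(k, i)]) \<in> \<tau>"
          unfolding node_snoc by (rule agg_tree_child[OF tree Suc.prems(2) i])
        show "height_le \<tau> (node I (a @ [(k, i)])) f"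
          unfolding node_snoc by (rule height_le_child[OF Suc.prems(3)])
        show "s u d = s' u d" if "u \<in> desc (a @ [(k, i)])" "d \<in> unit_dom \<tau> I u" for u d
          using that(1) desc_child by (intro Suc.prems(5) that(2)) blast
      qed
      show "s (Cop a k j) i = s' (Cop a k j) i"
        by (rule Suc.prems(5)[OF Cop_in[OF Suc.prems(1) J Suc.prems(4) j]]) (simp only: unit_dom_Cop i)
    qed
    then show ?thesis by (simp only: mra_X_branching[OF False])
  qed
qed

lemma measurable_unit:
  assumes "u \<in> K" "d \<in> unit_dom \<tau> I u"
  shows "(\<lambda>w. w u d) \<in> borel_measurable (PiM K Md)"
  by (rule measurable_compose[OF measurable_component_singleton[of u K Md, OF assms(1)] measurable_component_singleton[OF assms(2)]])

lemma measurable_mra_X: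
  assumes "addr_ok n a" "node I a \<in> \<tau>" "height_le \<tau> (node I a) f" "k \<in> {1..n}" "desc a \<subseteq> K"
  shows "(\<lambda>w. mra_X f \<tau> n w I a k) \<in> borel_measurable (PiM K Md)"
  using assms
proof (induction f arbitrary: a k)
  have leaf: "(\<lambda>w. mra_X f \<tau> n w I a k) \<in> borel_measurable (PiM K Md)"
    if "addr_ok n a" "node I a \<in> \<tau>" "k \<in> {1..n}" "desc a \<subseteq> K" "nchild \<tau> (node I a) = 0" for f a k
  proof -
    have "node I a \<in> leaves \<tau>" using that by (simp add: leaves_def)
    then have "Lf a k \<in> K" using Lf_in[OF that(1) _ that(3)] that(4) by blast
    then show ?thesis unfolding mra_X_leaf[OF that(5)] by (rule measurable_unit[OF _ unit_dom_Lf])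
  qed
  {
    case 0
    then show ?case by (intro leaf height_le_0)
  next
    case (Suc f)
    show ?case
    proof (cases "nchild \<tau> (node I a) = 0")
      case True
      then show ?thesis by (intro leaf Suc.prems)
    next
      case False
      then have J: "node I a \<in> branching \<tau>" using Suc.prems(2) by (simp add: branching_def)
      have xs: "(\<lambda>w. mra_X f \<tau> n w I (a @ [(k, i)]) j) \<in> borel_measurable (PiM K Md)"
        if i: "i \<in> {1..nchild \<tau> (node I a)}" and j: "j \<in> {1..n}" for i j
      proof (rule Suc.IH[OF addr_ok_snoc[OF Suc.prems(1,4)] _ _ j])
        show "node I (a @ [(k, i)]) \<in> \<tau>"
          unfolding node_snoc by (rule agg_tree_child[OF tree Suc.prems(2) i])
        show "height_le \<tau> (node I (a @ [(k, i)])) f"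
          unfolding node_snoc by (rule height_le_child[OF Suc.prems(3)])
        show "desc (a @ [(k, i)]) \<subseteq> K" using desc_child Suc.prems(5) by blast
      qed
      have us: "(\<lambda>w. w (Cop a k j) i) \<in> borel_measurable (PiM K Md)"
        if i: "i \<in> {1..nchild \<tau> (node I a)}" and j: "j \<in> {1..n}" for i j
        by (rule measurable_unit) (use Cop_in[OF Suc.prems(1) J Suc.prems(4) j] Suc.prems(5) in blast,
          simp only: unit_dom_Cop i)
      show ?thesis
        unfolding mra_X.simps if_not_P[OF False]
        by (rule borel_measurable_sum) (rule measurable_mra_row[OF xs us Suc.prems(4)])
    qed
  }
qed

definition child_units :: "(nat \<times> nat) list \<Rightarrow> nat \<Rightarrow> sidx set" where
  "child_units a l = (\<Union>i\<in>{1..nchild \<tau> (node I a)}. desc (a @ [(l, i)]))"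

definition cop_units :: "(nat \<times> nat) list \<Rightarrow> nat \<Rightarrow> sidx set" where
  "cop_units a l = Cop a l ` {1..n}"

context
  fixes a f
  assumes a: "addr_ok n a" and J: "node I a \<in> branching \<tau>" and h: "height_le \<tau> (node I a) (Suc f)"
begin

abbreviation "N \<equiv> nchild \<tau> (node I a)"

lemma J_in: "node I a \<in> \<tau>"
  using J by (simp add: branching_def)

lemma child_ok:
  assumes "l \<in> {1..n}" "i \<in> {1..N}"
  shows "addr_ok n (a @ [(l, i)])" "node I (a @ [(l, i)]) \<in> \<tau>" "height_le \<tau> (node I (a @ [(l, i)])) f"
  unfolding node_snoc
  by (rule addr_ok_snoc[OF a assms(1)], rule agg_tree_child[OF tree J_in assms(2)], rule height_le_child[OF h])

lemma child_units_subset: "child_units a l \<subseteq> U"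
  unfolding child_units_def using desc_subset by blast

lemma cop_units_subset: "l \<in> {1..n} \<Longrightarrow> cop_units a l \<subseteq> U"
  unfolding cop_units_def using Cop_in[OF a J] desc_subset by blast

lemma rows_eq_restrict:
  assumes l: "l \<in> {1..n}" and K: "child_units a l \<union> cop_units a l \<subseteq> K"
  shows "rows f (\<lambda>s. S s \<omega>) a l = rows f (\<lambda>s\<in>K. V s \<omega>) a l"
  unfolding rows_def
proof (rule mra_rows_cong[OF _ _ l])
  fix i j assume i: "i \<in> {1..N}" and j: "j \<in> {1..n}"
  show "mra_X f \<tau> n (\<lambda>s. S s \<omega>) I (a @ [(l, i)]) j = mra_X f \<tau> n (\<lambda>s\<in>K. V s \<omega>) I (a @ [(l, i)]) j"
  proof (rule mra_X_cong[OF child_ok[OF l i] j])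
    fix u d assume u: "u \<in> desc (a @ [(l, i)])" and d: "d \<in> unit_dom \<tau> I u"
    have "u \<in> child_units a l" using u i unfolding child_units_def by blast
    then have "u \<in> K" using K by blast
    then show "S u \<omega> d = (\<lambda>s\<in>K. V s \<omega>) u d" by (simp add: V_eq[OF d])
  qed
  have "Cop a l j \<in> K" using K j unfolding cop_units_def by blast
  then show "S (Cop a l j) \<omega> i = (\<lambda>s\<in>K. V s \<omega>) (Cop a l j) i"
    by (simp add: V_def unit_dom_Cop i del: atLeastAtMost_iff)
qed

lemma measurable_rows:
  assumes l: "l \<in> {1..n}" and K: "child_units a l \<union> cop_units a l \<subseteq> K"
  shows "(\<lambda>w. rows f w a l) \<in> measurable (PiM K Md) (PiM {1..N} (\<lambda>_. borel))"
  unfolding rows_def mra_rows_def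
proof (rule measurable_restrict)
  have xs: "(\<lambda>w. mra_X f \<tau> n w I (a @ [(l, i)]) j) \<in> borel_measurable (PiM K Md)"
    if i: "i \<in> {1..N}" and j: "j \<in> {1..n}" for i j
    by (rule measurable_mra_X[OF child_ok[OF l i] j]) (use K i child_units_def in blast)
  have us: "(\<lambda>w. w (Cop a l j) i) \<in> borel_measurable (PiM K Md)"
    if i: "i \<in> {1..N}" and j: "j \<in> {1..n}" for i j
    by (rule measurable_unit) (use K j cop_units_def in blast, simp only: unit_dom_Cop i)
  fix i assume i: "i \<in> {1..N}"
  show "(\<lambda>w. mra_row n (\<lambda>i j. mra_X f \<tau> n w I (a @ [(l, i)]) j) (\<lambda>i j. w (Cop a l j) i) l i) \<in> borel_measurable (PiM K Md)"
    by (rule measurable_mra_row[OF xs us l i])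
qed

text \<open>The address of every input records the repetition in which it was drawn, so different
  repetitions share no input.\<close>

lemma disjoint_rep_units: "disjoint_family_on (\<lambda>l. child_units a l \<union> cop_units a l) {1..n}"
  unfolding disjoint_family_on_def child_units_def cop_units_def desc_def by auto

lemma indep_rows: "indep_vars (\<lambda>_. PiM {1..N} (\<lambda>_. borel)) (\<lambda>l \<omega>. rows f (\<lambda>s. S s \<omega>) a l) {1..n}"
proof (rule indep_vars_blocks[OF indep _ disjoint_rep_units])
  show "child_units a l \<union> cop_units a l \<subseteq> U" if "l \<in> {1..n}" for l
    using child_units_subset cop_units_subset[OF that] by blast
  show "(\<lambda>w. rows f w a l) \<in> measurable (PiM (child_units a l \<union> cop_units a l) Md) (PiM {1..N} (\<lambda>_. borel))"
    if "l \<in> {1..n}" for l by (rule measurable_rows[OF that order_refl])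
  show "rows f (\<lambda>s. S s \<omega>) a l = rows f (\<lambda>s\<in>child_units a l \<union> cop_units a l. V s \<omega>) a l" if "l \<in> {1..n}" for l \<omega>
    by (rule rows_eq_restrict[OF that order_refl])
qed

text \<open>The hypothesis on the child batches is the induction hypothesis of
  \<open>distr_batch\<close> below.\<close>

context
  fixes Bs l
  assumes l: "l \<in> {1..n}"
    and Bs: "\<And>i. i \<in> {1..N} \<Longrightarrow>
      distr P (PiM {1..n} (\<lambda>_. borel)) (\<lambda>\<omega>. \<lambda>j\<in>{1..n}. mra_X f \<tau> n (\<lambda>s. S s \<omega>) I (a @ [(l, i)]) j) = Bs i"
begin

lemma measurable_batch:
  assumes i: "i \<in> {1..N}" and K: "desc (a @ [(l, i)]) \<subseteq> K"
  shows "(\<lambda>w. \<lambda>j\<in>{1..n}. mra_X f \<tau> n w I (a @ [(l, i)]) j) \<in> measurable (PiM K Md) (PiM {1..n} (\<lambda>_. borel))"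
  by (rule measurable_restrict) (rule measurable_mra_X[OF child_ok[OF l i] _ K])

lemma batch_eq_restrict:
  assumes i: "i \<in> {1..N}" and K: "desc (a @ [(l, i)]) \<subseteq> K"
  shows "(\<lambda>j\<in>{1..n}. mra_X f \<tau> n (\<lambda>s. S s \<omega>) I (a @ [(l, i)]) j) =
     (\<lambda>j\<in>{1..n}. mra_X f \<tau> n (\<lambda>s\<in>K. V s \<omega>) I (a @ [(l, i)]) j)"
proof (rule restrict_ext)
  fix j assume j: "j \<in> {1..n}"
  show "mra_X f \<tau> n (\<lambda>s. S s \<omega>) I (a @ [(l, i)]) j = mra_X f \<tau> n (\<lambda>s\<in>K. V s \<omega>) I (a @ [(l, i)]) j"
  proof (rule mra_X_cong[OF child_ok[OF l i] j])
    fix u d assume "u \<in> desc (a @ [(l, i)])" and d: "d \<in> unit_dom \<tau> I u"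
    then have "u \<in> K" using K by blast
    then show "S u \<omega> d = (\<lambda>s\<in>K. V s \<omega>) u d" by (simp add: V_eq[OF d])
  qed
qed

lemma distr_batches:
  "distr P (PiM {1..N} (\<lambda>_. PiM {1..n} (\<lambda>_. borel)))
    (\<lambda>\<omega>. \<lambda>i\<in>{1..N}. \<lambda>j\<in>{1..n}. mra_X f \<tau> n (\<lambda>s. S s \<omega>) I (a @ [(l, i)]) j) = PiM {1..N} Bs"
proof -
  have ne: "{1..N} \<noteq> {}" using J by (simp add: branching_def)
  have "indep_vars (\<lambda>_. PiM {1..n} (\<lambda>_. borel)) (\<lambda>i \<omega>. \<lambda>j\<in>{1..n}. mra_X f \<tau> n (\<lambda>s. S s \<omega>) I (a @ [(l, i)]) j) {1..N}"
  proof (rule indep_vars_blocks[OF indep desc_subset])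
    show "disjoint_family_on (\<lambda>i. desc (a @ [(l, i)])) {1..N}"
      unfolding disjoint_family_on_def desc_def by auto
    show "(\<lambda>w. \<lambda>j\<in>{1..n}. mra_X f \<tau> n w I (a @ [(l, i)]) j)
        \<in> measurable (PiM (desc (a @ [(l, i)])) Md) (PiM {1..n} (\<lambda>_. borel))" if "i \<in> {1..N}" for i
      by (rule measurable_batch[OF that order_refl])
    show "(\<lambda>j\<in>{1..n}. mra_X f \<tau> n (\<lambda>s. S s \<omega>) I (a @ [(l, i)]) j) =
     (\<lambda>j\<in>{1..n}. mra_X f \<tau> n (\<lambda>s\<in>desc (a @ [(l, i)]). V s \<omega>) I (a @ [(l, i)]) j)" if "i \<in> {1..N}" for i \<omega>
      by (rule batch_eq_restrict[OF that order_refl])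
  qed
  from indep_vars_distr_PiM[OF this ne] show ?thesis
    by (simp only: PiM_cong[OF refl Bs])
qed

lemma distr_cops:
  "distr P (PiM {1..n} (\<lambda>_. PiM {1..N} (\<lambda>_. borel))) (\<lambda>\<omega>. \<lambda>j\<in>{1..n}. V (Cop a l j) \<omega>) =
     PiM {1..n} (\<lambda>_. C (node I a))"
proof -
  have ne: "{1..n} \<noteq> {}" using n by simp
  have cu: "Cop a l j \<in> U" if "j \<in> {1..n}" for j
    using Cop_in[OF a J l that] desc_subset by blast
  have "indep_vars (\<lambda>_. PiM {1..N} (\<lambda>_. borel)) (\<lambda>j \<omega>. V (Cop a l j) \<omega>) {1..n}"
  proof (rule indep_vars_blocks[OF indep, where K="\<lambda>j. {Cop a l j}" and g="\<lambda>j w. w (Cop a l j)"])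
    show "{Cop a l j} \<subseteq> U" if "j \<in> {1..n}" for j using cu[OF that] by blast
    show "disjoint_family_on (\<lambda>j. {Cop a l j}) {1..n}" unfolding disjoint_family_on_def by simp
    show "(\<lambda>w. w (Cop a l j)) \<in> measurable (PiM {Cop a l j} Md) (PiM {1..N} (\<lambda>_. borel))" if "j \<in> {1..n}" for j
      using measurable_component_singleton[of "Cop a l j" "{Cop a l j}" Md] unfolding unit_dom_Cop by simp
  qed simp
  from indep_vars_distr_PiM[OF this ne] show ?thesis
    by (simp only: PiM_cong[OF refl cop_law[OF cu]])
qed

text \<open>A row is a deterministic function of the child batches and copula samples of its
  repetition; once their joint law is known to be \<open>rep_law\<close>, its law is an image
  measure.\<close>

lemma distr_row: "distr P (PiM {1..N} (\<lambda>_. borel)) (\<lambda>\<omega>. rows f (\<lambda>s. S s \<omega>) a l) = row_law n N Bs (C (node I a)) l"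
proof -
  let ?X = "\<lambda>w. \<lambda>i\<in>{1..N}. \<lambda>j\<in>{1..n}. mra_X f \<tau> n w I (a @ [(l, i)]) j"
  let ?Y = "\<lambda>w. \<lambda>j\<in>{1..n}. w (Cop a l j)"
  let ?MX = "PiM {1..N} (\<lambda>_. PiM {1..n} (\<lambda>_. borel :: real measure))"
  let ?MY = "PiM {1..n} (\<lambda>_. PiM {1..N} (\<lambda>_. borel :: real measure))"
  let ?A = "child_units a l" and ?B = "cop_units a l"
  have mX: "?X \<in> measurable (PiM ?A Md) ?MX"
    by (rule measurable_restrict) (rule measurable_batch, assumption, use child_units_def in blast)
  have mY: "?Y \<in> measurable (PiM ?B Md) ?MY"
  proof (rule measurable_restrict)
    fix j assume "j \<in> {1..n}"
    then have "Cop a l j \<in> ?B" unfolding cop_units_def by blast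
    then show "(\<lambda>w. w (Cop a l j)) \<in> measurable (PiM ?B Md) (PiM {1..N} (\<lambda>_. borel))"
      using measurable_component_singleton[of "Cop a l j" ?B Md] unfolding unit_dom_Cop by simp
  qed
  have disj: "?A \<inter> ?B = {}" unfolding child_units_def cop_units_def desc_def by auto
  have X: "?X (\<lambda>s\<in>?A. V s \<omega>) = ?X (\<lambda>s. S s \<omega>)" for \<omega>
    by (rule restrict_ext) (rule batch_eq_restrict[symmetric], assumption, use child_units_def in blast)
  have Y: "?Y (\<lambda>s\<in>?B. V s \<omega>) = (\<lambda>j\<in>{1..n}. V (Cop a l j) \<omega>)" for \<omega>
    by (rule restrict_ext) (simp add: cop_units_def)
  have "indep_var ?MX (?X \<circ> (\<lambda>\<omega>. \<lambda>s\<in>?A. V s \<omega>)) ?MY (?Y \<circ> (\<lambda>\<omega>. \<lambda>s\<in>?B. V s \<omega>))"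
    by (rule indep_var_compose[OF indep_var_restrict[OF indep disj child_units_subset cop_units_subset[OF l]] mX mY])
  then have iv: "indep_var ?MX (\<lambda>\<omega>. ?X (\<lambda>s. S s \<omega>)) ?MY (\<lambda>\<omega>. \<lambda>j\<in>{1..n}. V (Cop a l j) \<omega>)"
    unfolding comp_def X Y .
  then have rv: "(\<lambda>\<omega>. ?X (\<lambda>s. S s \<omega>)) \<in> measurable P ?MX" "(\<lambda>\<omega>. \<lambda>j\<in>{1..n}. V (Cop a l j) \<omega>) \<in> measurable P ?MY"
    by (rule indep_var_rv1, rule indep_var_rv2)
  \<comment> \<open>Child calls and copula samples use disjoint sets of inputs, so the joint law is
    the product of the two laws computed above.\<close>
  have joint: "rep_law n N Bs (C (node I a)) =
      distr P (?MX \<Otimes>\<^sub>M ?MY) (\<lambda>\<omega>. (?X (\<lambda>s. S s \<omega>), \<lambda>j\<in>{1..n}. V (Cop a l j) \<omega>))"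
    using iv unfolding rep_law_def indep_var_distribution_eq distr_batches distr_cops by blast
  have sBs: "sets (Bs i) = sets (PiM {1..n} (\<lambda>_. borel))" if "i \<in> {1..N}" for i
    unfolding Bs[OF that, symmetric] by simp
  have rep_sets: "sets (rep_law n N Bs (C (node I a))) = sets (?MX \<Otimes>\<^sub>M ?MY)"
    by (rule sets_rep_law[OF sBs cop[OF J]])
  have "(\<lambda>w. mra_rows n N (fst w) (snd w) l) \<in> measurable (rep_law n N Bs (C (node I a))) (PiM {1..N} (\<lambda>_. borel))"
    by (rule measurable_mra_rows[OF sBs cop[OF J] l])
  then have mrow: "(\<lambda>w. mra_rows n N (fst w) (snd w) l) \<in> measurable (?MX \<Otimes>\<^sub>M ?MY) (PiM {1..N} (\<lambda>_. borel))"
    unfolding measurable_cong_sets[OF rep_sets refl] .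
  have "row_law n N Bs (C (node I a)) l = distr P (PiM {1..N} (\<lambda>_. borel))
     ((\<lambda>w. mra_rows n N (fst w) (snd w) l) \<circ> (\<lambda>\<omega>. (?X (\<lambda>s. S s \<omega>), \<lambda>j\<in>{1..n}. V (Cop a l j) \<omega>)))"
    unfolding row_law_def joint by (rule distr_distr[OF mrow measurable_Pair[OF rv]])
  also have "(\<lambda>w. mra_rows n N (fst w) (snd w) l) \<circ> (\<lambda>\<omega>. (?X (\<lambda>s. S s \<omega>), \<lambda>j\<in>{1..n}. V (Cop a l j) \<omega>)) =
     (\<lambda>\<omega>. rows f (\<lambda>s. S s \<omega>) a l)"
  proof
    fix \<omega>
    have "mra_rows n N (?X (\<lambda>s. S s \<omega>)) (\<lambda>j\<in>{1..n}. V (Cop a l j) \<omega>) l = rows f (\<lambda>s. S s \<omega>) a l"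
      unfolding rows_def
      by (rule mra_rows_cong[OF _ _ l]) (simp_all add: V_def unit_dom_Cop del: atLeastAtMost_iff)
    then show "((\<lambda>w. mra_rows n N (fst w) (snd w) l) \<circ> (\<lambda>\<omega>. (?X (\<lambda>s. S s \<omega>), \<lambda>j\<in>{1..n}. V (Cop a l j) \<omega>))) \<omega> =
        rows f (\<lambda>s. S s \<omega>) a l" by simp
  qed
  finally show ?thesis by (rule sym)
qed

end

end

text \<open>The law depends on the address only through its node: this is the precise sense in which
  all repetitions are identically distributed.\<close>

lemma distr_batch:
  assumes "addr_ok n a" "node I a \<in> \<tau>" "height_le \<tau> (node I a) f"
  shows "distr P (PiM {1..n} (\<lambda>_. borel)) (\<lambda>\<omega>. \<lambda>k\<in>{1..n}. mra_X f \<tau> n (\<lambda>s. S s \<omega>) I a k) =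
    batch_law f \<tau> L C n (node I a)"
  using assms
proof (induction f arbitrary: a)
  have ne: "{1..n} \<noteq> {}" using n by simp
  have leaf: "distr P (PiM {1..n} (\<lambda>_. borel)) (\<lambda>\<omega>. \<lambda>k\<in>{1..n}. mra_X f \<tau> n (\<lambda>s. S s \<omega>) I a k) =
    batch_law f \<tau> L C n (node I a)"
    if "addr_ok n a" "node I a \<in> \<tau>" "nchild \<tau> (node I a) = 0" for a f
  proof -
    have J: "node I a \<in> leaves \<tau>" using that by (simp add: leaves_def)
    have lu: "Lf a k \<in> U" if "k \<in> {1..n}" for k
      using Lf_in[OF \<open>addr_ok n a\<close> J that] desc_subset by blast
    have "indep_vars (\<lambda>_. borel) (\<lambda>k \<omega>. S (Lf a k) \<omega> 0) {1..n}"
    proof (rule indep_vars_blocks[OF indep, where K="\<lambda>k. {Lf a k}" and g="\<lambda>k w. w (Lf a k) 0"])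
      show "{Lf a k} \<subseteq> U" if "k \<in> {1..n}" for k using lu[OF that] by blast
      show "disjoint_family_on (\<lambda>k. {Lf a k}) {1..n}" unfolding disjoint_family_on_def by simp
      show "(\<lambda>w. w (Lf a k) 0) \<in> borel_measurable (PiM {Lf a k} Md)" if "k \<in> {1..n}" for k
        by (rule measurable_unit[OF singletonI unit_dom_Lf])
      show "S (Lf a k) \<omega> 0 = (\<lambda>s\<in>{Lf a k}. V s \<omega>) (Lf a k) 0" if "k \<in> {1..n}" for k \<omega>
        by (simp add: V_eq[OF unit_dom_Lf])
    qed
    from indep_vars_distr_PiM[OF this ne] show ?thesis
      unfolding batch_law_leaf[OF that(3)] mra_X_leaf[OF that(3)]
      by (simp only: PiM_cong[OF refl leaf_law[OF lu]])
  qed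
  {
    case 0
    then show ?case by (intro leaf height_le_0)
  next
    case (Suc f)
    show ?case
    proof (cases "nchild \<tau> (node I a) = 0")
      case True
      then show ?thesis by (intro leaf Suc.prems)
    next
      case False
      define N where "N = nchild \<tau> (node I a)"
      have J: "node I a \<in> branching \<tau>" using False Suc.prems(2) by (simp add: branching_def)
      define Bs where "Bs i = batch_law f \<tau> L C n (node I a @ [i])" for i
      have Bs: "distr P (PiM {1..n} (\<lambda>_. borel)) (\<lambda>\<omega>. \<lambda>j\<in>{1..n}. mra_X f \<tau> n (\<lambda>s. S s \<omega>) I (a @ [(l, i)]) j) = Bs i"
        if "l \<in> {1..n}" "i \<in> {1..nchild \<tau> (node I a)}" for l i
        using Suc.IH[OF child_ok[OF Suc.prems(1) J Suc.prems(3) that]] unfolding Bs_def node_snoc .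
      note row = distr_row[OF Suc.prems(1) J Suc.prems(3) _ Bs, folded N_def]
      have ind: "indep_vars (\<lambda>_. PiM {1..N} (\<lambda>_. borel)) (\<lambda>l \<omega>. rows f (\<lambda>s. S s \<omega>) a l) {1..n}"
        unfolding N_def by (rule indep_rows[OF Suc.prems(1) J Suc.prems(3)])
      let ?s = "\<lambda>y :: nat \<Rightarrow> real. \<Sum>i\<in>{1..N}. y i"
      have "indep_vars (\<lambda>_. borel) (\<lambda>l \<omega>. ?s (rows f (\<lambda>s. S s \<omega>) a l)) {1..n}"
        by (rule indep_vars_compose2[OF ind measurable_row_sum])
      from indep_vars_distr_PiM[OF this ne]
      have "distr P (PiM {1..n} (\<lambda>_. borel)) (\<lambda>\<omega>. \<lambda>k\<in>{1..n}. mra_X (Suc f) \<tau> n (\<lambda>s. S s \<omega>) I a k) =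
          PiM {1..n} (\<lambda>k. distr P borel (\<lambda>\<omega>. ?s (rows f (\<lambda>s. S s \<omega>) a k)))"
        unfolding N_def mra_X_branching[OF False] .
      also have "\<dots> = PiM {1..n} (\<lambda>k. distr (row_law n N Bs (C (node I a)) k) borel ?s)"
      proof (rule PiM_cong[OF refl])
        fix k assume k: "k \<in> {1..n}"
        have "distr P (PiM {1..N} (\<lambda>_. borel)) (\<lambda>\<omega>. rows f (\<lambda>s. S s \<omega>) a k) = row_law n N Bs (C (node I a)) k"
          by (rule row[OF k k])
        then show "distr P borel (\<lambda>\<omega>. ?s (rows f (\<lambda>s. S s \<omega>) a k)) = distr (row_law n N Bs (C (node I a)) k) borel ?s"
          using distr_distr[OF measurable_row_sum[of N] indep_vars_rv[OF ind k]] by (simp add: comp_def)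
      qed
      also have "\<dots> = batch_law (Suc f) \<tau> L C n (node I a)"
        using False unfolding N_def Bs_def by simp
      finally show ?thesis .
    qed
  }
qed

end

subsection \<open>Almost sure uniform convergence\<close>

text \<open>Borel--Cantelli for a triangular array: independence is required within each row
  \<open>n\<close> only, since the tail bounds are summable in \<open>n\<close>.\<close>

lemma (in prob_space) AE_emp_tendsto:
  fixes X :: "nat \<Rightarrow> nat \<Rightarrow> 'a \<Rightarrow> 'b"
  assumes X: "\<And>n. 0 < n \<Longrightarrow> indep_vars (\<lambda>_. N) (X n) {1..n}" and B: "B \<in> sets N"
    and lim: "(\<lambda>n. (\<Sum>k\<in>{1..n}. prob (X n k -` B \<inter> space M)) / n) \<longlonglongrightarrow> m"
  shows "AE w in M. (\<lambda>n. emp n B (\<lambda>k. X n k w)) \<longlonglongrightarrow> m"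
proof -
  define avg where "avg n = (\<Sum>k\<in>{1..n}. prob (X n k -` B \<inter> space M)) / n" for n
  have close: "AE w in M. \<forall>\<^sub>F n in sequentially. \<bar>emp n B (\<lambda>k. X n k w) - avg n\<bar> < \<epsilon>" if \<epsilon>: "0 < \<epsilon>" for \<epsilon> :: real
  proof -
    \<comment> \<open>The index 0 is excluded because independence and the tail bound are available
      for positive \<open>n\<close> only.\<close>
    define A where "A n = (if n = 0 then {} else {w\<in>space M. \<epsilon> \<le> \<bar>emp n B (\<lambda>k. X n k w) - avg n\<bar>})" for n
    have A: "A n \<in> events" for n
    proof (cases "n = 0")
      case False
      then have "(\<lambda>w. emp n B (\<lambda>k. X n k w)) \<in> borel_measurable M"
        by (intro measurable_emp[OF indep_vars_rv[OF X] B]) simp_all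
      then show ?thesis using False unfolding A_def by simp
    qed (simp add: A_def)
    have bound: "prob (A n) \<le> 2 * exp (- 2 * real n * \<epsilon>\<^sup>2)" for n
    proof (cases "n = 0")
      case False
      then have n: "0 < n" by simp
      show ?thesis
        using prob_emp_deviation[OF X[OF n] B n less_imp_le[OF \<epsilon>]] False unfolding A_def avg_def by simp
    qed (simp add: A_def)
    have "summable (\<lambda>n. prob (A n))"
      by (rule summable_comparison_test'[OF summable_exp_deviation[OF \<epsilon>], of 0]) (use bound in simp)
    then have "AE w in M. \<forall>\<^sub>F n in sequentially. w \<in> space M - A n"
      by (intro borel_cantelli_AE1 A) (simp_all add: emeasure_eq_measure)
    then show ?thesis
    proof eventually_elim
      case (elim w)
      then show ?case using eventually_gt_at_top[of 0]
      proof eventually_elim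
        case (elim n)
        then show ?case by (auto simp: A_def not_le)
      qed
    qed
  qed
  \<comment> \<open>Countably many thresholds suffice, so their exceptional sets unite to a null
    set.\<close>
  have "AE w in M. \<forall>j::nat. \<forall>\<^sub>F n in sequentially. \<bar>emp n B (\<lambda>k. X n k w) - avg n\<bar> < inverse (real (Suc j))"
    unfolding AE_all_countable by (intro allI close) simp
  then show ?thesis
  proof eventually_elim
    case (elim w)
    have "(\<lambda>n. emp n B (\<lambda>k. X n k w) - avg n) \<longlonglongrightarrow> 0"
    proof (rule tendstoI)
      fix e :: real assume "0 < e"
      then obtain j where "inverse (real (Suc j)) < e" using reals_Archimedean by blast
      then show "\<forall>\<^sub>F n in sequentially. dist (emp n B (\<lambda>k. X n k w) - avg n) 0 < e"
        using elim[rule_format, of j] by (auto elim!: eventually_mono simp: dist_real_def)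
    qed
    then show ?case using tendsto_add[OF _ lim[folded avg_def]] by fastforce
  qed
qed

lemma emp_Un_disjoint: "A \<inter> B = {} \<Longrightarrow> emp n (A \<union> B) y = emp n A y + emp n B y"
proof -
  assume "A \<inter> B = {}"
  then have "indicat_real (A \<union> B) x = indicat_real A x + indicat_real B x" for x
    by (auto simp: indicator_def)
  then show ?thesis unfolding emp_eq_sum by (simp add: sum.distrib add_divide_distrib)
qed

lemma emp_finite: "finite A \<Longrightarrow> emp n A y = (\<Sum>a\<in>A. emp n {a} y)"
proof (induction A rule: finite_induct)
  case (insert a A)
  then show ?case using emp_Un_disjoint[of "{a}" A n y] by simp
qed (simp add: emp_def)

text \<open>A Scheffe-type argument: convergence of the mass of every atom of a discrete law leaves
  no mass to escape, so the convergence is in total variation.\<close>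

lemma (in prob_space) emp_uniform_convergence:
  assumes D: "countable D" "AE y in M. y \<in> D" "\<And>d. d \<in> D \<Longrightarrow> {d} \<in> events"
    and lim: "\<And>d. d \<in> D \<Longrightarrow> (\<lambda>n. emp n {d} (y n)) \<longlonglongrightarrow> prob {d}" and \<epsilon>: "0 < \<epsilon>"
  shows "\<forall>\<^sub>F n in sequentially. \<forall>B\<in>events. \<bar>emp n B (y n) - prob B\<bar> \<le> \<epsilon>"
proof -
  \<comment> \<open>Inside \<open>A\<close> the error is at most \<open>s n\<close>; outside, the
    two masses are at most \<open>prob (space M - A) + s n\<close>. Three terms below \<epsilon> / 4
    result.\<close>
  have "0 < \<epsilon> / 4" using \<epsilon> by simp
  then obtain A where A: "finite A" "A \<subseteq> D" "prob (space M - A) < \<epsilon> / 4"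
    using finite_approx_countable_support[OF D] by blast
  have sing: "{a} \<in> events" if "a \<in> A" for a using A(2) D(3) that by blast
  have A_ev: "A \<in> events"
    by (rule sets.countable[OF sing countable_finite[OF A(1)]])
  define s where "s n = (\<Sum>a\<in>A. \<bar>emp n {a} (y n) - prob {a}\<bar>)" for n
  have "s \<longlonglongrightarrow> (\<Sum>a\<in>A. \<bar>prob {a} - prob {a}\<bar>)"
    unfolding s_def using A(2) by (intro tendsto_sum tendsto_rabs tendsto_diff tendsto_const lim) blast
  then have "s \<longlonglongrightarrow> 0" by simp
  then have "\<forall>\<^sub>F n in sequentially. s n < \<epsilon> / 4"
    using \<open>0 < \<epsilon> / 4\<close> by (rule order_tendstoD(2))
  then show ?thesis
  proof eventually_elim
    case (elim n)
    have part: "\<bar>emp n E (y n) - prob E\<bar> \<le> s n" if "E \<subseteq> A" for E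
    proof -
      have E: "finite E" using that A(1) by (rule finite_subset)
      have "prob E = (\<Sum>a\<in>E. prob {a})"
        by (rule finite_measure_eq_sum_singleton[OF E]) (use that sing in blast)
      then have "\<bar>emp n E (y n) - prob E\<bar> = \<bar>\<Sum>a\<in>E. emp n {a} (y n) - prob {a}\<bar>"
        by (simp add: emp_finite[OF E] sum_subtractf)
      also have "\<dots> \<le> (\<Sum>a\<in>E. \<bar>emp n {a} (y n) - prob {a}\<bar>)" by (rule sum_abs)
      also have "\<dots> \<le> s n" unfolding s_def by (rule sum_mono2[OF A(1) that]) simp
      finally show ?thesis .
    qed
    have pA: "prob A > 1 - \<epsilon> / 4" using A(3) prob_compl[OF A_ev] by simp
    show ?case
    proof
      fix B assume B: "B \<in> events"
      have disj: "(B - A) \<inter> A = {}" by blast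
      have "emp n B (y n) = emp n (B \<inter> A) (y n) + emp n (B - A) (y n)"
        using emp_Un_disjoint[of "B \<inter> A" "B - A" n "y n"] by (simp add: Int_Diff_disjoint Int_Diff_Un)
      \<comment> \<open>The empirical mass outside \<open>A\<close> is controlled through its
        complement: \<open>A\<close> already carries almost everything.\<close>
      moreover have "emp n (B - A) (y n) + emp n A (y n) \<le> 1"
        using emp_Un_disjoint[OF disj, of n "y n"] emp_le_1[of n "(B - A) \<union> A" "y n"] by simp
      moreover have "0 \<le> emp n (B - A) (y n)" by (rule emp_nonneg)
      moreover have "prob B = prob (B \<inter> A) + prob (B - A)"
        using finite_measure_Union[of "B \<inter> A" "B - A"] B A_ev by (simp add: Int_Diff_disjoint Int_Diff_Un)
      moreover have "prob (B - A) + prob A \<le> 1"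
        using finite_measure_Union[OF _ _ disj] B A_ev prob_le_1[of "(B - A) \<union> A"] by simp
      moreover have "0 \<le> prob (B - A)" by simp
      moreover have "\<bar>emp n (B \<inter> A) (y n) - prob (B \<inter> A)\<bar> \<le> s n" "\<bar>emp n A (y n) - prob A\<bar> \<le> s n"
        by (rule part, blast)+
      ultimately show "\<bar>emp n B (y n) - prob B\<bar> \<le> \<epsilon>"
        using pA elim by linarith
    qed
  qed
qed

lemma SUP_abs_tendsto_zero:
  fixes g :: "nat \<Rightarrow> 'x \<Rightarrow> real"
  assumes "\<And>\<epsilon>. 0 < \<epsilon> \<Longrightarrow> \<forall>\<^sub>F n in sequentially. \<forall>x. \<bar>g n x\<bar> \<le> \<epsilon>"
  shows "(\<lambda>n. SUP x. \<bar>g n x\<bar>) \<longlonglongrightarrow> 0"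
proof (rule tendstoI)
  fix e :: real assume e: "0 < e"
  then have "\<forall>\<^sub>F n in sequentially. \<forall>x. \<bar>g n x\<bar> \<le> e / 2" by (intro assms) simp
  then show "\<forall>\<^sub>F n in sequentially. dist (SUP x. \<bar>g n x\<bar>) 0 < e"
  proof eventually_elim
    case (elim n)
    have "(SUP x. \<bar>g n x\<bar>) \<le> e / 2" using elim by (intro cSUP_least) simp_all
    moreover have "bdd_above (range (\<lambda>x. \<bar>g n x\<bar>))"
      by (rule bdd_aboveI2[where M="e/2"]) (use elim in blast)
    \<comment> \<open>Any point serves to show that the supremum is nonnegative.\<close>
    then have "\<bar>g n undefined\<bar> \<le> (SUP x. \<bar>g n x\<bar>)" by (rule cSUP_upper[OF UNIV_I])
    then have "0 \<le> (SUP x. \<bar>g n x\<bar>)" by (rule order_trans[OF abs_ge_zero])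
    ultimately show ?case using e by (simp add: dist_real_def)
  qed
qed

theorem theorem4p1:
  fixes \<tau> :: "nat list set"
    and L :: "nat list \<Rightarrow> real measure"
    and C :: "nat list \<Rightarrow> (nat \<Rightarrow> real) measure"
    and c :: "nat list \<Rightarrow> (nat \<Rightarrow> real) \<Rightarrow> real"
    and F :: "nat list \<Rightarrow> real \<Rightarrow> real"
    and P :: "'w measure"
    and S :: "nat \<Rightarrow> sidx \<Rightarrow> 'w \<Rightarrow> nat \<Rightarrow> real"
    and I :: "nat list"
  assumes tree: "agg_tree \<tau>"
    and leaf_laws: "\<forall>J\<in>leaves \<tau>. real_distribution (L J) \<and> discrete_distr (L J)"
    and copulas: "\<forall>J\<in>branching \<tau>. is_copula (nchild \<tau> J) (C J)"
    and densities: "\<forall>J\<in>branching \<tau>. (\<forall>u. 0 \<le> c J u) \<and>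
        c J \<in> borel_measurable (PiM {1..nchild \<tau> J} (\<lambda>_. lborel)) \<and>
        C J = density (PiM {1..nchild \<tau> J} (\<lambda>_. lborel)) (\<lambda>u. ennreal (c J u))"
    and model: "agg_F \<tau> L C F"
    and boundary: "\<forall>J\<in>branching \<tau>.
        ((\<lambda>\<delta>. \<Squnion>t. \<integral>\<^sup>+ u \<in> U_nbhd (nchild \<tau> J) \<delta> (B_set \<tau> F J t). ennreal (c J u)
                     \<partial>(PiM {1..nchild \<tau> J} (\<lambda>_. lborel))) \<longlongrightarrow> 0) (at_right 0)"
    and P: "prob_space P"
    and samples: "\<forall>n. mra_samples \<tau> L C P I n (S n)"
    and I: "I \<in> branching \<tau>"
  shows "(AE \<omega> in P. (\<lambda>n. SUP x. \<bar>emp_G \<tau> n (\<lambda>s. S n s \<omega>) I x - G_fun \<tau> C F I x\<bar>)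
                         \<longlonglongrightarrow> 0) \<and>
         (AE \<omega> in P. (\<lambda>n. SUP t. \<bar>emp_F \<tau> n (\<lambda>s. S n s \<omega>) I t - F I t\<bar>) \<longlonglongrightarrow> 0)"
proof -
  interpret P: prob_space P by (rule P)
  have leaf': "\<forall>J\<in>leaves \<tau>. real_distribution (L J)" using leaf_laws by blast
  obtain \<mu> where \<mu>: "tree_laws \<tau> L C \<mu>"
    and G: "\<And>J x. J \<in> branching \<tau> \<Longrightarrow> G_fun \<tau> C F J x =
       measure (node_law \<tau> C \<mu> J) {y\<in>space (node_law \<tau> C \<mu> J). \<forall>i\<in>{1..nchild \<tau> J}. y i \<le> x i}"
    and F: "\<And>J t. J \<in> branching \<tau> \<Longrightarrow> F J t =
       measure (node_law \<tau> C \<mu> J) {y\<in>space (node_law \<tau> C \<mu> J). (\<Sum>i\<in>{1..nchild \<tau> J}. y i) \<le> t}"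
    by (rule tree_laws_exist[OF tree leaf' copulas model]) (rule that)
  define N where "N = nchild \<tau> I"
  \<comment> \<open>The fuel with which \<open>mra_Y\<close> evaluates the children of
    \<open>I\<close>; \<open>emp_F\<close> starts one level higher with
    \<open>Suc f\<close>.\<close>
  define f where "f = card \<tau>"
  define K where "K = PiM {1..N} (\<lambda>_. borel :: real measure)"
  define \<nu> where "\<nu> i = \<mu> (I @ [i])" for i
  define M where "M = distr (C I) K (qvec N \<nu>)"
  have M_eq: "node_law \<tau> C \<mu> I = M" by (simp add: node_law_def M_def K_def N_def \<nu>_def[abs_def])
  have sM: "space M = PiE {1..N} (\<lambda>_. UNIV)" "sets M = sets K" by (simp_all add: M_def K_def space_PiM)
  have IT: "I \<in> \<tau>" using I by (simp add: branching_def)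
  have h: "height_le \<tau> J f" for J
    using height_le_card[OF tree, of J] unfolding height_le_def f_def by fastforce
  then have h': "height_le \<tau> I (Suc f)" unfolding height_le_def by (simp add: le_Suc_eq)
  have C: "is_copula N (C I)" using copulas I by (simp add: N_def)
  have child: "I @ [i] \<in> \<tau>" if "i \<in> {1..N}" for i
    using agg_tree_child[OF tree IT] that unfolding N_def .
  have rd: "real_distribution (\<nu> i)" if "i \<in> {1..N}" for i
    using \<mu> child[OF that] by (simp add: tree_laws_def \<nu>_def)
  define Bs where "Bs n i = batch_law f \<tau> L C n (I @ [i])" for n i
  note correct = batch_law_correct[OF tree leaf_laws copulas \<mu> child h]
  have dd: "discrete_distr (\<nu> i)" if "i \<in> {1..N}" for i
    using correct[OF that] unfolding \<nu>_def by blast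
  have Bs: "prob_space (Bs n i)" "sets (Bs n i) = sets (PiM {1..n} (\<lambda>_. borel))" if "i \<in> {1..N}" for n i
    using correct[OF that] unfolding Bs_def by blast+
  have dev: "(\<lambda>n. \<integral>x. \<bar>emp n E x - measure (\<nu> i) E\<bar> \<partial>Bs n i) \<longlonglongrightarrow> 0"
    if "i \<in> {1..N}" "E \<in> sets borel" for i E
    using correct[OF that(1)] that(2) unfolding Bs_def \<nu>_def by blast
  interpret M: prob_space M
    unfolding M_def K_def by (rule prob_space.prob_space_distr[OF copula_prob_space[OF C] measurable_qvec[OF C rd]])
  define row where "row n k \<omega> = mra_run.rows \<tau> I n f (\<lambda>s. S n s \<omega>) [] k" for n k \<omega>
  have run: "mra_run P \<tau> L C I n (S n)" if "0 < n" for n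
    using P tree copulas samples that by (simp add: mra_run_def mra_run_axioms_def)
  have row_eq: "row n k \<omega> = mra_rows n N (\<lambda>i j. mra_X f \<tau> n (\<lambda>s. S n s \<omega>) I [(k, i)] j) (\<lambda>j. S n (Cop [] k j) \<omega>) k"
    if "0 < n" for n k \<omega>
    unfolding row_def mra_run.rows_def[OF run[OF that]] by (simp add: N_def node_def)
  \<comment> \<open>Addresses are relative to \<open>I\<close>: the empty address is the call at
    \<open>I\<close> itself, wherever \<open>I\<close> lies in the tree.\<close>
  have root: "addr_ok n []" "node I [] = I" for n by (simp_all add: addr_ok_def node_def)
  have indep: "P.indep_vars (\<lambda>_. K) (row n) {1..n}" if n: "0 < n" for n
    using mra_run.indep_rows[OF run[OF n] root(1), unfolded root(2), OF I h']
    unfolding row_def[abs_def] K_def N_def .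
  have law: "distr P K (row n k) = row_law n N (Bs n) (C I) k" if n: "0 < n" and k: "k \<in> {1..n}" for n k
  proof -
    have "distr P (PiM {1..n} (\<lambda>_. borel)) (\<lambda>\<omega>. \<lambda>j\<in>{1..n}. mra_X f \<tau> n (\<lambda>s. S n s \<omega>) I ([] @ [(k, i)]) j) = Bs n i"
      if i: "i \<in> {1..nchild \<tau> (node I [])}" for i
    proof -
      have "addr_ok n ([] @ [(k, i)])" using k by (simp add: addr_ok_def)
      moreover have nd: "node I ([] @ [(k, i)]) = I @ [i]" by (simp add: node_def)
      moreover have "I @ [i] \<in> \<tau>" using child i unfolding root(2) N_def by blast
      ultimately show ?thesis
        using mra_run.distr_batch[OF run[OF n], of "[] @ [(k, i)]" f] h unfolding Bs_def by simp
    qed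
    then show ?thesis
      using mra_run.distr_row[OF run[OF n] root(1), unfolded root(2), OF I h' k, of "Bs n"]
      unfolding row_def[abs_def] K_def N_def root(2) by blast
  qed
  have AE_B: "AE \<omega> in P. (\<lambda>n. emp n B (\<lambda>k. row n k \<omega>)) \<longlonglongrightarrow> M.prob B" if B: "B \<in> sets K" for B
  proof (rule P.AE_emp_tendsto[OF indep B])
    have "(\<lambda>n. (\<Sum>k\<in>{1..n}. measure (row_law n N (Bs n) (C I) k) B) / n) \<longlonglongrightarrow> M.prob B"
      unfolding M_def K_def by (rule row_law_avg_tendsto[OF C rd dd Bs dev B[unfolded K_def]])
    moreover have "(\<Sum>k\<in>{1..n}. measure (row_law n N (Bs n) (C I) k) B) = (\<Sum>k\<in>{1..n}. P.prob (row n k -` B \<inter> space P))" for n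
    proof (rule sum.cong[OF refl])
      fix k assume k: "k \<in> {1..n}"
      then have n: "0 < n" by auto
      show "measure (row_law n N (Bs n) (C I) k) B = P.prob (row n k -` B \<inter> space P)"
        unfolding law[OF n k, symmetric] by (rule measure_distr[OF P.indep_vars_rv[OF indep[OF n] k] B])
    qed
    ultimately show "(\<lambda>n. (\<Sum>k\<in>{1..n}. P.prob (row n k -` B \<inter> space P)) / n) \<longlonglongrightarrow> M.prob B" by simp
  qed
  have "\<exists>D. countable D \<and> D \<subseteq> PiE {1..N} (\<lambda>_. UNIV) \<and> (AE y in M. y \<in> D)"
    unfolding M_def K_def by (rule copula_law_countable_support[OF C rd dd])
  then obtain D where D: "countable D" "D \<subseteq> PiE {1..N} (\<lambda>_. UNIV)" "AE y in M. y \<in> D"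
    by blast
  \<comment> \<open>Since \<open>D\<close> consists of points of the product space, a singleton is a
    finite product of singletons and hence measurable.\<close>
  have sing: "{d} \<in> sets K" if "d \<in> D" for d
  proof -
    have "d \<in> PiE {1..N} (\<lambda>_. UNIV)" using that D(2) by blast
    then have "{d} = PiE {1..N} (\<lambda>i. {d i})" by (intro PiE_singleton[symmetric]) (rule PiE_iff[THEN iffD1, THEN conjunct2])
    also have "\<dots> \<in> sets K" unfolding K_def by (rule sets_PiM_I_finite) simp_all
    finally show ?thesis .
  qed
  \<comment> \<open>The null set in \<open>AE_B\<close> depends on the set; only those of the
    countably many atoms are united.\<close>
  have "AE \<omega> in P. \<forall>d\<in>D. (\<lambda>n. emp n {d} (\<lambda>k. row n k \<omega>)) \<longlonglongrightarrow> M.prob {d}"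
    by (rule AE_ball_countable'[OF AE_B[OF sing] D(1)])
  \<comment> \<open>Both claims are instances of this uniformity over Borel sets: lower orthants
    give the one for G, half-spaces for the coordinate sum the one for F.\<close>
  then have main: "AE \<omega> in P. \<forall>\<epsilon>>0. \<forall>\<^sub>F n in sequentially. \<forall>B\<in>sets M. \<bar>emp n B (\<lambda>k. row n k \<omega>) - M.prob B\<bar> \<le> \<epsilon>"
  proof eventually_elim
    case (elim \<omega>)
    show ?case
    proof (intro allI impI)
      fix \<epsilon> :: real assume "0 < \<epsilon>"
      then show "\<forall>\<^sub>F n in sequentially. \<forall>B\<in>sets M. \<bar>emp n B (\<lambda>k. row n k \<omega>) - M.prob B\<bar> \<le> \<epsilon>"
        by (rule M.emp_uniform_convergence[OF D(1,3), rotated 2])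
          (use sing sM(2) elim in blast)+
    qed
  qed
  have row_space: "row n k \<omega> \<in> space M" if "0 < n" for n k \<omega>
    unfolding row_eq[OF that] sM(1) mra_rows_def by (rule restrict_PiE_iff[THEN iffD2]) simp
  have emp_G_eq: "emp_G \<tau> n (\<lambda>s. S n s \<omega>) I x = emp n {y\<in>space M. \<forall>i\<in>{1..N}. y i \<le> x i} (\<lambda>k. row n k \<omega>)"
    if n: "0 < n" for n \<omega> x
  proof -
    have "mra_Y \<tau> n (\<lambda>s. S n s \<omega>) I k i = row n k \<omega> i" if "i \<in> {1..N}" for k i
      using that by (simp add: row_eq[OF n] mra_rows_def mra_Y_def f_def)
    then show ?thesis
      unfolding emp_G_def emp_def N_def[symmetric] by (simp add: row_space[OF n])
  qed
  have emp_F_eq: "emp_F \<tau> n (\<lambda>s. S n s \<omega>) I t = emp n {y\<in>space M. (\<Sum>i\<in>{1..N}. y i) \<le> t} (\<lambda>k. row n k \<omega>)"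
    if n: "0 < n" for n \<omega> t
  proof -
    have "nchild \<tau> (node I []) \<noteq> 0" using I by (simp add: root branching_def)
    then have "mra_X (Suc f) \<tau> n (\<lambda>s. S n s \<omega>) I [] k = (\<Sum>i\<in>{1..N}. row n k \<omega> i)" for k
      using mra_run.mra_X_branching[OF run[OF n], of "[]" f] unfolding row_def N_def root(2) by blast
    then show ?thesis
      unfolding emp_F_def emp_def f_def[symmetric] by (simp add: row_space[OF n])
  qed
  have setG: "{y\<in>space M. \<forall>i\<in>{1..N}. y i \<le> x i} \<in> sets M" for x :: "nat \<Rightarrow> real"
  proof -
    have "{y\<in>space K. \<forall>i\<in>{1..N}. y i \<le> x i} \<in> sets K" unfolding K_def by measurable
    then show ?thesis by (simp add: M_def)
  qed
  have setF: "{y\<in>space M. (\<Sum>i\<in>{1..N}. y i) \<le> t} \<in> sets M" for t :: real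
  proof -
    have "{y\<in>space K. (\<Sum>i\<in>{1..N}. y i) \<le> t} \<in> sets K"
      unfolding K_def by (intro borel_measurable_le measurable_row_sum) simp
    then show ?thesis by (simp add: M_def)
  qed
  show ?thesis
  proof
    show "AE \<omega> in P. (\<lambda>n. SUP x. \<bar>emp_G \<tau> n (\<lambda>s. S n s \<omega>) I x - G_fun \<tau> C F I x\<bar>) \<longlonglongrightarrow> 0"
      using main
    proof eventually_elim
      case (elim \<omega>)
      show ?case
      proof (rule SUP_abs_tendsto_zero)
        fix \<epsilon> :: real assume "0 < \<epsilon>"
        then have "\<forall>\<^sub>F n in sequentially. \<forall>B\<in>sets M. \<bar>emp n B (\<lambda>k. row n k \<omega>) - M.prob B\<bar> \<le> \<epsilon>"
          using elim by blast
        then show "\<forall>\<^sub>F n in sequentially. \<forall>x. \<bar>emp_G \<tau> n (\<lambda>s. S n s \<omega>) I x - G_fun \<tau> C F I x\<bar> \<le> \<epsilon>"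
          using eventually_gt_at_top[of 0]
        proof eventually_elim
          case (elim n)
          show ?case
            unfolding G[OF I] M_eq N_def[symmetric] emp_G_eq[OF elim(2)] using elim(1) setG by blast
        qed
      qed
    qed
    show "AE \<omega> in P. (\<lambda>n. SUP t. \<bar>emp_F \<tau> n (\<lambda>s. S n s \<omega>) I t - F I t\<bar>) \<longlonglongrightarrow> 0"
      using main
    proof eventually_elim
      case (elim \<omega>)
      show ?case
      proof (rule SUP_abs_tendsto_zero)
        fix \<epsilon> :: real assume "0 < \<epsilon>"
        then have "\<forall>\<^sub>F n in sequentially. \<forall>B\<in>sets M. \<bar>emp n B (\<lambda>k. row n k \<omega>) - M.prob B\<bar> \<le> \<epsilon>"
          using elim by blast
        then show "\<forall>\<^sub>F n in sequentially. \<forall>t. \<bar>emp_F \<tau> n (\<lambda>s. S n s \<omega>) I t - F I t\<bar> \<le> \<epsilon>"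
          using eventually_gt_at_top[of 0]
        proof eventually_elim
          case (elim n)
          show ?case
            unfolding F[OF I] M_eq N_def[symmetric] emp_F_eq[OF elim(2)] using elim(1) setF by blast
        qed
      qed
    qed
  qed
qed

end
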